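(* There exists a constant $L^\ast\in\mathbb{N}$, not depending on $a,b,\mu$, such that for all $a,b,\mu\in\mathbb{R}$ the equation $x'=f(x)+\mu\sin t$ has no more than $L^\ast$ limit cycles.
   Context: For $a,b\in\mathbb{R}$, the function $f:\mathbb{R}\to\mathbb{R}$ is the continuous odd piecewise linear function $$f(x)=\begin{cases} ax+(a-b), & x\le -1,\\ bx, & -1<x<1,\\ ax+(b-a), & x\ge 1.\end{cases}$$ For $\mu\in\mathbb{R}$, consider the scalar $2\pi$-periodic differential equation $x'=f(x)+\mu\sin t$, whose solutions are all defined on $\mathbb{R}$. "Periodic solution" means $2\pi$-periodic solution (constant solutions are included). A limit cycle is an isolated periodic solution, i.e. its value $x$ at $t=0$ is an isolated zero of the displacement function $d(x)=u(2\pi,x)-x$, where $u(t,x)$ is the solution with $u(0,x)=x$. *)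

theory Defs
  imports "HOL-Analysis.Analysis"
begin

definition pwl :: "real \<Rightarrow> real \<Rightarrow> real \<Rightarrow> real" where
  "pwl a b x =
     (if x \<le> -1 then a * x + (a - b)
      else if x < 1 then b * x
      else a * x + (b - a))"

definition solution :: "real \<Rightarrow> real \<Rightarrow> real \<Rightarrow> (real \<Rightarrow> real) \<Rightarrow> bool" where
  "solution a b \<mu> v \<longleftrightarrow>
     (\<forall>t. (v has_real_derivative (pwl a b (v t) + \<mu> * sin t)) (at t))"

text \<open>The right-hand side of the equation is globally Lipschitz in the state variable, so for
  each initial value there is exactly one solution, defined on the whole real line. The definite
  description below is therefore always meaningful.\<close>

definition flow :: "real \<Rightarrow> real \<Rightarrow> real \<Rightarrow> real \<Rightarrow> real \<Rightarrow> real" where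
  "flow a b \<mu> t x = (THE v. solution a b \<mu> v \<and> v 0 = x) t"

definition displacement :: "real \<Rightarrow> real \<Rightarrow> real \<Rightarrow> real \<Rightarrow> real" where
  "displacement a b \<mu> x = flow a b \<mu> (2 * pi) x - x"

definition periodic_solution :: "real \<Rightarrow> real \<Rightarrow> real \<Rightarrow> (real \<Rightarrow> real) \<Rightarrow> bool" where
  "periodic_solution a b \<mu> v \<longleftrightarrow> solution a b \<mu> v \<and> (\<forall>t. v (t + 2 * pi) = v t)"

definition limit_cycle :: "real \<Rightarrow> real \<Rightarrow> real \<Rightarrow> (real \<Rightarrow> real) \<Rightarrow> bool" where
  "limit_cycle a b \<mu> v \<longleftrightarrow>
     periodic_solution a b \<mu> v \<and> v 0 isolated_in {x. displacement a b \<mu> x = 0}"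

end

theory Submission
  imports Defs
begin

text \<open>A periodic solution staying in \<open>x \<ge> -1\<close> or in \<open>x \<le> 1\<close> only sees a convex or a concave
  nonlinearity, and at most two such solutions are isolated. A periodic solution crossing both lines
  \<open>x = 1\<close> and \<open>x = -1\<close> does so at exactly four times per period, because each line is crossed upwards
  and downwards on complementary arcs of the time circle. Consecutive crossing times satisfy
  \<open>K (t) = K' (t')\<close> with \<open>K\<close>, \<open>K'\<close> an exponential times a trigonometric polynomial; differentiating and
  eliminating the exponentials, the half-angle tangents of the crossing times form a triangular chain
  of rational differential equations. For such chains, zeros of polynomials are bounded uniformly in all
  coefficients by induction on the degree \<open>m\<close> in the last variable: pseudo-division writes the
  derivative of \<open>q\<close> as \<open>c\<^sup>k e q' = A q + r\<close> with \<open>r\<close> of degree less than \<open>m\<close>, so between zeros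
  of \<open>c\<close>, \<open>e\<close>, \<open>r\<close> all zeros of \<open>q\<close> are crossed in the same direction and there is at most one. Applied
  to the difference of first and fifth crossing times, this bounds the isolated periodic solutions.\<close>

section \<open>Preliminaries on real functions\<close>

text \<open>Periodic solutions may form continua, and a polynomial in the chain may vanish
  identically on an interval, so a plain bound on the number of zeros would be false. What is
  propagated is constancy of the sign, zero included, off a finite set of bounded size; in the chain
  argument isolation enters only at the end, to exclude intervals of zeros. The second obstacle is
  uniformity in \<open>a\<close>, \<open>b\<close>, \<mu>: the coefficient ring contains every
  function of the parameters, so they never enter a degree or a count. The third is that a solution
  need not cross the lines in the pattern of a given one. Only solutions squeezed between two cycles
  that cross both lines are considered; they inherit the pattern, and setting the outer two aside
  costs a constant. The case \<open>a = 0\<close>, where the quotient \<open>b / a\<close> is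
  meaningless, is disposed of separately: the vector field is then monotone.\<close>

lemma card_interleaved:
  fixes E F :: "real set"
  assumes "finite F"
    and sep: "\<And>x y. x \<in> E \<Longrightarrow> y \<in> E \<Longrightarrow> x < y \<Longrightarrow> \<exists>f\<in>F. x \<le> f \<and> f < y"
  shows "finite E \<and> card E \<le> card F + 1"
proof -
  \<comment> \<open>The number of separators strictly below \<open>x\<close> is a strictly
    increasing label on \<open>E\<close> with values in \<open>0, ..., card F\<close>, hence the
    bound \<open>card F + 1\<close>.\<close>
  define c where "c x = card {f\<in>F. f < x}" for x
  have less: "c x < c y" if "x \<in> E" "y \<in> E" "x < y" for x y
  proof -
    from sep[OF that] obtain f where "f \<in> F" "x \<le> f" "f < y" by blast
    then have "{f\<in>F. f < x} \<subseteq> {f\<in>F. f < y}" "f \<in> {f\<in>F. f < y} - {f\<in>F. f < x}"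
      using that(3) by auto
    then have "{f\<in>F. f < x} \<subset> {f\<in>F. f < y}" by blast
    then show ?thesis unfolding c_def using assms(1) by (intro psubset_card_mono) auto
  qed
  have inj: "inj_on c E"
    by (rule inj_onI) (metis less less_irrefl linorder_neqE_linordered_idom)
  have img: "c ` E \<subseteq> {..card F}"
    using assms(1) by (auto simp: c_def intro!: card_mono)
  have "finite E" using finite_imageD[OF finite_subset[OF img] inj] by simp
  moreover have "card E \<le> card {..card F}"
    using card_inj_on_le[OF inj img] by simp
  ultimately show ?thesis by simp
qed

text \<open>The dynamical arguments only count elements strictly between two given ones; the outer
  two cost the summand 2. Passing to finite subsets supplies a minimum and a maximum before
  \<open>X\<close> is known to be finite.\<close>

lemma card_le_of_between:
  fixes X :: "real set"
  assumes "\<And>l h. l \<in> X \<Longrightarrow> h \<in> X \<Longrightarrow> l < h \<Longrightarrow> finite (X \<inter> {l<..<h}) \<and> card (X \<inter> {l<..<h}) \<le> N"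
  shows "finite X \<and> card X \<le> N + 2"
proof (rule finite_if_finite_subsets_card_bdd)
  fix G assume G: "G \<subseteq> X" "finite G"
  show "card G \<le> N + 2"
  proof (cases "G = {}")
    case False
    define l h where "l = Min G" and "h = Max G"
    have lh: "l \<in> G" "h \<in> G" "\<And>x. x \<in> G \<Longrightarrow> l \<le> x \<and> x \<le> h"
      using False G(2) by (auto simp: l_def h_def)
    show ?thesis
    proof (cases "l < h")
      case True
      note * = assms[of l h] 
      have "G \<subseteq> insert l (insert h (X \<inter> {l<..<h}))" using G(1) lh(3) by force
      then have "card G \<le> card (insert l (insert h (X \<inter> {l<..<h})))"
        using * lh G True by (intro card_mono) auto
      also have "\<dots> \<le> N + 2" using * lh G True
        by (auto intro!: order_trans[OF card_insert_le_m1])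
      finally show ?thesis .
    next
      case False
      then have "G \<subseteq> {l}" using lh by force
      then have "card G \<le> card {l}" by (intro card_mono) auto
      then show ?thesis by simp
    qed
  qed simp
qed

text \<open>At a first return to \<open>q \<le> 0\<close> the function would come down to zero,
  against the positive derivative there. Constraining the derivative only at zeros of
  \<open>q\<close> suits both the Rolle step and transversal crossings of a line.\<close>

lemma first_crossing_up:
  fixes q q' :: "real \<Rightarrow> real"
  assumes "s < t"
    and der: "\<And>r. r \<in> {s..t} \<Longrightarrow> (q has_real_derivative q' r) (at r)"
    and up: "\<And>r. r \<in> {s..t} \<Longrightarrow> q r = 0 \<Longrightarrow> q' r > 0"
    and "q s \<ge> 0"
  shows "q t > 0"
proof (rule ccontr)
  assume "\<not> q t > 0"
  have cont: "continuous_on {s..t} q"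
    using der by (meson DERIV_continuous_on has_field_derivative_at_within)
  have "\<exists>r. r \<in> {s<..t} \<and> q r > 0"
  proof (cases "q s = 0")
    case True
    from DERIV_pos_inc_right[OF der[of s] up[of s]] True assms(1)
    obtain d where d: "d > 0" "\<And>h. 0 < h \<Longrightarrow> h < d \<Longrightarrow> q s < q (s + h)" by auto
    define h where "h = min (d/2) (t - s)"
    have "0 < h" "h < d" "s + h \<le> t" using d assms(1) by (auto simp: h_def)
    then show ?thesis using d(2)[of h] True by (intro exI[of _ "s + h"]) auto
  next
    case False
    then have pos: "q s > 0" using assms(4) by simp
    have "isCont q s" using der[of s] assms(1) DERIV_isCont by auto
    then have "\<forall>\<^sub>F x in at s. q x > 0"
      using pos by (metis isCont_def order_tendstoD(1))
    then obtain d where d: "d > 0" "\<And>x. x \<noteq> s \<Longrightarrow> dist x s < d \<Longrightarrow> q x > 0"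
      by (auto simp: eventually_at)
    define x where "x = min (s + d/2) t"
    have "x \<noteq> s" "dist x s < d" "x \<in> {s<..t}" using d assms(1) by (auto simp: x_def dist_real_def)
    then show ?thesis using d by blast
  qed
  then obtain r0 where r0: "r0 \<in> {s<..t}" "q r0 > 0" by blast
  define A where "A = {r\<in>{r0..t}. q r \<le> 0}"
  have "closed A"
  proof -
    have "continuous_on {r0..t} q" using cont r0 by (auto intro: continuous_on_subset)
    then have "closed ({r0..t} \<inter> q -` {..0})"
      by (intro continuous_closed_preimage) auto
    then show ?thesis by (simp add: A_def vimage_def Int_def)
  qed
  moreover have A: "A \<noteq> {}" "bdd_below A" using r0 \<open>\<not> q t > 0\<close> by (auto simp: A_def not_less)
  ultimately have inA: "Inf A \<in> A" by (intro closed_contains_Inf)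
  define m where "m = Inf A"
  have m: "m \<in> {r0..t}" "q m \<le> 0" using inA by (auto simp: A_def m_def)
  have "m > r0" using m r0 by (cases "m = r0") auto
  have before: "q r > 0" if "r0 \<le> r" "r < m" for r
  proof (rule ccontr)
    assume "\<not> q r > 0"
    then have "r \<in> A" using that m by (auto simp: A_def)
    then have "m \<le> r" unfolding m_def by (intro cInf_lower A)
    then show False using that by simp
  qed
  have "\<exists>x\<ge>r0. x \<le> m \<and> q x = 0"
    using m r0 \<open>m > r0\<close> cont by (intro IVT2') (auto intro: continuous_on_subset)
  then have q0: "q m = 0" using before m by (metis less_eq_real_def less_irrefl)
  from DERIV_pos_inc_left[OF der[of m] up[of m]] q0 m r0
  obtain d where d: "d > 0" "\<And>h. 0 < h \<Longrightarrow> h < d \<Longrightarrow> q (m - h) < q m" by auto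
  define h where "h = min (d/2) (m - r0)"
  have "0 < h" "h < d" "m - h \<ge> r0" using d \<open>m > r0\<close> by (auto simp: h_def)
  then show False using d(2)[of h] q0 before[of "m - h"] by auto
qed

text \<open>Counterpart of the strict crossing argument for a barrier whose rate may vanish. After
  the last time with \<open>w \<ge> 0\<close>, the product of \<open>w\<close> with
  \<open>exp (- L * r)\<close> does not decrease, so it cannot become negative.\<close>

lemma stays_nonneg:
  fixes w w' :: "real \<Rightarrow> real"
  assumes "s \<le> t"
    and der: "\<And>r. r \<in> {s..t} \<Longrightarrow> (w has_real_derivative w' r) (at r)"
    and bd: "\<And>r. r \<in> {s..t} \<Longrightarrow> w r < 0 \<Longrightarrow> w' r \<ge> L * w r"
    and "w s \<ge> 0"
  shows "w t \<ge> 0"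
proof (rule ccontr)
  assume neg: "\<not> w t \<ge> 0"
  have cont: "continuous_on {s..t} w"
    using der by (meson DERIV_continuous_on has_field_derivative_at_within)
  define A where "A = {r\<in>{s..t}. w r \<ge> 0}"
  have "closed A"
  proof -
    have "closed ({s..t} \<inter> w -` {0..})"
      using cont by (intro continuous_closed_preimage) auto
    then show ?thesis by (simp add: A_def vimage_def Int_def)
  qed
  moreover have A: "A \<noteq> {}" "bdd_above A" using assms by (auto simp: A_def)
  ultimately have inA: "Sup A \<in> A" by (intro closed_contains_Sup)
  define m where "m = Sup A"
  have m: "m \<in> {s..t}" "w m \<ge> 0" using inA by (auto simp: A_def m_def)
  have "m < t" using m neg by (cases "m = t") auto
  have after: "w r < 0" if "m < r" "r \<le> t" for r
  proof (rule ccontr)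
    assume "\<not> w r < 0"
    then have "r \<in> A" using that m by (auto simp: A_def)
    then have "r \<le> m" unfolding m_def by (intro cSup_upper A)
    then show False using that by simp
  qed
  define z where "z r = w r * exp (- L * r)" for r
  have dz: "(z has_real_derivative (w' r - L * w r) * exp (- L * r)) (at r)" if "r \<in> {s..t}" for r
    unfolding z_def by (rule derivative_eq_intros der that refl)+ (simp add: algebra_simps)
  have "z m \<le> z t"
  proof (rule DERIV_nonneg_imp_increasing_open[of m t z])
    show "continuous_on {m..t} z" using dz m
      by (intro DERIV_continuous_on[where D="\<lambda>r. (w' r - L * w r) * exp (- L * r)"]
            has_field_derivative_at_within[OF dz]) auto
    show "m \<le> t" using m by auto
  next
    fix x assume "m < x" "x < t"
    then show "\<exists>y. (z has_real_derivative y) (at x) \<and> y \<ge> 0"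
      using dz[of x] bd[of x] after[of x] m
      by (intro exI[of _ "(w' x - L * w x) * exp (- L * x)"] conjI) auto
  qed
  moreover have "z m \<ge> 0" using m by (simp add: z_def)
  ultimately have "w t * exp (- L * t) \<ge> 0" by (simp add: z_def)
  then show False using neg by (simp add: zero_le_mult_iff)
qed

text \<open>Zero is a barrier for both \<open>w\<close> and \<open>- w\<close>; reversing time
  covers the part to the left of \<open>c\<close>. This serves uniqueness of solutions as well as
  the degenerate case of the Rolle step.\<close>

lemma gronwall_zero:
  fixes w w' :: "real \<Rightarrow> real"
  assumes der: "\<And>r. r \<in> {s..t} \<Longrightarrow> (w has_real_derivative w' r) (at r)"
    and bd: "\<And>r. r \<in> {s..t} \<Longrightarrow> \<bar>w' r\<bar> \<le> L * \<bar>w r\<bar>"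
    and c: "c \<in> {s..t}" "w c = 0" and x: "x \<in> {s..t}"
  shows "w x = 0"
proof -
  have fwd: "w y \<ge> 0" if y: "c \<le> y" "{c..y} \<subseteq> T" and c: "w c = 0"
    and der: "\<And>r. r \<in> T \<Longrightarrow> (w has_real_derivative w' r) (at r)"
    and bd: "\<And>r. r \<in> T \<Longrightarrow> \<bar>w' r\<bar> \<le> L * \<bar>w r\<bar>" for w w' :: "real \<Rightarrow> real" and c y T
  proof (rule stays_nonneg[of c y w w' L])
    fix r assume r: "r \<in> {c..y}" "w r < 0"
    then have "\<bar>w' r\<bar> \<le> L * (- w r)" using bd[of r] y by auto
    then show "L * w r \<le> w' r" by auto
  qed (use that in auto)
  have fwd0: "w y = 0" if "c \<le> y" "{c..y} \<subseteq> T" and "w c = 0"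
    and der: "\<And>r. r \<in> T \<Longrightarrow> (w has_real_derivative w' r) (at r)"
    and bd: "\<And>r. r \<in> T \<Longrightarrow> \<bar>w' r\<bar> \<le> L * \<bar>w r\<bar>" for w w' :: "real \<Rightarrow> real" and c y T
  proof -
    have "w y \<ge> 0" by (rule fwd[OF that])
    moreover have "- w y \<ge> 0"
      by (rule fwd[of c y T "\<lambda>r. - w r" "\<lambda>r. - w' r"])
        (use that in \<open>auto intro!: derivative_eq_intros\<close>)
    ultimately show ?thesis by simp
  qed
  show ?thesis
  proof (cases "c \<le> x")
    case True
    then show ?thesis using fwd0[of c x "{s..t}" w w'] assms by auto
  next
    case False
    have "w (- (- x)) = 0"
    proof (rule fwd0[of "- c" "- x" "{- t..- s}" "\<lambda>r. w (- r)" "\<lambda>r. - w' (- r)"])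
      fix r assume r: "r \<in> {- t..- s}"
      show "((\<lambda>r. w (- r)) has_real_derivative - w' (- r)) (at r)"
        using DERIV_chain2[of w "w' (- r)" "\<lambda>r. - r" r "-1"] der[of "- r"] r
        by (auto simp: DERIV_minus[OF DERIV_ident])
      show "\<bar>- w' (- r)\<bar> \<le> L * \<bar>w (- r)\<bar>" using bd[of "- r"] r by auto
    qed (use False c x in auto)
    then show ?thesis by simp
  qed
qed

lemma sgn_const_of_no_zero:
  fixes f :: "real \<Rightarrow> real"
  assumes "continuous_on {s..t} f" "\<And>r. r \<in> {s..t} \<Longrightarrow> f r \<noteq> 0" "s \<le> t"
  shows "sgn (f s) = sgn (f t)"
proof (rule ccontr)
  assume ne: "sgn (f s) \<noteq> sgn (f t)"
  have "f s \<noteq> 0" "f t \<noteq> 0" using assms by auto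
  then consider "f s < 0" "f t > 0" | "f s > 0" "f t < 0"
    using ne by (auto simp: sgn_real_def split: if_splits)
  then have "\<exists>x\<ge>s. x \<le> t \<and> f x = 0"
    by cases (use IVT'[of f s 0 t] IVT2'[of f t 0 s] assms in auto)
  then show False using assms by auto
qed

section \<open>Uniform counting of zeros along a chain of differential equations\<close>

text \<open>Since \<open>sgn\<close> also takes the value 0, a function may vanish identically
  between exceptional points. For open \<open>I\<close> and finite \<open>F\<close>, a zero in
  \<open>I - F\<close> therefore lies in a whole interval of zeros, which isolation contradicts
  later.\<close>

definition sgn_const_off :: "real set \<Rightarrow> real set \<Rightarrow> (real \<Rightarrow> real) \<Rightarrow> bool" where
  "sgn_const_off I F f \<longleftrightarrow> (\<forall>s t. s \<le> t \<longrightarrow> {s..t} \<subseteq> I - F \<longrightarrow> sgn (f s) = sgn (f t))"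

lemma sgn_const_off_mono: "sgn_const_off I F f \<Longrightarrow> F \<subseteq> G \<Longrightarrow> sgn_const_off I G f"
  unfolding sgn_const_off_def by blast

lemma sgn_const_offD:
  assumes "sgn_const_off I F f" "{s..t} \<subseteq> I - F" "x \<in> {s..t}" "y \<in> {s..t}"
  shows "sgn (f x) = sgn (f y)"
proof -
  have "sgn (f x) = sgn (f y)" if "x \<le> y" "x \<in> {s..t}" "y \<in> {s..t}" for x y
  proof -
    have "{x..y} \<subseteq> {s..t}" using that by auto
    then have "{x..y} \<subseteq> I - F" using assms(2) by blast
    then show ?thesis using assms(1) that by (auto simp: sgn_const_off_def)
  qed
  then show ?thesis using assms(3,4) by (metis linear)
qed

text \<open>The Rolle step. Where \<open>c\<close> and \<open>r\<close> have no zero, \<open>q'\<close> has the same sign at all zeros of \<open>q\<close>, so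
  there is at most one; where \<open>r\<close> vanishes identically, \<open>q\<close> solves a homogeneous linear equation.\<close>

lemma sgn_const_off_step:
  fixes q q0 c r A e D y :: "real \<Rightarrow> real"
  assumes I: "I = {l<..<h}" and F: "finite F"
    and der: "\<And>t. t \<in> I \<Longrightarrow> (q has_real_derivative D t) (at t)"
    and eq: "\<And>t. t \<in> I \<Longrightarrow> c t ^ k * (e t * D t) = A t * q t + r t"
    and cont: "continuous_on I c" "continuous_on I A" "continuous_on I e"
    and e: "\<And>t. t \<in> I - F \<Longrightarrow> e t \<noteq> 0"
    and sc: "sgn_const_off I F c" and sr: "sgn_const_off I F r" and s0: "sgn_const_off I F q0"
    and q: "\<And>t. t \<in> I \<Longrightarrow> q t = c t * y t + q0 t"
  shows "\<exists>G. finite G \<and> card G \<le> 2 * card F + 1 \<and> sgn_const_off I G q"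
proof -
  \<comment> \<open>The zeros of \<open>q\<close> that have to be added to the exceptional set:
    those outside \<open>F\<close> at which neither the leading coefficient nor the remainder
    vanishes.\<close>
  define E where "E = {z \<in> I - F. q z = 0 \<and> r z \<noteq> 0 \<and> c z \<noteq> 0}"
  have contq: "continuous_on I q"
    using der by (meson DERIV_continuous_on has_field_derivative_at_within)
  have sep: "\<exists>f\<in>F. x \<le> f \<and> f < z" if xz: "x \<in> E" "z \<in> E" "x < z" for x z
  proof (rule ccontr)
    assume "\<not> ?thesis"
    then have sub: "{x..z} \<subseteq> I - F"
      using xz I by (fastforce simp: E_def)
    \<comment> \<open>At a zero of \<open>q\<close> the equation reads
      \<open>c ^ k * e * D = r\<close>, so \<open>D\<close> has the sign of
      \<open>c ^ k * e * r\<close>, which is constant on \<open>{x..z}\<close>. Multiplied by this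
      sign, \<open>q\<close> crosses zero upwards wherever it vanishes and cannot be zero again at
      \<open>z\<close>.\<close>
    define \<sigma> where "\<sigma> = sgn (c x ^ k * e x * r x)"
    have \<sigma>: "sgn (c t ^ k * e t * r t) = \<sigma>" if "t \<in> {x..z}" for t
    proof -
      have "{x..t} \<subseteq> {x..z}" using that by auto
      then have "{x..t} \<subseteq> I" "{x..t} \<subseteq> I - F" using sub by blast+
      then have "sgn (e x) = sgn (e t)"
        using that e by (intro sgn_const_of_no_zero continuous_on_subset[OF cont(3)]) auto
      moreover have "sgn (c x) = sgn (c t)" "sgn (r x) = sgn (r t)"
        using sgn_const_offD[OF sc sub, of x t] sgn_const_offD[OF sr sub, of x t] that xz by auto
      ultimately show ?thesis by (simp add: \<sigma>_def sgn_mult power_sgn)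
    qed
    have "\<sigma> \<noteq> 0" using xz e by (auto simp: \<sigma>_def sgn_zero_iff E_def)
    have "\<sigma> * q z > 0"
    proof (rule first_crossing_up[OF xz(3), of "\<lambda>t. \<sigma> * q t" "\<lambda>t. \<sigma> * D t"])
      fix t assume t: "t \<in> {x..z}"
      then have tI: "t \<in> I" using sub by auto
      show "((\<lambda>t. \<sigma> * q t) has_real_derivative \<sigma> * D t) (at t)"
        using der[OF tI] by (rule DERIV_cmult)
      assume "\<sigma> * q t = 0"
      then have "q t = 0" using \<open>\<sigma> \<noteq> 0\<close> by simp
      then have *: "r t = c t ^ k * e t * D t" using eq[OF tI] by simp
      have "\<sigma> = sgn ((c t ^ k * e t)^2 * D t)"
        using \<sigma>[OF t] by (simp add: * power2_eq_square mult_ac)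
      then have "\<sigma> = sgn (c t ^ k * e t)^2 * sgn (D t)" by (simp add: sgn_mult power_sgn)
      then have "\<sigma> = sgn (D t)" "D t \<noteq> 0" using \<open>\<sigma> \<noteq> 0\<close>
        by (auto simp: sgn_real_def split: if_splits)
      then show "\<sigma> * D t > 0" by (simp add: sgn_real_def split: if_splits)
    qed (use xz in \<open>auto simp: E_def\<close>)
    then show False using xz by (auto simp: E_def)
  qed
  have E: "finite E \<and> card E \<le> card F + 1" by (rule card_interleaved[OF F sep])
  have "sgn_const_off I (F \<union> E) q"
    unfolding sgn_const_off_def
  proof (intro allI impI)
    fix s t assume st: "s \<le> t" "{s..t} \<subseteq> I - (F \<union> E)"
    have sub: "{s..t} \<subseteq> I - F" "{s..t} \<subseteq> I" "s \<in> {s..t}" "t \<in> {s..t}" using st by auto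
    have c: "sgn (c x) = sgn (c s)" and r: "sgn (r x) = sgn (r s)" if "x \<in> {s..t}" for x
      using sgn_const_offD[OF sc sub(1), of x s] sgn_const_offD[OF sr sub(1), of x s] that sub by auto
    note contq' = continuous_on_subset[OF contq sub(2)]
    \<comment> \<open>If the leading coefficient vanishes on the whole interval, \<open>q\<close>
      coincides there with its lower-degree part \<open>q0\<close>; this is why the sign of
      \<open>q0\<close> has to be controlled too.\<close>
    consider "c s = 0" | "c s \<noteq> 0" "r s = 0" | "c s \<noteq> 0" "r s \<noteq> 0" by blast
    then show "sgn (q s) = sgn (q t)"
    proof cases
      case 1
      then have "c t = 0" using c[of t] sub by (simp add: sgn_zero_iff)
      then have "q s = q0 s" "q t = q0 t" using 1 q sub by auto
      then show ?thesis using sgn_const_offD[OF s0 sub(1), of s t] sub by auto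
    next
      case 2
      have nz: "c x ^ k * e x \<noteq> 0" and rz: "r x = 0" if "x \<in> {s..t}" for x
        using c[OF that] r[OF that] e[of x] 2 that sub by (auto simp: sgn_zero_iff)
      \<comment> \<open>On a compact interval the coefficient of the homogeneous equation
        \<open>D = B * q\<close> is bounded, so a single zero forces \<open>q\<close> to vanish on
        all of it.\<close>
      define B where "B x = A x / (c x ^ k * e x)" for x
      have "continuous_on {s..t} B" unfolding B_def
        by (intro continuous_intros continuous_on_subset[OF cont(1) sub(2)]
            continuous_on_subset[OF cont(2) sub(2)] continuous_on_subset[OF cont(3) sub(2)]) (use nz in auto)
      then have "compact (B ` {s..t})" by (intro compact_continuous_image) auto
      then obtain L where L: "\<And>x. x \<in> {s..t} \<Longrightarrow> \<bar>B x\<bar> \<le> L"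
        using compact_imp_bounded by (metis bounded_iff imageI real_norm_def)
      have D: "D x = B x * q x" if "x \<in> {s..t}" for x
        using eq[of x] nz[OF that] rz[OF that] that sub unfolding B_def by (auto simp: field_simps)
      show ?thesis
      proof (cases "\<exists>z\<in>{s..t}. q z = 0")
        case True
        then obtain z where z: "z \<in> {s..t}" "q z = 0" by blast
        have "q x = 0" if x: "x \<in> {s..t}" for x
        proof (rule gronwall_zero[where w = q and w' = D, OF _ _ z x])
          fix y assume y: "y \<in> {s..t}"
          then show "(q has_real_derivative D y) (at y)" using der sub(2) by blast
          show "\<bar>D y\<bar> \<le> L * \<bar>q y\<bar>"
            using mult_right_mono[OF L[OF y] abs_ge_zero] by (simp add: D[OF y] abs_mult)
        qed
        then show ?thesis using sub by auto
      qed (use sgn_const_of_no_zero[OF contq'] st in blast)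
    next
      case 3
      have "q x \<noteq> 0" if "x \<in> {s..t}" for x
      proof
        assume "q x = 0"
        moreover have "r x \<noteq> 0" "c x \<noteq> 0" using c[OF that] r[OF that] 3 sub
          by (metis sgn_zero_iff)+
        ultimately have "x \<in> E" using that sub by (auto simp: E_def)
        then show False using that st by auto
      qed
      then show ?thesis using sgn_const_of_no_zero[OF contq'] st by blast
    qed
  qed
  moreover have "card (F \<union> E) \<le> 2 * card F + 1"
    using card_Un_le[of F E] E by linarith
  ultimately show ?thesis using F E by blast
qed

section \<open>Rings of functions of a parameter and time, and polynomials over them\<close>

definition subring :: "('p \<Rightarrow> real \<Rightarrow> real) set \<Rightarrow> bool" where
  "subring R \<longleftrightarrow> (\<forall>c. (\<lambda>\<theta> t. c \<theta>) \<in> R) \<and>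
     (\<forall>f\<in>R. \<forall>g\<in>R. (\<lambda>\<theta> t. f \<theta> t + g \<theta> t) \<in> R \<and> (\<lambda>\<theta> t. f \<theta> t * g \<theta> t) \<in> R)"

lemma subring_const: "subring R \<Longrightarrow> (\<lambda>\<theta> t. c \<theta>) \<in> R"
  and subring_add: "subring R \<Longrightarrow> f \<in> R \<Longrightarrow> g \<in> R \<Longrightarrow> (\<lambda>\<theta> t. f \<theta> t + g \<theta> t) \<in> R"
  and subring_mult: "subring R \<Longrightarrow> f \<in> R \<Longrightarrow> g \<in> R \<Longrightarrow> (\<lambda>\<theta> t. f \<theta> t * g \<theta> t) \<in> R"
  by (auto simp: subring_def)

lemma subring_diff:
  assumes "subring R" "f \<in> R" "g \<in> R"
  shows "(\<lambda>\<theta> t. f \<theta> t - g \<theta> t) \<in> R"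
  using subring_add[OF assms(1,2) subring_mult[OF assms(1) subring_const[OF assms(1), of "\<lambda>_. -1"] assms(3)]]
  by simp

lemma subring_power:
  assumes "subring R" "f \<in> R"
  shows "(\<lambda>\<theta> t. f \<theta> t ^ n) \<in> R"
  by (induction n) (auto intro: subring_const[OF assms(1), of "\<lambda>_. 1"] subring_mult assms)

lemmas subring_intros = subring_const subring_add subring_mult subring_diff subring_power

text \<open>Polynomials of degree at most \<open>n\<close> in \<open>y\<close>, taken as functions
  rather than formal expressions, because the derivation acts on functions; representations need not
  be unique. Peeling off the top coefficient matches the induction on the degree. That coefficient
  may vanish for some parameters or times.\<close>

fun polys :: "('p \<Rightarrow> real \<Rightarrow> real) set \<Rightarrow> ('p \<Rightarrow> real \<Rightarrow> real) \<Rightarrow> nat \<Rightarrow> ('p \<Rightarrow> real \<Rightarrow> real) set" where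
  "polys R y 0 = R"
| "polys R y (Suc n) = {\<lambda>\<theta> t. c \<theta> t * y \<theta> t ^ Suc n + g \<theta> t | c g. c \<in> R \<and> g \<in> polys R y n}"

definition adjoin :: "('p \<Rightarrow> real \<Rightarrow> real) set \<Rightarrow> ('p \<Rightarrow> real \<Rightarrow> real) \<Rightarrow> ('p \<Rightarrow> real \<Rightarrow> real) set" where
  "adjoin R y = (\<Union>n. polys R y n)"

lemma adjoinI: "f \<in> polys R y n \<Longrightarrow> f \<in> adjoin R y"
  unfolding adjoin_def by (rule UN_I[of n]) auto

lemma adjoinE:
  assumes "f \<in> adjoin R y"
  obtains n where "f \<in> polys R y n"
  using assms unfolding adjoin_def by (rule UN_E)

declare polys.simps(2) [simp del]

lemma polys_SucI:
  "c \<in> R \<Longrightarrow> g \<in> polys R y n \<Longrightarrow> (\<And>\<theta> t. f \<theta> t = c \<theta> t * y \<theta> t ^ Suc n + g \<theta> t) \<Longrightarrow> f \<in> polys R y (Suc n)"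
  unfolding polys.simps(2) by (rule CollectI, intro exI[of _ c] exI[of _ g]) auto

lemma polys_SucE:
  assumes "f \<in> polys R y (Suc n)"
  obtains c g where "c \<in> R" "g \<in> polys R y n" "f = (\<lambda>\<theta> t. c \<theta> t * y \<theta> t ^ Suc n + g \<theta> t)"
  using assms unfolding polys.simps(2) by blast

context
  fixes R :: "('p \<Rightarrow> real \<Rightarrow> real) set" and y :: "'p \<Rightarrow> real \<Rightarrow> real"
  assumes R: "subring R"
begin

lemma polys_Suc_mono: "f \<in> polys R y n \<Longrightarrow> f \<in> polys R y (Suc n)"
  by (rule polys_SucI[OF subring_const[OF R, of "\<lambda>_. 0"]]) auto

lemma polys_mono: "m \<le> n \<Longrightarrow> f \<in> polys R y m \<Longrightarrow> f \<in> polys R y n"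
  by (induction rule: dec_induct) (auto intro: polys_Suc_mono)

lemma polys_add: "f \<in> polys R y n \<Longrightarrow> g \<in> polys R y n \<Longrightarrow> (\<lambda>\<theta> t. f \<theta> t + g \<theta> t) \<in> polys R y n"
proof (induction n arbitrary: f g)
  case (Suc n)
  from Suc.prems obtain c f0 d g0 where *: "c \<in> R" "f0 \<in> polys R y n" "d \<in> R" "g0 \<in> polys R y n"
    "f = (\<lambda>\<theta> t. c \<theta> t * y \<theta> t ^ Suc n + f0 \<theta> t)" "g = (\<lambda>\<theta> t. d \<theta> t * y \<theta> t ^ Suc n + g0 \<theta> t)"
    by (elim polys_SucE) blast
  show ?case
    by (rule polys_SucI[OF subring_add[OF R *(1,3)] Suc.IH[OF *(2,4)]]) (simp add: * algebra_simps)
qed (auto intro: subring_add R)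

lemma polys_scale: "c \<in> R \<Longrightarrow> f \<in> polys R y n \<Longrightarrow> (\<lambda>\<theta> t. c \<theta> t * f \<theta> t) \<in> polys R y n"
proof (induction n arbitrary: f)
  case (Suc n)
  from Suc.prems(2) obtain d f0 where *: "d \<in> R" "f0 \<in> polys R y n"
    "f = (\<lambda>\<theta> t. d \<theta> t * y \<theta> t ^ Suc n + f0 \<theta> t)"
    by (elim polys_SucE)
  show ?case
    by (rule polys_SucI[OF subring_mult[OF R Suc.prems(1) *(1)] Suc.IH[OF Suc.prems(1) *(2)]])
      (simp add: * algebra_simps)
qed (auto intro: subring_mult R)

lemma polys_shift: "f \<in> polys R y n \<Longrightarrow> (\<lambda>\<theta> t. y \<theta> t * f \<theta> t) \<in> polys R y (Suc n)"
proof (induction n arbitrary: f)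
  case 0
  then show ?case
    by (intro polys_SucI[of f R "\<lambda>\<theta> t. 0"]) (auto intro: subring_const[OF R])
next
  case (Suc n)
  from Suc.prems obtain d f0 where *: "d \<in> R" "f0 \<in> polys R y n"
    "f = (\<lambda>\<theta> t. d \<theta> t * y \<theta> t ^ Suc n + f0 \<theta> t)"
    by (elim polys_SucE)
  show ?case
    by (rule polys_SucI[OF *(1) Suc.IH[OF *(2)]]) (simp add: * algebra_simps)
qed

lemma polys_shift_power: "f \<in> polys R y n \<Longrightarrow> (\<lambda>\<theta> t. y \<theta> t ^ k * f \<theta> t) \<in> polys R y (k + n)"
proof (induction k)
  case (Suc k)
  from polys_shift[OF Suc.IH[OF Suc.prems]] show ?case by (simp add: mult_ac)
qed simp

lemma adjoin_add: 
  assumes "f \<in> adjoin R y" "g \<in> adjoin R y"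
  shows "(\<lambda>\<theta> t. f \<theta> t + g \<theta> t) \<in> adjoin R y"
proof -
  from assms obtain m n where "f \<in> polys R y m" "g \<in> polys R y n" by (elim adjoinE)
  then have "f \<in> polys R y (max m n)" "g \<in> polys R y (max m n)"
    by (auto intro: polys_mono[of m] polys_mono[of n])
  then show ?thesis by (intro adjoinI[OF polys_add])
qed

lemma base_in_adjoin: "f \<in> R \<Longrightarrow> f \<in> adjoin R y"
  by (rule adjoinI[of _ _ _ 0]) simp

lemma gen_in_adjoin: "y \<in> adjoin R y"
proof -
  have "(\<lambda>\<theta> t. y \<theta> t * 1) \<in> polys R y (Suc 0)"
    by (rule polys_shift) (simp add: subring_const[OF R])
  then show ?thesis using adjoinI by simp
qed

lemma adjoin_mult:
  assumes "f \<in> adjoin R y" "g \<in> adjoin R y"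
  shows "(\<lambda>\<theta> t. f \<theta> t * g \<theta> t) \<in> adjoin R y"
proof -
  from assms obtain m n where "f \<in> polys R y m" and g: "g \<in> polys R y n" by (elim adjoinE)
  then show ?thesis
  proof (induction m arbitrary: f)
    case 0
    then show ?case by (intro adjoinI[OF polys_scale]) auto
  next
    case (Suc m)
    from Suc.prems(1) obtain d f0 where *: "d \<in> R" "f0 \<in> polys R y m"
      "f = (\<lambda>\<theta> t. d \<theta> t * y \<theta> t ^ Suc m + f0 \<theta> t)"
      by (elim polys_SucE)
    have "(\<lambda>\<theta> t. y \<theta> t ^ Suc m * (d \<theta> t * g \<theta> t)) \<in> adjoin R y"
      by (rule adjoinI[OF polys_shift_power[OF polys_scale[OF *(1) g]]])
    from adjoin_add[OF this Suc.IH[OF *(2) g]] show ?case by (simp add: * algebra_simps)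
  qed
qed

lemma subring_adjoin: "subring (adjoin R y)"
  unfolding subring_def
  using adjoin_add adjoin_mult base_in_adjoin subring_const[OF R] by blast

text \<open>The leading coefficient is a function with possible zeros, so multiplication by a power
  of \<open>c\<close> replaces division by it. Each round lowers the degree of the dividend by one
  until it is at most \<open>m\<close>.\<close>

lemma pseudo_division:
  assumes c: "c \<in> R" and q0: "q0 \<in> polys R y m" and S: "S \<in> adjoin R y"
  defines "q \<equiv> (\<lambda>\<theta> t. c \<theta> t * y \<theta> t ^ Suc m + q0 \<theta> t)"
  shows "\<exists>k A r. A \<in> adjoin R y \<and> r \<in> polys R y m \<and>
    (\<forall>\<theta> t. c \<theta> t ^ k * S \<theta> t = A \<theta> t * q \<theta> t + r \<theta> t)"
proof -
  from S obtain n where "S \<in> polys R y n" by (elim adjoinE)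
  then show ?thesis
  proof (induction n arbitrary: S)
    case 0
    then have S: "S \<in> polys R y m" using polys_mono[of 0 m S] by simp
    show ?case
      by (rule exI[of _ 0], rule exI[of _ "\<lambda>\<theta> t. 0"], rule exI[of _ S])
        (use S base_in_adjoin[OF subring_const[OF R]] in auto)
  next
    case (Suc n)
    show ?case
    proof (cases "Suc n \<le> m")
      case True
      then have S: "S \<in> polys R y m" using polys_mono Suc.prems by blast
      show ?thesis
        by (rule exI[of _ 0], rule exI[of _ "\<lambda>\<theta> t. 0"], rule exI[of _ S])
          (use S base_in_adjoin[OF subring_const[OF R]] in auto)
    next
      case False
      from Suc.prems obtain d S0 where *: "d \<in> R" "S0 \<in> polys R y n"
        "S = (\<lambda>\<theta> t. d \<theta> t * y \<theta> t ^ Suc n + S0 \<theta> t)"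
        by (elim polys_SucE)
      \<comment> \<open>The product \<open>d * y ^ (n - m) * q\<close> has the same top term as
        \<open>c * S\<close>; \<open>T\<close> is what remains after subtracting it.\<close>
      define T where "T = (\<lambda>\<theta> t. c \<theta> t * S0 \<theta> t + (-1) * (d \<theta> t * (y \<theta> t ^ (n - m) * q0 \<theta> t)))"
      have "(\<lambda>\<theta> t. y \<theta> t ^ (n - m) * q0 \<theta> t) \<in> polys R y n"
        using polys_shift_power[OF q0, of "n - m"] False by simp
      from polys_scale[OF subring_const[OF R, of "\<lambda>_. -1"] polys_scale[OF *(1) this]]
      have "T \<in> polys R y n" unfolding T_def
        by (intro polys_add polys_scale[OF c *(2)]) auto
      from Suc.IH[OF this] obtain k A r where k: "A \<in> adjoin R y" "r \<in> polys R y m"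
        "\<And>\<theta> t. c \<theta> t ^ k * T \<theta> t = A \<theta> t * q \<theta> t + r \<theta> t" by blast
      define A' where "A' = (\<lambda>\<theta> t. c \<theta> t ^ k * (d \<theta> t * y \<theta> t ^ (n - m)) + A \<theta> t)"
      have "A' \<in> adjoin R y" unfolding A'_def
        by (intro adjoin_add adjoin_mult k(1) subring_power[OF subring_adjoin] base_in_adjoin c *(1) gen_in_adjoin)
      moreover have "c \<theta> t ^ Suc k * S \<theta> t = A' \<theta> t * q \<theta> t + r \<theta> t" for \<theta> t
      proof -
        have "Suc n = (n - m) + Suc m" using False by simp
        then have pw: "y \<theta> t ^ Suc n = y \<theta> t ^ (n - m) * y \<theta> t ^ Suc m" by (metis power_add)
        have "c \<theta> t * S \<theta> t = d \<theta> t * y \<theta> t ^ (n - m) * q \<theta> t + T \<theta> t"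
          unfolding *(3) pw q_def T_def by (simp add: algebra_simps)
        then have "c \<theta> t ^ Suc k * S \<theta> t
            = c \<theta> t ^ k * (d \<theta> t * y \<theta> t ^ (n - m) * q \<theta> t) + c \<theta> t ^ k * T \<theta> t"
          by (simp only: power_Suc2 mult.assoc distrib_left)
        then show ?thesis unfolding k(3) A'_def by (simp add: algebra_simps)
      qed
      ultimately show ?thesis using k(2) by blast
    qed
  qed
qed

end


section \<open>Uniformly tame families and adjunction of a generator\<close>

locale family =
  fixes \<Theta> :: "'p set" and lo hi :: "'p \<Rightarrow> real"
begin

definition dom :: "'p \<Rightarrow> real set" where
  "dom \<theta> = {lo \<theta><..<hi \<theta>}"

text \<open>The bound \<open>N\<close> is chosen before the parameter: this order of quantifiers is
  the uniformity on which the final constant rests. The exceptional set itself may vary with the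
  parameter.\<close>

definition tame :: "('p \<Rightarrow> real \<Rightarrow> real) \<Rightarrow> bool" where
  "tame f \<longleftrightarrow> (\<exists>N. \<forall>\<theta>\<in>\<Theta>. \<exists>F. finite F \<and> card F \<le> N \<and> sgn_const_off (dom \<theta>) F (f \<theta>))"

text \<open>Meant for the factor \<open>e\<close> of the derivation: where \<open>e\<close> vanishes
  the differential equation says nothing about the derivative, so intervals of zeros must be
  excluded for it.\<close>

definition few_zeros :: "('p \<Rightarrow> real \<Rightarrow> real) \<Rightarrow> bool" where
  "few_zeros f \<longleftrightarrow> (\<exists>N. \<forall>\<theta>\<in>\<Theta>. finite {t \<in> dom \<theta>. f \<theta> t = 0} \<and> card {t \<in> dom \<theta>. f \<theta> t = 0} \<le> N)"

definition has_der :: "('p \<Rightarrow> real \<Rightarrow> real) \<Rightarrow> ('p \<Rightarrow> real \<Rightarrow> real) \<Rightarrow> ('p \<Rightarrow> real \<Rightarrow> real) \<Rightarrow> bool" where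
  "has_der e f g \<longleftrightarrow>
     (\<forall>\<theta>\<in>\<Theta>. \<forall>t\<in>dom \<theta>. \<exists>D. (f \<theta> has_real_derivative D) (at t) \<and> e \<theta> t * D = g \<theta> t)"

text \<open>The derivation acting on \<open>R\<close> is \<open>e d/dt\<close>; the factor \<open>e\<close> clears denominators.\<close>

definition tame_ring :: "('p \<Rightarrow> real \<Rightarrow> real) \<Rightarrow> ('p \<Rightarrow> real \<Rightarrow> real) set \<Rightarrow> bool" where
  "tame_ring e R \<longleftrightarrow> subring R \<and> e \<in> R \<and> few_zeros e \<and> (\<forall>f\<in>R. tame f) \<and> (\<forall>f\<in>R. \<exists>g\<in>R. has_der e f g)"

lemma few_zeros_mult:
  assumes "few_zeros f" "few_zeros g"
  shows "few_zeros (\<lambda>\<theta> t. f \<theta> t * g \<theta> t)"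
proof -
  obtain M N where
    M: "\<And>\<theta>. \<theta> \<in> \<Theta> \<Longrightarrow> finite {t \<in> dom \<theta>. f \<theta> t = 0} \<and> card {t \<in> dom \<theta>. f \<theta> t = 0} \<le> M" and
    N: "\<And>\<theta>. \<theta> \<in> \<Theta> \<Longrightarrow> finite {t \<in> dom \<theta>. g \<theta> t = 0} \<and> card {t \<in> dom \<theta>. g \<theta> t = 0} \<le> N"
    using assms[unfolded few_zeros_def] by (elim exE) blast
  have eq: "{t \<in> dom \<theta>. f \<theta> t * g \<theta> t = 0} = {t \<in> dom \<theta>. f \<theta> t = 0} \<union> {t \<in> dom \<theta>. g \<theta> t = 0}" for \<theta>
    by auto
  show ?thesis unfolding few_zeros_def eq
  proof (intro exI[of _ "M + N"] ballI conjI)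
    fix \<theta> assume "\<theta> \<in> \<Theta>"
    from M[OF this] N[OF this]
    show "finite ({t \<in> dom \<theta>. f \<theta> t = 0} \<union> {t \<in> dom \<theta>. g \<theta> t = 0})"
      "card ({t \<in> dom \<theta>. f \<theta> t = 0} \<union> {t \<in> dom \<theta>. g \<theta> t = 0}) \<le> M + N"
      using card_Un_le[of "{t \<in> dom \<theta>. f \<theta> t = 0}" "{t \<in> dom \<theta>. g \<theta> t = 0}"] by auto
  qed
qed

lemma has_der_add:
  assumes "has_der e f f'" "has_der e g g'"
  shows "has_der e (\<lambda>\<theta> t. f \<theta> t + g \<theta> t) (\<lambda>\<theta> t. f' \<theta> t + g' \<theta> t)"
  unfolding has_der_def
proof (intro ballI)
  fix \<theta> t assume "\<theta> \<in> \<Theta>" "t \<in> dom \<theta>"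
  then obtain D E where "(f \<theta> has_real_derivative D) (at t)" "(g \<theta> has_real_derivative E) (at t)"
    "e \<theta> t * D = f' \<theta> t" "e \<theta> t * E = g' \<theta> t"
    using assms unfolding has_der_def by blast
  then show "\<exists>D. ((\<lambda>t. f \<theta> t + g \<theta> t) has_real_derivative D) (at t) \<and> e \<theta> t * D = f' \<theta> t + g' \<theta> t"
    by (intro exI[of _ "D + E"]) (auto intro: DERIV_add simp: algebra_simps)
qed

lemma has_der_mult:
  assumes "has_der e f f'" "has_der e g g'"
  shows "has_der e (\<lambda>\<theta> t. f \<theta> t * g \<theta> t) (\<lambda>\<theta> t. f' \<theta> t * g \<theta> t + f \<theta> t * g' \<theta> t)"
  unfolding has_der_def
proof (intro ballI)
  fix \<theta> t assume "\<theta> \<in> \<Theta>" "t \<in> dom \<theta>"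
  then obtain D E where D: "(f \<theta> has_real_derivative D) (at t)" "(g \<theta> has_real_derivative E) (at t)"
    and eq: "e \<theta> t * D = f' \<theta> t" "e \<theta> t * E = g' \<theta> t"
    using assms unfolding has_der_def by blast
  show "\<exists>D. ((\<lambda>t. f \<theta> t * g \<theta> t) has_real_derivative D) (at t) \<and>
      e \<theta> t * D = f' \<theta> t * g \<theta> t + f \<theta> t * g' \<theta> t"
    using DERIV_mult[OF D] by (intro exI conjI, assumption) (simp add: eq[symmetric] algebra_simps)
qed

lemma has_der_power:
  assumes "subring R" "f \<in> R" "g \<in> R" "has_der e f g"
  shows "\<exists>g'\<in>R. has_der e (\<lambda>\<theta> t. f \<theta> t ^ n) g'"
proof (induction n)
  case 0
  show ?case
    by (rule bexI[of _ "\<lambda>\<theta> t. 0"])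
      (auto simp: has_der_def intro!: exI[of _ "0::real"] subring_const[OF assms(1)])
next
  case (Suc n)
  then obtain g' where g': "g' \<in> R" "has_der e (\<lambda>\<theta> t. f \<theta> t ^ n) g'" by blast
  from has_der_mult[OF assms(4) g'(2)] show ?case
    by (intro bexI[of _ "\<lambda>\<theta> t. g \<theta> t * f \<theta> t ^ n + f \<theta> t * g' \<theta> t"] subring_intros assms g') simp
qed

lemma has_der_rescale:
  assumes "has_der e f g"
  shows "has_der (\<lambda>\<theta> t. d \<theta> t * e \<theta> t) f (\<lambda>\<theta> t. d \<theta> t * g \<theta> t)"
  unfolding has_der_def
proof (intro ballI)
  fix \<theta> t assume "\<theta> \<in> \<Theta>" "t \<in> dom \<theta>"
  then obtain D where "(f \<theta> has_real_derivative D) (at t)" "e \<theta> t * D = g \<theta> t"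
    using assms unfolding has_der_def by blast
  then show "\<exists>D. (f \<theta> has_real_derivative D) (at t) \<and> d \<theta> t * e \<theta> t * D = d \<theta> t * g \<theta> t"
    by (intro exI[of _ D]) simp
qed

lemma has_der_continuous:
  assumes "has_der e f g" "\<theta> \<in> \<Theta>"
  shows "continuous_on (dom \<theta>) (f \<theta>)"
  using assms unfolding has_der_def
  by (intro continuous_at_imp_continuous_on ballI) (blast intro: DERIV_isCont)

text \<open>The derivative of \<open>q\<close> may have higher degree in \<open>y\<close> than
  \<open>q\<close>; what decreases is the degree of the pseudo-remainder. Four exceptional sets are
  collected: those of \<open>c\<close>, \<open>q0\<close> and \<open>r\<close>, and the zeros of
  \<open>e\<close>.\<close>

lemma tame_polys_Suc:
  assumes R: "subring R" and e: "e \<in> adjoin R y" "few_zeros e"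
    and der: "\<And>f. f \<in> adjoin R y \<Longrightarrow> \<exists>g\<in>adjoin R y. has_der e f g"
    and tR: "\<And>f. f \<in> R \<Longrightarrow> tame f" and tm: "\<And>f. f \<in> polys R y m \<Longrightarrow> tame f"
    and q: "q \<in> polys R y (Suc m)"
  shows "tame q"
proof -
  from q obtain c q0 where c: "c \<in> R" "q0 \<in> polys R y m"
    and q_eq: "q = (\<lambda>\<theta> t. c \<theta> t * y \<theta> t ^ Suc m + q0 \<theta> t)" by (elim polys_SucE)
  from der[OF adjoinI[OF q]] obtain S where S: "S \<in> adjoin R y" "has_der e q S" by blast
  from pseudo_division[OF R c S(1)] obtain k A r
    where A: "A \<in> adjoin R y" "r \<in> polys R y m"
      "\<And>\<theta> t. c \<theta> t ^ k * S \<theta> t = A \<theta> t * q \<theta> t + r \<theta> t" unfolding q_eq by blast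
  obtain N1 N2 N3 N4 where
    N1: "\<And>\<theta>. \<theta> \<in> \<Theta> \<Longrightarrow> \<exists>F. finite F \<and> card F \<le> N1 \<and> sgn_const_off (dom \<theta>) F (c \<theta>)" and
    N2: "\<And>\<theta>. \<theta> \<in> \<Theta> \<Longrightarrow> \<exists>F. finite F \<and> card F \<le> N2 \<and> sgn_const_off (dom \<theta>) F (q0 \<theta>)" and
    N3: "\<And>\<theta>. \<theta> \<in> \<Theta> \<Longrightarrow> \<exists>F. finite F \<and> card F \<le> N3 \<and> sgn_const_off (dom \<theta>) F (r \<theta>)" and
    N4: "\<And>\<theta>. \<theta> \<in> \<Theta> \<Longrightarrow> finite {t \<in> dom \<theta>. e \<theta> t = 0} \<and> card {t \<in> dom \<theta>. e \<theta> t = 0} \<le> N4"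
    using tR[OF c(1), unfolded tame_def] tm[OF c(2), unfolded tame_def]
      tm[OF A(2), unfolded tame_def] e(2)[unfolded few_zeros_def] by (elim exE) blast
  show ?thesis unfolding tame_def
  proof (intro exI[of _ "2 * (N1 + N2 + N3 + N4) + 1"] ballI)
    fix \<theta> assume \<theta>: "\<theta> \<in> \<Theta>"
    obtain F1 F2 F3 where F: "finite F1" "card F1 \<le> N1" "sgn_const_off (dom \<theta>) F1 (c \<theta>)"
      "finite F2" "card F2 \<le> N2" "sgn_const_off (dom \<theta>) F2 (q0 \<theta>)"
      "finite F3" "card F3 \<le> N3" "sgn_const_off (dom \<theta>) F3 (r \<theta>)"
      using N1[OF \<theta>] N2[OF \<theta>] N3[OF \<theta>] by blast
    define F4 where "F4 = {t \<in> dom \<theta>. e \<theta> t = 0}"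
    define F where "F = F1 \<union> F2 \<union> F3 \<union> F4"
    have F4: "finite F4" "card F4 \<le> N4" using N4[OF \<theta>] by (auto simp: F4_def)
    have finF: "finite F" using F F4 by (simp add: F_def)
    have cardF: "card F \<le> N1 + N2 + N3 + N4"
      unfolding F_def using card_Un_le[of "F1 \<union> F2 \<union> F3" F4] card_Un_le[of "F1 \<union> F2" F3]
        card_Un_le[of F1 F2] F F4 by linarith
    from S(2) \<theta> have "\<forall>t\<in>dom \<theta>. \<exists>D. (q \<theta> has_real_derivative D) (at t) \<and> e \<theta> t * D = S \<theta> t"
      unfolding has_der_def by blast
    then obtain D where D: "\<And>t. t \<in> dom \<theta> \<Longrightarrow> (q \<theta> has_real_derivative D t) (at t)"
      "\<And>t. t \<in> dom \<theta> \<Longrightarrow> e \<theta> t * D t = S \<theta> t" by metis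
    have cont: "continuous_on (dom \<theta>) (f \<theta>)" if "f \<in> adjoin R y" for f
      using der[OF that] has_der_continuous \<theta> by blast
    have "\<exists>G. finite G \<and> card G \<le> 2 * card F + 1 \<and> sgn_const_off (dom \<theta>) G (q \<theta>)"
    proof (rule sgn_const_off_step[where l = "lo \<theta>" and h = "hi \<theta>" and D = D and c = "c \<theta>"
          and k = k and A = "A \<theta>" and r = "r \<theta>" and e = "e \<theta>" and ?q0.0 = "q0 \<theta>"
          and y = "\<lambda>t. y \<theta> t ^ Suc m"])
      show "c \<theta> t ^ k * (e \<theta> t * D t) = A \<theta> t * q \<theta> t + r \<theta> t" if "t \<in> dom \<theta>" for t
        using D(2)[OF that] A(3) by simp
      show "continuous_on (dom \<theta>) (c \<theta>)" "continuous_on (dom \<theta>) (A \<theta>)" "continuous_on (dom \<theta>) (e \<theta>)"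
        using cont base_in_adjoin[OF R c(1)] A(1) e(1) by blast+
      show "sgn_const_off (dom \<theta>) F (c \<theta>)" "sgn_const_off (dom \<theta>) F (r \<theta>)" "sgn_const_off (dom \<theta>) F (q0 \<theta>)"
        using F by (auto intro: sgn_const_off_mono simp: F_def)
    qed (use D finF in \<open>auto simp: dom_def F_def F4_def q_eq\<close>)
    then show "\<exists>F. finite F \<and> card F \<le> 2 * (N1 + N2 + N3 + N4) + 1 \<and> sgn_const_off (dom \<theta>) F (q \<theta>)"
      using cardF by (meson add_le_mono le_refl mult_le_mono2 order_trans)
  qed
qed

text \<open>The equation for the generator is \<open>d * e * y' = p\<close>, where \<open>d\<close>
  and \<open>p\<close> may themselves contain \<open>y\<close>. Multiplying the old derivation by
  \<open>d\<close> keeps the derivatives of old elements inside the enlarged ring, so a single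
  derivation acts on all of it and the construction can be iterated.\<close>

theorem tame_ring_adjoin:
  assumes R: "tame_ring e R" and d: "d \<in> adjoin R y" "few_zeros d"
    and y: "p \<in> adjoin R y" "has_der (\<lambda>\<theta> t. d \<theta> t * e \<theta> t) y p"
  shows "tame_ring (\<lambda>\<theta> t. d \<theta> t * e \<theta> t) (adjoin R y)"
proof -
  define e' where "e' = (\<lambda>\<theta> t. d \<theta> t * e \<theta> t)"
  note R' = R[unfolded tame_ring_def]
  have sR: "subring R" using R' by blast
  note sA = subring_adjoin[OF sR, of y]
  have e': "e' \<in> adjoin R y" "few_zeros e'" unfolding e'_def
    using subring_mult[OF sA d(1) base_in_adjoin[OF sR]] few_zeros_mult[OF d(2)] R' by blast+
  have derR: "\<exists>g\<in>adjoin R y. has_der e' f g" if "f \<in> R" for f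
  proof -
    from R' that obtain g where "g \<in> R" "has_der e f g" by blast
    then show ?thesis unfolding e'_def
      using has_der_rescale subring_mult[OF sA d(1) base_in_adjoin[OF sR]] by blast
  qed
  have der: "\<exists>g\<in>adjoin R y. has_der e' f g" if "f \<in> polys R y n" for f n
    using that
  proof (induction n arbitrary: f)
    case (Suc n)
    from Suc.prems obtain c f0 where f: "c \<in> R" "f0 \<in> polys R y n"
      "f = (\<lambda>\<theta> t. c \<theta> t * y \<theta> t ^ Suc n + f0 \<theta> t)" by (elim polys_SucE)
    obtain c' where c': "c' \<in> adjoin R y" "has_der e' c c'" using derR[OF f(1)] by blast
    obtain f0' where f0': "f0' \<in> adjoin R y" "has_der e' f0 f0'" using Suc.IH[OF f(2)] by blast
    obtain y' where y': "y' \<in> adjoin R y" "has_der e' (\<lambda>\<theta> t. y \<theta> t ^ Suc n) y'"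
      using has_der_power[OF sA gen_in_adjoin[OF sR] y[folded e'_def], of "Suc n"] by blast
    show ?case unfolding f(3)
      by (rule bexI[where x = "\<lambda>\<theta> t. c' \<theta> t * y \<theta> t ^ Suc n + c \<theta> t * y' \<theta> t + f0' \<theta> t"],
          rule has_der_add[OF has_der_mult[OF c'(2) y'(2)] f0'(2)]) (intro subring_intros sA c' f0' y' base_in_adjoin[OF sR f(1)] gen_in_adjoin[OF sR])
  qed (use derR in auto)
  have der': "\<exists>g\<in>adjoin R y. has_der e' f g" if "f \<in> adjoin R y" for f
    using der that by (elim adjoinE)
  have "tame f" if "f \<in> polys R y n" for f n
    using that
  proof (induction n arbitrary: f)
    case (Suc n)
    show ?case
      by (rule tame_polys_Suc[OF sR e' der' _ Suc.IH Suc.prems]) (use R' in auto)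
  qed (use R' in auto)
  then have tame: "tame f" if "f \<in> adjoin R y" for f
    using that by (elim adjoinE)
  show ?thesis unfolding tame_ring_def e'_def[symmetric]
    by (intro conjI ballI sA e' der' tame)
qed

text \<open>Arbitrary dependence on the parameter is allowed, so \<open>a\<close>, \<open>b\<close>,
  \<mu> and their quotients are all scalars of the chain.\<close>

definition constants :: "('p \<Rightarrow> real \<Rightarrow> real) set" where
  "constants = {f. \<forall>\<theta> s t. f \<theta> s = f \<theta> t}"

lemma tame_ring_constants: "tame_ring (\<lambda>\<theta> t. 1) constants"
  unfolding tame_ring_def
proof (intro conjI ballI)
  show "subring constants" unfolding subring_def constants_def
    by (simp, metis)
  show "few_zeros (\<lambda>\<theta> t. 1)" unfolding few_zeros_def by simp
  show "(\<lambda>\<theta> t. 1) \<in> constants" by (simp add: constants_def)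
  fix f :: "'p \<Rightarrow> real \<Rightarrow> real" assume f: "f \<in> constants"
  then have sgn: "sgn_const_off (dom \<theta>) {} (f \<theta>)" for \<theta>
    unfolding sgn_const_off_def constants_def by simp metis
  show "tame f" unfolding tame_def
    by (intro exI[of _ 0] ballI exI[of _ "{}"] conjI sgn) simp_all
  have "(f \<theta> has_real_derivative 0) (at t)" for \<theta> t
  proof -
    have "f \<theta> = (\<lambda>_. f \<theta> 0)" using f by (auto simp: constants_def)
    then show ?thesis by (metis DERIV_const)
  qed
  then show "\<exists>g\<in>constants. has_der (\<lambda>\<theta> t. 1) f g"
    by (intro bexI[of _ "\<lambda>\<theta> t. 0"]) (auto simp: has_der_def constants_def)
qed

end

section \<open>The differential equation\<close>

lemma continuous_antiderivative:
  fixes g :: "real \<Rightarrow> real"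
  assumes g: "continuous_on UNIV g"
  shows "\<exists>G. G 0 = 0 \<and> (\<forall>t. (G has_real_derivative g t) (at t))"
proof (intro exI[of _ "\<lambda>u::real. LBINT y=ereal 0..ereal u. g y"] conjI allI)
  fix t :: real
  define l r where "l = min 0 t - 1" and "r = max 0 t + 1"
  have *: "l < 0" "0 < r" "l < t" "t < r" by (auto simp: l_def r_def)
  have "((\<lambda>u::real. LBINT y=ereal 0..ereal u. g y) has_vector_derivative g t) (at t within {l..r})"
    by (rule interval_integral_FTC2) (use * g in \<open>auto intro: continuous_on_subset\<close>)
  moreover have "at t within {l..r} = at t" using * by (intro at_within_interior) auto
  ultimately show "((\<lambda>u::real. LBINT y=ereal 0..ereal u. g y) has_real_derivative g t) (at t)"
    by (simp add: has_real_derivative_iff_has_vector_derivative)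
qed simp

text \<open>Both \<open>H - G\<close> and \<open>H + G\<close> are nondecreasing and vanish at 0,
  which settles negative times as well.\<close>

lemma abs_le_of_abs_deriv_le:
  fixes G H :: "real \<Rightarrow> real"
  assumes G: "\<And>t. (G has_real_derivative g t) (at t)" "G 0 = 0"
    and H: "\<And>t. (H has_real_derivative h t) (at t)" "H 0 = 0"
    and le: "\<And>t. \<bar>g t\<bar> \<le> h t"
  shows "\<bar>G t\<bar> \<le> \<bar>H t\<bar>"
proof -
  have mono: "H x - G x \<le> H y - G y" "H x + G x \<le> H y + G y" if "x \<le> y" for x y
  proof -
    have le': "g t \<le> h t" "- g t \<le> h t" for t using le[of t] by auto
    show "H x - G x \<le> H y - G y"
      by (rule DERIV_nonneg_imp_nondecreasing[OF that, of "\<lambda>t. H t - G t"])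
        (use DERIV_diff[OF H(1) G(1)] le' in force)
    show "H x + G x \<le> H y + G y"
      by (rule DERIV_nonneg_imp_nondecreasing[OF that, of "\<lambda>t. H t + G t"])
        (use DERIV_add[OF H(1) G(1)] le' in \<open>smt (verit)\<close>)
  qed
  show ?thesis using mono[of 0 t] mono[of t 0] G(2) H(2) by (cases "t \<ge> 0") auto
qed

lemma abs_sinh_le_cosh: "\<bar>sinh x\<bar> \<le> cosh (x::real)"
  using sinh_le_cosh_real[of x] sinh_le_cosh_real[of "- x"] by auto

text \<open>Contraction for the norm weighted by \<open>1 / cosh (2 L t)\<close>.\<close>

lemma ivp_exists:
  fixes F :: "real \<Rightarrow> real \<Rightarrow> real"
  assumes L: "L > 0" and lip: "\<And>s x y. \<bar>F s x - F s y\<bar> \<le> L * \<bar>x - y\<bar>"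
    and bd: "\<And>s. \<bar>F s 0\<bar> \<le> M"
    and cont: "\<And>z. continuous_on UNIV z \<Longrightarrow> continuous_on UNIV (\<lambda>s. F s (z s))"
  shows "\<exists>v. v 0 = x0 \<and> (\<forall>t. (v has_real_derivative F t (v t)) (at t))"
proof -
  \<comment> \<open>The weight grows like \<open>exp (2 * L * |t|)\<close> but is smooth at 0, so
    one formula serves both time directions.\<close>
  define c where "c t = cosh (2 * L * t)" for t
  have c1: "c t \<ge> 1" for t unfolding c_def by (rule cosh_real_ge_1)
  have c0: "c t > 0" "c t \<noteq> 0" for t using c1[of t] by auto
  have contc: "continuous_on UNIV c" unfolding c_def by (intro continuous_intros)
  \<comment> \<open>The antiderivative of \<open>d * c t\<close> that vanishes at 0. Its factor
    \<open>1 / (2 * L)\<close> turns the Lipschitz constant \<open>L\<close> into the contraction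
    constant 1/2.\<close>
  define H where "H d t = d / (2 * L) * sinh (2 * L * t)" for d t
  have H: "(H d has_real_derivative d * c t) (at t)" "H d 0 = 0" for d t
    unfolding H_def c_def using L by (auto intro!: derivative_eq_intros)
  have Hle: "\<bar>H d t\<bar> \<le> d / (2 * L) * c t" if "d \<ge> 0" for d t
    using that L abs_sinh_le_cosh[of "2 * L * t"]
    by (auto simp: H_def c_def abs_mult intro!: mult_left_mono divide_right_mono)
  obtain A where A: "\<And>g. continuous_on UNIV g \<Longrightarrow>
      A g 0 = 0 \<and> (\<forall>t. (A g has_real_derivative g t) (at t))"
    using continuous_antiderivative by metis
  \<comment> \<open>The unknown is \<open>z = v / c\<close>, a bounded continuous function: the
    fixed point problem lives in a Banach space although solutions may grow exponentially.\<close>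
  define N where "N z s = F s (z s * c s)" for z :: "real \<Rightarrow>\<^sub>C real" and s
  have contN: "continuous_on UNIV (N z)" for z
    unfolding N_def by (intro cont continuous_intros contc) auto
  note AN = A[OF contN]
  define P where "P z t = (x0 + A (N z) t) / c t" for z t
  have contA: "continuous_on UNIV (A (N z))" for z
    using AN by (intro continuous_at_imp_continuous_on ballI) (blast intro: DERIV_isCont)
  have P: "P z \<in> bcontfun" for z
  proof -
    obtain B where B: "\<And>t. \<bar>apply_bcontfun z t\<bar> \<le> B"
      using bounded_apply_bcontfun[of z] by (auto simp: bounded_iff)
    have "B \<ge> 0" using B[of 0] by linarith
    have "M \<ge> 0" using bd[of 0] by linarith
    have Nle: "\<bar>N z s\<bar> \<le> (M + L * B) * c s" for s
    proof -
      have "\<bar>N z s\<bar> \<le> \<bar>F s 0\<bar> + \<bar>F s (z s * c s) - F s 0\<bar>" unfolding N_def by linarith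
      also have "\<dots> \<le> M + L * \<bar>z s * c s - 0\<bar>" by (intro add_mono bd lip)
      also have "\<dots> \<le> M * c s + L * (B * c s)"
        using \<open>M \<ge> 0\<close> c1[of s] B[of s] L
        by (intro add_mono mult_left_mono) (auto simp: abs_mult mult_le_cancel_left1 intro!: mult_right_mono)
      finally show ?thesis by (simp add: algebra_simps)
    qed
    have "\<bar>A (N z) t\<bar> \<le> (M + L * B) / (2 * L) * c t" for t
      using abs_le_of_abs_deriv_le[of "A (N z)" "N z", OF _ _ H, of "M + L * B" t] AN Nle
        Hle[of "M + L * B" t] \<open>M \<ge> 0\<close> \<open>B \<ge> 0\<close> L by force
    then have *: "\<bar>A (N z) t\<bar> / c t \<le> (M + L * B) / (2 * L)" for t
      using c0 by (simp add: pos_divide_le_eq)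
    have "norm (P z t) \<le> \<bar>x0\<bar> + (M + L * B) / (2 * L)" for t
    proof -
      have "norm (P z t) \<le> \<bar>x0\<bar> / c t + \<bar>A (N z) t\<bar> / c t"
        using c0(1)[of t] unfolding P_def
        by (simp add: abs_divide divide_right_mono flip: add_divide_distrib)
      also have "\<bar>x0\<bar> / c t \<le> \<bar>x0\<bar>" using c1[of t] c0(1)[of t]
        by (simp add: pos_divide_le_eq mult_le_cancel_left1)
      finally show ?thesis using *[of t] by linarith
    qed
    moreover have "continuous_on UNIV (P z)"
      unfolding P_def by (intro continuous_intros contA contc) (use c0 in auto)
    ultimately show ?thesis by (intro bcontfun_normI)
  qed
  define \<Phi> where "\<Phi> z = Bcontfun (P z)" for z
  have \<Phi>: "apply_bcontfun (\<Phi> z) t = P z t" for z t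
    unfolding \<Phi>_def using Bcontfun_inverse[OF P] by simp
  have "dist (\<Phi> z) (\<Phi> w) \<le> 1/2 * dist z w" for z w
  proof (rule dist_bound)
    fix t
    define d where "d = dist z w"
    have "\<bar>N z s - N w s\<bar> \<le> (L * d) * c s" for s
    proof -
      have "\<bar>N z s - N w s\<bar> \<le> L * \<bar>z s * c s - w s * c s\<bar>" unfolding N_def by (rule lip)
      also have "\<dots> = L * (dist (z s) (w s) * c s)"
        using c0(1)[of s] by (simp add: dist_real_def abs_mult flip: left_diff_distrib)
      also have "\<dots> \<le> L * (d * c s)" unfolding d_def
        using L c0(1)[of s] by (intro mult_left_mono mult_right_mono dist_bounded) auto
      finally show ?thesis by (simp add: mult_ac)
    qed
    from abs_le_of_abs_deriv_le[of "\<lambda>t. A (N z) t - A (N w) t" "\<lambda>s. N z s - N w s", OF _ _ H this]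
    have "\<bar>A (N z) t - A (N w) t\<bar> \<le> \<bar>H (L * d) t\<bar>" using AN by (auto intro: DERIV_diff)
    also have "\<dots> \<le> d / 2 * c t" using Hle[of "L * d" t] L by (simp add: d_def)
    finally have "\<bar>A (N z) t - A (N w) t\<bar> / c t \<le> d / 2" using c0 by (simp add: pos_divide_le_eq)
    moreover have "dist (P z t) (P w t) = \<bar>A (N z) t - A (N w) t\<bar> / c t"
      using c0(1)[of t] by (simp add: P_def dist_real_def flip: diff_divide_distrib)
    ultimately show "dist (\<Phi> z t) (\<Phi> w t) \<le> 1/2 * dist z w" by (simp add: \<Phi> d_def)
  qed
  then have "\<exists>!z. \<Phi> z = z" by (intro banach_fix_type[of "1/2"]) auto
  then obtain z where z: "\<Phi> z = z" by blast
  define v where "v t = x0 + A (N z) t" for t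
  have vz: "v t = z t * c t" for t
    using \<Phi>[of z t] c0(2)[of t] by (simp add: z v_def P_def)
  have "(v has_real_derivative F t (v t)) (at t)" for t
  proof -
    have "(v has_real_derivative 0 + N z t) (at t)"
      unfolding v_def by (intro DERIV_add DERIV_const) (use AN in blast)
    then show ?thesis by (simp add: N_def vz)
  qed
  moreover have "v 0 = x0" using AN by (simp add: v_def)
  ultimately show ?thesis by blast
qed

section \<open>The vector field, its solutions, their order and isolation\<close>

lemma pwl_eq_sat: "pwl a b x = a * x + (b - a) * max (-1) (min 1 x)"
  by (auto simp: pwl_def max_def min_def algebra_simps)

lemma pwl_minus: "pwl a b (- x) = - pwl a b x"
  by (auto simp: pwl_def algebra_simps)

lemma pwl_lipschitz: "\<bar>pwl a b x - pwl a b y\<bar> \<le> (\<bar>a\<bar> + \<bar>b - a\<bar>) * \<bar>x - y\<bar>"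
proof -
  define s where "s x = max (-1) (min 1 x)" for x :: real
  have s: "\<bar>s x - s y\<bar> \<le> \<bar>x - y\<bar>" by (auto simp: s_def max_def min_def)
  have "\<bar>pwl a b x - pwl a b y\<bar> = \<bar>a * (x - y) + (b - a) * (s x - s y)\<bar>"
    unfolding pwl_eq_sat s_def by (simp add: algebra_simps)
  also have "\<dots> \<le> \<bar>a\<bar> * \<bar>x - y\<bar> + \<bar>b - a\<bar> * \<bar>s x - s y\<bar>"
    by (metis abs_mult abs_triangle_ineq)
  also have "\<dots> \<le> \<bar>a\<bar> * \<bar>x - y\<bar> + \<bar>b - a\<bar> * \<bar>x - y\<bar>"
    by (intro add_mono mult_left_mono s) auto
  finally show ?thesis by (simp add: algebra_simps)
qed

text \<open>Initial data at an arbitrary time are wanted because solutions will be labelled by the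
  time at which they cross \<open>x = -1\<close>. Shifting the forcing reduces this to time
  0.\<close>

lemma solution_exists: "\<exists>v. solution a b \<mu> v \<and> v \<tau> = x0"
proof -
  have "\<exists>v. v 0 = x0 \<and> (\<forall>t. (v has_real_derivative pwl a b (v t) + \<mu> * sin (t + \<tau>)) (at t))"
  proof (rule ivp_exists)
    \<comment> \<open>The summand 1 makes the Lipschitz constant positive also for
      \<open>a = b = 0\<close>.\<close>
    show "\<bar>pwl a b x + \<mu> * sin (s + \<tau>) - (pwl a b y + \<mu> * sin (s + \<tau>))\<bar> \<le> (\<bar>a\<bar> + \<bar>b - a\<bar> + 1) * \<bar>x - y\<bar>"
      for s x y using pwl_lipschitz[of a b x y] by (simp add: algebra_simps add_increasing)
    show "\<bar>pwl a b 0 + \<mu> * sin (s + \<tau>)\<bar> \<le> \<bar>\<mu>\<bar>" for s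
      using mult_left_mono[of "\<bar>sin (s + \<tau>)\<bar>" 1 "\<bar>\<mu>\<bar>"] by (simp add: pwl_def abs_mult)
    show "continuous_on UNIV (\<lambda>s. pwl a b (z s) + \<mu> * sin (s + \<tau>))" if "continuous_on UNIV z" for z
      unfolding pwl_eq_sat by (intro continuous_intros that)
  qed auto
  then obtain v where v: "v 0 = x0" "\<And>t. (v has_real_derivative pwl a b (v t) + \<mu> * sin (t + \<tau>)) (at t)"
    by blast
  have "((\<lambda>t. v (t + - \<tau>)) has_real_derivative pwl a b (v (t - \<tau>)) + \<mu> * sin t) (at t)" for t
    using v(2)[of "t - \<tau>"] DERIV_shift[of v _ t "- \<tau>"] by simp
  then show ?thesis
    by (intro exI[of _ "\<lambda>t. v (t - \<tau>)"]) (simp add: solution_def v(1))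
qed

lemma solution_deriv:
  "solution a b \<mu> v \<Longrightarrow> (v has_real_derivative (pwl a b (v t) + \<mu> * sin t)) (at t)"
  by (simp add: solution_def)

lemma solution_continuous: "solution a b \<mu> v \<Longrightarrow> continuous_on S v"
  by (intro continuous_at_imp_continuous_on ballI) (blast intro: DERIV_isCont solution_deriv)

lemma solution_unique:
  assumes u: "solution a b \<mu> u" and v: "solution a b \<mu> v" and eq: "u s = v s"
  shows "u = v"
proof
  fix t
  have "u t - v t = 0"
  proof (rule gronwall_zero[where w = "\<lambda>t. u t - v t" and c = s and s = "min s t" and t = "max s t"])
    fix r
    show "((\<lambda>t. u t - v t) has_real_derivative
        (pwl a b (u r) + \<mu> * sin r) - (pwl a b (v r) + \<mu> * sin r)) (at r)"
      by (intro DERIV_diff solution_deriv u v)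
    show "\<bar>pwl a b (u r) + \<mu> * sin r - (pwl a b (v r) + \<mu> * sin r)\<bar> \<le> (\<bar>a\<bar> + \<bar>b - a\<bar>) * \<bar>u r - v r\<bar>"
      using pwl_lipschitz[of a b "u r" "v r"] by simp
  qed (use eq in auto)
  then show "u t = v t" by simp
qed

text \<open>A change of order would make two solutions meet, hence coincide. This order is what
  later squeezes solutions between two cycles.\<close>

lemma solution_less:
  assumes u: "solution a b \<mu> u" and v: "solution a b \<mu> v" and less: "u s < v s"
  shows "u t < v t"
proof (rule ccontr)
  assume ge: "\<not> u t < v t"
  have cont: "continuous_on S (\<lambda>t. v t - u t)" for S
    by (intro continuous_intros solution_continuous[OF u] solution_continuous[OF v])
  have "\<exists>r. v r - u r = 0"
  proof (cases "s \<le> t")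
    case True
    then show ?thesis using IVT2'[of "\<lambda>t. v t - u t" t 0 s, OF _ _ True cont] less ge by force
  next
    case False
    then show ?thesis using IVT'[of "\<lambda>t. v t - u t" t 0 s, OF _ _ _ cont] less ge by force
  qed
  then obtain r where "u r = v r" by (metis eq_iff_diff_eq_0)
  then show False using solution_unique[OF u v, of r] less by auto
qed

lemma solution_minus:
  assumes "solution a b \<mu> v"
  shows "solution a b (- \<mu>) (\<lambda>t. - v t)"
  unfolding solution_def
proof
  fix t
  show "((\<lambda>t. - v t) has_real_derivative pwl a b (- v t) + - \<mu> * sin t) (at t)"
    using DERIV_minus[OF solution_deriv[OF assms, of t]] by (simp add: pwl_minus)
qed

lemma solution_shift:
  assumes "solution a b \<mu> v"
  shows "solution a b \<mu> (\<lambda>t. v (t + 2 * pi))"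
  unfolding solution_def
proof
  fix t
  show "((\<lambda>t. v (t + 2 * pi)) has_real_derivative pwl a b (v (t + 2 * pi)) + \<mu> * sin t) (at t)"
    using solution_deriv[OF assms, of "t + 2 * pi"] DERIV_shift[of v _ t "2 * pi"] by simp
qed

lemma periodic_iff_return:
  assumes "solution a b \<mu> v"
  shows "periodic_solution a b \<mu> v \<longleftrightarrow> v (s + 2 * pi) = v s"
proof
  assume "v (s + 2 * pi) = v s"
  from solution_unique[OF solution_shift[OF assms] assms this]
  have "v (t + 2 * pi) = v t" for t by metis
  then show "periodic_solution a b \<mu> v" using assms by (simp add: periodic_solution_def)
qed (simp add: periodic_solution_def)

lemma displacement_zero_iff:
  assumes "solution a b \<mu> v"
  shows "displacement a b \<mu> (v 0) = 0 \<longleftrightarrow> periodic_solution a b \<mu> v"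
proof -
  have "(THE w. solution a b \<mu> w \<and> w 0 = v 0) = v"
    using assms solution_unique[where s = 0] by (intro the_equality) auto
  then show ?thesis using periodic_iff_return[OF assms, of 0]
    by (auto simp: displacement_def flow_def)
qed

lemma limit_cycle_solution: "limit_cycle a b \<mu> v \<Longrightarrow> solution a b \<mu> v"
  and limit_cycle_periodic: "limit_cycle a b \<mu> v \<Longrightarrow> periodic_solution a b \<mu> v"
  by (auto simp: limit_cycle_def periodic_solution_def)

lemma limit_cycle_minus:
  assumes "limit_cycle a b \<mu> v"
  shows "limit_cycle a b (- \<mu>) (\<lambda>t. - v t)"
proof -
  have disp: "displacement a b (- \<mu>) (- x) = 0" if "displacement a b \<mu> x = 0" for \<mu> x
  proof -
    obtain w where w: "solution a b \<mu> w" "w 0 = x" using solution_exists by blast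
    then have "periodic_solution a b \<mu> w" using displacement_zero_iff[OF w(1)] that by simp
    then have "periodic_solution a b (- \<mu>) (\<lambda>t. - w t)"
      using solution_minus by (auto simp: periodic_solution_def)
    then show ?thesis using displacement_zero_iff[OF solution_minus[OF w(1)]] w by simp
  qed
  have per: "periodic_solution a b (- \<mu>) (\<lambda>t. - v t)"
    using assms solution_minus by (auto simp: limit_cycle_def periodic_solution_def)
  from assms obtain e where e: "e > 0" "\<And>y. displacement a b \<mu> y = 0 \<Longrightarrow> dist (v 0) y < e \<Longrightarrow> y = v 0"
    by (auto simp: limit_cycle_def isolated_in_dist_Ex_iff)
  have "- v 0 isolated_in {x. displacement a b (- \<mu>) x = 0}"
    unfolding isolated_in_dist_Ex_iff
  proof (intro conjI exI[of _ e] ballI impI)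
    show "- v 0 \<in> {x. displacement a b (- \<mu>) x = 0}"
      using disp assms by (auto simp: limit_cycle_def isolated_in_def)
    fix y assume y: "y \<in> {x. displacement a b (- \<mu>) x = 0}" "dist (- v 0) y < e"
    have "displacement a b \<mu> (- y) = 0" using disp[of "- \<mu>" y] y by simp
    moreover have "dist (v 0) (- y) < e" using y(2) unfolding dist_real_def by linarith
    ultimately show "y = - v 0" using e(2)[of "- y"] by simp
  qed (rule e)
  then show ?thesis using per by (simp add: limit_cycle_def)
qed

text \<open>The form in which isolation is exploited: a strip filled with periodic solutions
  excludes limit cycles, also on its boundary. The closed ends matter, since the cycle in question
  often bounds the strip itself.\<close>

lemma limit_cycle_not_between:
  assumes v: "limit_cycle a b \<mu> v" and cd: "c < d" "c \<le> v 0" "v 0 \<le> d"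
    and per: "\<And>w. solution a b \<mu> w \<Longrightarrow> c < w 0 \<Longrightarrow> w 0 < d \<Longrightarrow> periodic_solution a b \<mu> w"
  shows False
proof -
  from v obtain e where e: "e > 0" "\<And>y. displacement a b \<mu> y = 0 \<Longrightarrow> dist (v 0) y < e \<Longrightarrow> y = v 0"
    by (auto simp: limit_cycle_def isolated_in_dist_Ex_iff)
  have "\<exists>y. y \<noteq> v 0 \<and> c < y \<and> y < d \<and> dist (v 0) y < e"
  proof (cases "v 0 < d")
    case True
    define y where "y = min (v 0 + e / 2) ((v 0 + d) / 2)"
    have "v 0 < y" "y < d" "y \<le> v 0 + e / 2" using True e(1) by (auto simp: y_def min_def)
    then show ?thesis using cd e(1) by (intro exI[of _ y]) (auto simp: dist_real_def)
  next
    case False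
    define y where "y = max (v 0 - e / 2) ((v 0 + c) / 2)"
    have "y < v 0" "c < y" "y \<ge> v 0 - e / 2" using False cd e(1) by (auto simp: y_def max_def)
    then show ?thesis using cd e(1) by (intro exI[of _ y]) (auto simp: dist_real_def)
  qed
  then obtain y where y: "y \<noteq> v 0" "c < y" "y < d" "dist (v 0) y < e" by blast
  obtain w where w: "solution a b \<mu> w" "w 0 = y" using solution_exists by blast
  with per[OF w(1)] y have "displacement a b \<mu> y = 0" using displacement_zero_iff[OF w(1)] by simp
  then show False using e(2) y by blast
qed


section \<open>Limit cycles of a monotone vector field or of one with a single kink\<close>

lemma periodic_deriv_nonneg_imp_zero:
  fixes h :: "real \<Rightarrow> real"
  assumes der: "\<And>t. (h has_real_derivative h' t) (at t)" and nonneg: "\<And>t. h' t \<ge> 0"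
    and per: "\<And>t. h (t + 2 * pi) = h t"
  shows "h' t = 0"
proof (rule DERIV_local_const[OF der, of pi])
  have mono: "h x \<le> h y" if "x \<le> y" for x y
    by (rule DERIV_nonneg_imp_nondecreasing[OF that]) (use der nonneg in blast)
  have "t - pi + 2 * pi = t + pi" by simp
  then have ends: "h (t + pi) = h (t - pi)" using per[of "t - pi"] by metis
  have const: "h y = h (t - pi)" if "t - pi \<le> y" "y \<le> t + pi" for y
    using mono[OF that(1)] mono[OF that(2)] ends by linarith
  show "\<forall>y. \<bar>t - y\<bar> < pi \<longrightarrow> h t = h y"
  proof (intro allI impI)
    fix y assume "\<bar>t - y\<bar> < pi"
    then have "h y = h (t - pi)" by (intro const) linarith+
    moreover have "h t = h (t - pi)" by (intro const) auto
    ultimately show "h t = h y" by simp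
  qed
qed simp

text \<open>Where the field is affine on every segment from \<open>u t\<close> to
  \<open>w t\<close>, combinations of the two solutions with a weight constant in time are solutions
  again, and periodic. The weight is read off at time 0.\<close>

lemma periodic_between_affine:
  assumes u: "periodic_solution a b \<mu> u" and w: "periodic_solution a b \<mu> w"
    and c: "solution a b \<mu> c" "u 0 < c 0" "c 0 < w 0"
    and aff: "\<And>t \<kappa>. 0 \<le> \<kappa> \<Longrightarrow> \<kappa> \<le> 1 \<Longrightarrow>
      pwl a b (u t + \<kappa> * (w t - u t)) = pwl a b (u t) + \<kappa> * (pwl a b (w t) - pwl a b (u t))"
  shows "periodic_solution a b \<mu> c"
proof -
  have su: "solution a b \<mu> u" and sw: "solution a b \<mu> w"
    using u w by (auto simp: periodic_solution_def)
  define \<kappa> where "\<kappa> = (c 0 - u 0) / (w 0 - u 0)"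
  have \<kappa>: "0 \<le> \<kappa>" "\<kappa> \<le> 1" using c by (auto simp: \<kappa>_def divide_simps)
  define z where "z t = u t + \<kappa> * (w t - u t)" for t
  have "solution a b \<mu> z" unfolding solution_def
  proof
    fix t
    have "(z has_real_derivative (pwl a b (u t) + \<mu> * sin t) +
        \<kappa> * ((pwl a b (w t) + \<mu> * sin t) - (pwl a b (u t) + \<mu> * sin t))) (at t)"
      unfolding z_def by (intro DERIV_add DERIV_cmult DERIV_diff solution_deriv su sw)
    then show "(z has_real_derivative pwl a b (z t) + \<mu> * sin t) (at t)"
      by (rule DERIV_cong) (use aff[OF \<kappa>, of t] in \<open>simp add: z_def algebra_simps\<close>)
  qed
  moreover have "z 0 = c 0" using c by (simp add: z_def \<kappa>_def)
  ultimately have "z = c" using solution_unique c(1) by blast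
  moreover have "z (t + 2 * pi) = z t" for t
    using u w by (simp add: z_def periodic_solution_def)
  ultimately show ?thesis using c(1) by (simp add: periodic_solution_def)
qed

text \<open>\<open>p\<close> and \<open>q\<close> are the lengths of the parts of the segment from
  \<open>x\<close> to \<open>y\<close> outside and inside \<open>[-1, 1]\<close>.\<close>

lemma pwl_diff:
  assumes "x \<le> y"
  obtains p q where "p \<ge> 0" "q \<ge> 0" "pwl a b y - pwl a b x = a * p + b * q"
proof
  define s where "s x = max (-1) (min 1 x)" for x :: real
  show "0 \<le> (y - s y) - (x - s x)" "0 \<le> s y - s x"
    using assms by (auto simp: s_def max_def min_def)
  show "pwl a b y - pwl a b x = a * ((y - s y) - (x - s x)) + b * (s y - s x)"
    by (simp add: pwl_eq_sat s_def algebra_simps)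
qed

text \<open>The difference \<open>w - u\<close> is monotone in time and periodic, hence constant.
  The field is then constant on each segment between \<open>u\<close> and \<open>w\<close>, and the
  strip consists of periodic solutions. This also disposes of \<open>a = b\<close> and
  \<open>a = 0\<close>.\<close>

lemma limit_cycles_monotone:
  assumes ab: "a * b \<ge> 0" and u: "limit_cycle a b \<mu> u" and w: "limit_cycle a b \<mu> w" and less: "u 0 < w 0"
  shows False
proof -
  note su = limit_cycle_solution[OF u] and sw = limit_cycle_solution[OF w]
  note pu = limit_cycle_periodic[OF u] and pw = limit_cycle_periodic[OF w]
  have less': "u t < w t" for t by (rule solution_less[OF su sw less])
  obtain \<sigma> :: real where \<sigma>: "\<sigma> \<noteq> 0" "\<sigma> * a \<ge> 0" "\<sigma> * b \<ge> 0"
  proof (cases "a \<ge> 0 \<and> b \<ge> 0")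
    case True
    then show ?thesis using that[of 1] by simp
  next
    case False
    then show ?thesis using that[of "-1"] ab by (auto simp: zero_le_mult_iff)
  qed
  have mono: "\<sigma> * pwl a b x \<le> \<sigma> * pwl a b y" if xy: "x \<le> y" for x y
  proof -
    obtain p q where pq: "p \<ge> 0" "q \<ge> 0" "pwl a b y - pwl a b x = a * p + b * q"
      by (rule pwl_diff[OF xy])
    have "\<sigma> * (pwl a b y - pwl a b x) = (\<sigma> * a) * p + (\<sigma> * b) * q"
      by (simp add: pq(3) algebra_simps)
    also have "\<dots> \<ge> 0" using \<sigma> pq by simp
    finally show ?thesis by (simp add: algebra_simps)
  qed
  have "\<sigma> * (pwl a b (w t) - pwl a b (u t)) = 0" for t
  proof (rule periodic_deriv_nonneg_imp_zero[where h = "\<lambda>t. \<sigma> * (w t - u t)"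
        and h' = "\<lambda>t. \<sigma> * (pwl a b (w t) - pwl a b (u t))"])
    show "((\<lambda>t. \<sigma> * (w t - u t)) has_real_derivative \<sigma> * (pwl a b (w t) - pwl a b (u t))) (at t)" for t
      using DERIV_cmult[OF DERIV_diff[OF solution_deriv[OF sw] solution_deriv[OF su]], of \<sigma> t] by simp
    show "0 \<le> \<sigma> * (pwl a b (w t) - pwl a b (u t))" for t
      using mono[OF less_imp_le[OF less'[of t]]] by (simp add: algebra_simps)
  qed (use pu pw in \<open>simp add: periodic_solution_def\<close>)
  then have eq: "pwl a b (w t) = pwl a b (u t)" for t using \<sigma>(1) by simp
  have aff: "pwl a b (u t + \<kappa> * (w t - u t)) = pwl a b (u t) + \<kappa> * (pwl a b (w t) - pwl a b (u t))"
    if "0 \<le> \<kappa>" "\<kappa> \<le> 1" for t \<kappa>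
  proof -
    have "u t + \<kappa> * (w t - u t) \<le> u t + 1 * (w t - u t)"
      using that less'[of t] by (intro add_left_mono mult_right_mono) auto
    then have "\<sigma> * pwl a b (u t + \<kappa> * (w t - u t)) \<le> \<sigma> * pwl a b (w t)"
      by (intro mono) simp
    moreover have "\<sigma> * pwl a b (u t) \<le> \<sigma> * pwl a b (u t + \<kappa> * (w t - u t))"
      using that less'[of t] by (intro mono) simp
    ultimately show ?thesis using eq[of t] \<sigma>(1) by simp
  qed
  show False
    by (rule limit_cycle_not_between[OF u less _ _ periodic_between_affine[OF pu pw _ _ _ aff]])
      (use less in auto)
qed

text \<open>Convexity of the hinge together with its equality case, free of division: the chord is
  met only if the kink 1 is not strictly between \<open>u\<close> and \<open>w\<close>.\<close>

lemma hinge_below_chord: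
  fixes u v w :: real
  defines "m \<equiv> \<lambda>x. max 0 (x - 1)"
  assumes "u < v" "v < w"
  shows "(m v - m u) * (w - u) \<le> (v - u) * (m w - m u)"
    and "(m v - m u) * (w - u) = (v - u) * (m w - m u) \<Longrightarrow> w \<le> 1 \<or> u \<ge> 1"
proof -
  have "(m v - m u) * (w - u) \<le> (v - u) * (m w - m u) \<and>
    ((m v - m u) * (w - u) = (v - u) * (m w - m u) \<longrightarrow> w \<le> 1 \<or> u \<ge> 1)"
  proof (cases "w \<le> 1 \<or> u \<ge> 1")
    case True
    then show ?thesis using assms by (auto simp: m_def max_def)
  next
    case uw: False
    then have "m u = 0" "m w = w - 1" by (auto simp: m_def)
    moreover have "(m v - 0) * (w - u) < (v - u) * (w - 1)"
    proof (cases "v \<le> 1")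
      case True
      then have "m v = 0" by (simp add: m_def)
      then show ?thesis using uw assms by simp
    next
      case False
      then have mv: "m v = v - 1" by (simp add: m_def)
      have "(v - u) * (w - 1) - (v - 1) * (w - u) = (1 - u) * (w - v)" by (simp add: algebra_simps)
      moreover have "\<dots> > 0" using uw assms by simp
      ultimately show ?thesis unfolding mv by simp
    qed
    ultimately show ?thesis by simp
  qed
  then show "(m v - m u) * (w - u) \<le> (v - u) * (m w - m u)"
    and "(m v - m u) * (w - u) = (v - u) * (m w - m u) \<Longrightarrow> w \<le> 1 \<or> u \<ge> 1" by blast+
qed

text \<open>In the derivative of the periodic ratio \<open>(v - u) / (w - u)\<close> the linear part
  of the field cancels and convexity of the hinge leaves a term of fixed sign. The ratio is
  therefore constant, the kink never lies strictly between \<open>u\<close> and \<open>w\<close>,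
  and the field is affine across the strip.\<close>

lemma limit_cycles_one_kink:
  assumes u: "limit_cycle a b \<mu> u" and v: "limit_cycle a b \<mu> v" and w: "limit_cycle a b \<mu> w"
    and uv: "u 0 < v 0" and vw: "v 0 < w 0" and ge: "\<And>t. u t \<ge> -1"
  shows False
proof (cases "a = b")
  case True
  then show False using limit_cycles_monotone[OF _ u v uv] by simp
next
  case False
  note su = limit_cycle_solution[OF u] and sv = limit_cycle_solution[OF v] and sw = limit_cycle_solution[OF w]
  note pu = limit_cycle_periodic[OF u] and pv = limit_cycle_periodic[OF v] and pw = limit_cycle_periodic[OF w]
  have uv': "u t < v t" and vw': "v t < w t" for t
    by (rule solution_less[OF su sv uv], rule solution_less[OF sv sw vw])
  define m where "m = (\<lambda>x::real. max 0 (x - 1))"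
  have pwl: "pwl a b x = b * x + (a - b) * m x" if "x \<ge> -1" for x
    using that by (cases "x \<le> -1") (auto simp: pwl_def m_def max_def algebra_simps)
  have f: "pwl a b (u t) = b * u t + (a - b) * m (u t)" "pwl a b (v t) = b * v t + (a - b) * m (v t)"
    "pwl a b (w t) = b * w t + (a - b) * m (w t)" for t
    using ge[of t] uv'[of t] vw'[of t] by (auto intro!: pwl)
  define Q where "Q t = (v t - u t) * (m (w t) - m (u t)) - (m (v t) - m (u t)) * (w t - u t)" for t
  have Q: "Q t \<ge> 0" "Q t = 0 \<Longrightarrow> w t \<le> 1 \<or> u t \<ge> 1" for t
    using hinge_below_chord[OF uv'[of t] vw'[of t]] by (auto simp: Q_def m_def)
  define \<sigma> where "\<sigma> = sgn (b - a)"
  have \<sigma>: "\<sigma> * (b - a) > 0" using False by (auto simp: \<sigma>_def sgn_real_def)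
  have "\<sigma> * ((b - a) * Q t / (w t - u t)\<^sup>2) = 0" for t
  proof (rule periodic_deriv_nonneg_imp_zero[where h = "\<lambda>t. \<sigma> * ((v t - u t) / (w t - u t))"
        and h' = "\<lambda>t. \<sigma> * ((b - a) * Q t / (w t - u t)\<^sup>2)"])
    fix t
    have ne: "w t - u t \<noteq> 0" using uv'[of t] vw'[of t] by simp
    have num: "((pwl a b (v t) + \<mu> * sin t) - (pwl a b (u t) + \<mu> * sin t)) * (w t - u t) -
          (v t - u t) * ((pwl a b (w t) + \<mu> * sin t) - (pwl a b (u t) + \<mu> * sin t)) = (b - a) * Q t"
      unfolding f Q_def by (simp add: algebra_simps)
    show "((\<lambda>t. \<sigma> * ((v t - u t) / (w t - u t))) has_real_derivative
        \<sigma> * ((b - a) * Q t / (w t - u t)\<^sup>2)) (at t)"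
      using DERIV_cmult[OF DERIV_divide[OF DERIV_diff[OF solution_deriv[OF sv] solution_deriv[OF su]]
            DERIV_diff[OF solution_deriv[OF sw] solution_deriv[OF su]] ne], of \<sigma>]
      unfolding num power2_eq_square .
    show "0 \<le> \<sigma> * ((b - a) * Q t / (w t - u t)\<^sup>2)"
      using \<sigma> Q(1)[of t] by (simp add: mult.assoc[symmetric])
  qed (use pu pv pw in \<open>simp add: periodic_solution_def\<close>)
  then have "Q t = 0" for t using \<sigma> uv'[of t] vw'[of t] by (force simp: mult.assoc[symmetric])
  then have wu: "w t \<le> 1 \<or> u t \<ge> 1" for t using Q(2) by blast
  have aff: "pwl a b (u t + \<kappa> * (w t - u t)) = pwl a b (u t) + \<kappa> * (pwl a b (w t) - pwl a b (u t))"
    if \<kappa>: "0 \<le> \<kappa>" "\<kappa> \<le> 1" for t \<kappa>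
  proof -
    have lt: "u t < w t" using uv'[of t] vw'[of t] by simp
    have "u t + \<kappa> * (w t - u t) \<le> u t + 1 * (w t - u t)"
      using \<kappa> lt by (intro add_left_mono mult_right_mono) auto
    moreover have lo: "u t \<le> u t + \<kappa> * (w t - u t)" using \<kappa> lt by simp
    ultimately have mm: "m (u t + \<kappa> * (w t - u t)) = m (u t) + \<kappa> * (m (w t) - m (u t))"
      using wu[of t] lt
    proof (elim disjE)
      assume "u t \<ge> 1"
      then have "m x = x - 1" if "x \<ge> u t" for x using that by (simp add: m_def)
      then show ?thesis using lo lt by simp
    qed (auto simp: m_def)
    have "u t + \<kappa> * (w t - u t) \<ge> -1" using lo ge[of t] by linarith
    then have "pwl a b (u t + \<kappa> * (w t - u t)) =
        b * (u t + \<kappa> * (w t - u t)) + (a - b) * m (u t + \<kappa> * (w t - u t))" by (rule pwl)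
    then show ?thesis unfolding mm f by (simp add: algebra_simps)
  qed
  have "u 0 < w 0" using uv vw by simp
  then show False
    by (rule limit_cycle_not_between[OF v _ _ _ periodic_between_affine[OF pu pw _ _ _ aff]])
      (use uv vw in auto)
qed

section \<open>Crossing times\<close>

text \<open>Signed deviation at time \<open>t\<close> of the level \<xi> from the periodic solution
  \<open>- m / c - \<mu> / (1 + c\<^sup>2) * (c * sin t + cos t)\<close> of
  \<open>x' = c * x + m + \<mu> * sin t\<close>, where \<open>\<kappa> = \<xi> + m / c\<close>.
  Writing it with \<kappa> also covers \<open>c = 0\<close> when \<open>m = 0\<close>.\<close>

definition amp :: "real \<Rightarrow> real \<Rightarrow> real \<Rightarrow> real \<Rightarrow> real" where
  "amp c \<kappa> \<mu> t = \<kappa> + \<mu> / (1 + c\<^sup>2) * (c * sin t + cos t)"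

text \<open>For \<open>\<kappa> = \<xi> + m / c\<close>, the solution of \<open>x' = c x + m + \<mu> sin t\<close> starting at time \<open>t\<close> from \<open>\<xi>\<close>
  is characterised by the value of the following first integral.\<close>

definition first_integral :: "real \<Rightarrow> real \<Rightarrow> real \<Rightarrow> real \<Rightarrow> real" where
  "first_integral c \<kappa> \<mu> t = exp (- c * t) * amp c \<kappa> \<mu> t"

lemma one_plus_square_neq_zero: "1 + x\<^sup>2 \<noteq> (0 :: real)"
  using zero_le_power2[of x] by linarith

text \<open>The factor \<open>c * \<kappa> + \<mu> * sin t\<close> is the speed
  \<open>c * \<xi> + m + \<mu> * sin t\<close> with which solutions cross the level \<xi> at time
  \<open>t\<close>. The first integral is thus strictly monotone on arcs of transversal
  crossing.\<close>

lemma first_integral_deriv: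
  "(first_integral c \<kappa> \<mu> has_real_derivative - exp (- c * t) * (c * \<kappa> + \<mu> * sin t)) (at t)"
proof -
  have "(first_integral c \<kappa> \<mu> has_real_derivative
     (exp (- c * t) * (- c)) * (\<kappa> + \<mu> / (1 + c\<^sup>2) * (c * sin t + cos t)) +
     exp (- c * t) * (\<mu> / (1 + c\<^sup>2) * (c * cos t - sin t))) (at t)"
    unfolding first_integral_def amp_def by (auto intro!: derivative_eq_intros simp: one_plus_square_neq_zero)
  moreover have "(exp (- c * t) * (- c)) * (\<kappa> + k * (c * sin t + cos t)) +
     exp (- c * t) * (k * (c * cos t - sin t)) = - exp (- c * t) * (c * \<kappa> + k * ((1 + c\<^sup>2) * sin t))" for k
    by (simp add: algebra_simps power2_eq_square)
  moreover have "\<mu> / (1 + c\<^sup>2) * ((1 + c\<^sup>2) * sin t) = \<mu> * sin t"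
    by (simp add: one_plus_square_neq_zero)
  ultimately show ?thesis by (simp only:)
qed

lemma first_integral_inj:
  assumes "\<And>t. t \<in> {p<..<q} \<Longrightarrow> c * \<kappa> + \<mu> * sin t \<noteq> 0"
  shows "inj_on (first_integral c \<kappa> \<mu>) {p<..<q}"
proof -
  have "first_integral c \<kappa> \<mu> x \<noteq> first_integral c \<kappa> \<mu> y" if "x < y" "x \<in> {p<..<q}" "y \<in> {p<..<q}" for x y
  proof
    assume eq: "first_integral c \<kappa> \<mu> x = first_integral c \<kappa> \<mu> y"
    from MVT2[OF that(1) first_integral_deriv] obtain z where z: "x < z" "z < y"
      "first_integral c \<kappa> \<mu> y - first_integral c \<kappa> \<mu> x = (y - x) * (- exp (- c * z) * (c * \<kappa> + \<mu> * sin z))"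
      by blast
    then show False using eq assms[of z] that by auto
  qed
  then show ?thesis by (intro inj_onI) (metis linorder_neqE_linordered_idom)
qed

text \<open>Crossing times are chosen pointwise, so their continuity is not known beforehand.
  Injectivity of \<open>K\<close> on the arc exhibits \<open>T\<close> as the inverse
  \<open>J\<close> of \<open>K\<close> applied to \<open>G\<close>, and the inverse function theorem
  differentiates \<open>J\<close>.\<close>

lemma implicit_deriv:
  fixes K T G :: "real \<Rightarrow> real"
  assumes I: "I = {l<..<h}" and P: "P = {p<..<q}" and inj: "inj_on K P"
    and K: "\<And>x. x \<in> P \<Longrightarrow> (K has_real_derivative k x) (at x)" "\<And>x. x \<in> P \<Longrightarrow> k x \<noteq> 0"
    and T: "\<And>t. t \<in> I \<Longrightarrow> T t \<in> P" "\<And>t. t \<in> I \<Longrightarrow> K (T t) = G t"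
    and t: "t \<in> I" and G: "(G has_real_derivative g) (at t)"
  shows "(T has_real_derivative g / k (T t)) (at t)"
proof -
  define J where "J = inv_into P K"
  have J: "J (K x) = x" if "x \<in> P" for x unfolding J_def by (rule inv_into_f_f[OF inj that])
  have Tt: "T t \<in> P" by (rule T(1)[OF t])
  have "(J has_derivative (*) (inverse (k (T t)))) (at (K (T t)))"
  proof (rule has_derivative_inverse_strong[of P "T t" K J "(*) (k (T t))"])
    show "continuous_on P K"
      using K(1) by (intro continuous_at_imp_continuous_on ballI) (blast intro: DERIV_isCont)
    show "(K has_derivative (*) (k (T t))) (at (T t))"
      using K(1)[OF Tt] by (simp add: has_field_derivative_def)
    show "(*) (k (T t)) \<circ> (*) (inverse (k (T t))) = id" using K(2)[OF Tt] by (auto simp: fun_eq_iff)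
  qed (use J Tt P in auto)
  then have "(J has_real_derivative inverse (k (T t))) (at (G t))"
    by (simp add: has_field_derivative_def T(2)[OF t])
  from DERIV_chain2[OF this G]
  have "((\<lambda>s. J (G s)) has_real_derivative g / k (T t)) (at t)"
    by (simp add: divide_inverse mult.commute)
  then show ?thesis
  proof (rule has_field_derivative_transform_within_open[of _ _ _ I])
    show "J (G s) = T s" if "s \<in> I" for s using J[OF T(1)[OF that]] T(2)[OF that] by simp
  qed (use I t in auto)
qed

text \<open>Elimination of the exponentials makes the relation between consecutive crossing times polynomial.\<close>

lemma transition_deriv:
  assumes I: "I = {l<..<h}" and P: "P = {p<..<q}" and v: "\<And>x. x \<in> P \<Longrightarrow> c * \<kappa>' + \<mu> * sin x \<noteq> 0"
    and T': "\<And>t. t \<in> I \<Longrightarrow> T' t \<in> P"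
    and eq: "\<And>t. t \<in> I \<Longrightarrow> first_integral c \<kappa>' \<mu> (T' t) = first_integral c \<kappa> \<mu> (T t)"
    and t: "t \<in> I" and T: "(T has_real_derivative D) (at t)"
  shows "\<exists>D'. (T' has_real_derivative D') (at t) \<and>
    amp c \<kappa> \<mu> (T t) * (c * \<kappa>' + \<mu> * sin (T' t)) * D' = amp c \<kappa>' \<mu> (T' t) * (c * \<kappa> + \<mu> * sin (T t)) * D"
proof -
  define v v' A A' E E' where "v = c * \<kappa> + \<mu> * sin (T t)" and "v' = c * \<kappa>' + \<mu> * sin (T' t)"
    and "A = amp c \<kappa> \<mu> (T t)" and "A' = amp c \<kappa>' \<mu> (T' t)"
    and "E = exp (- c * T t)" and "E' = exp (- c * T' t)"
  note defs = this
  have nz: "v' \<noteq> 0" "E \<noteq> 0" "E' \<noteq> 0" using v[OF T'[OF t]] by (auto simp: defs)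
  \<comment> \<open>The exponentials enter the derivative of \<open>T'\<close> only through
    \<open>E / E'\<close>. Multiplying by \<open>A\<close> rather than dividing by it allows the
    amplitude to vanish.\<close>
  have AE: "E' * A' = E * A" using eq[OF t] by (simp add: first_integral_def defs)
  have inj: "inj_on (first_integral c \<kappa>' \<mu>) P"
    unfolding P by (rule first_integral_inj) (use v P in auto)
  have "(T' has_real_derivative (- E * v * D) / (- E' * v')) (at t)"
    unfolding defs
  proof (rule implicit_deriv[OF I P inj first_integral_deriv _ T' eq t])
    show "((\<lambda>s. first_integral c \<kappa> \<mu> (T s)) has_real_derivative
        - exp (- c * T t) * (c * \<kappa> + \<mu> * sin (T t)) * D) (at t)"
      by (rule DERIV_chain2[OF first_integral_deriv T])
  qed (use v in auto)
  moreover have "A * v' * ((- E * v * D) / (- E' * v')) = A' * v * D"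
  proof -
    have "A * v' * ((- E * v * D) / (- E' * v')) = (E * A) * v * D / E'"
      using nz by (simp add: field_simps)
    also have "\<dots> = A' * v * D" unfolding AE[symmetric] using nz by simp
    finally show ?thesis .
  qed
  ultimately show ?thesis unfolding defs by blast
qed

section \<open>Half-angle coordinates of crossing times and the rings they generate\<close>

definition psin :: "real \<Rightarrow> real \<Rightarrow> real" where
  "psin \<gamma> y = sin \<gamma> * (1 - y\<^sup>2) + cos \<gamma> * (2 * y)"

definition pcos :: "real \<Rightarrow> real \<Rightarrow> real" where
  "pcos \<gamma> y = cos \<gamma> * (1 - y\<^sup>2) - sin \<gamma> * (2 * y)"

text \<open>\<open>psin\<close> and \<open>pcos\<close> are the numerators of \<open>sin T\<close>
  and \<open>cos T\<close> over \<open>1 + y\<^sup>2\<close>. The centre \<gamma> will be moved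
  along with the arcs, so that the tangent has no pole on them.\<close>

lemma half_angle:
  fixes T \<gamma> :: real
  assumes "\<bar>T - \<gamma>\<bar> < pi"
  defines "y \<equiv> tan ((T - \<gamma>) / 2)"
  shows "(1 + y\<^sup>2) * sin T = psin \<gamma> y" "(1 + y\<^sup>2) * cos T = pcos \<gamma> y"
    and "((\<lambda>T. tan ((T - \<gamma>) / 2)) has_real_derivative (1 + y\<^sup>2) / 2) (at T)"
proof -
  define s where "s = (T - \<gamma>) / 2"
  have y: "y = tan s" and T: "T = \<gamma> + 2 * s" by (simp_all add: y_def s_def field_simps)
  have c0: "cos s \<noteq> 0" using assms(1) cos_gt_zero_pi[of s] by (auto simp: s_def abs_less_iff)
  then have cy: "y * cos s = sin s" by (simp add: y tan_def)
  have one: "(1 + y\<^sup>2) * (cos s)\<^sup>2 = 1"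
    by (simp add: distrib_right power_mult_distrib[symmetric] cy sin_squared_eq)
  have sin2: "(1 + y\<^sup>2) * sin (2 * s) = 2 * y"
  proof -
    have "(1 + y\<^sup>2) * sin (2 * s) = 2 * y * ((1 + y\<^sup>2) * (cos s)\<^sup>2)"
      unfolding sin_double cy[symmetric] by (simp add: power2_eq_square algebra_simps)
    then show ?thesis by (simp add: one)
  qed
  have cos2: "(1 + y\<^sup>2) * cos (2 * s) = 1 - y\<^sup>2"
  proof -
    have "(1 + y\<^sup>2) * cos (2 * s) = (1 - y\<^sup>2) * ((1 + y\<^sup>2) * (cos s)\<^sup>2)"
      unfolding cos_double cy[symmetric] by (simp add: power2_eq_square algebra_simps)
    then show ?thesis by (simp add: one)
  qed
  have "(1 + y\<^sup>2) * sin T = sin \<gamma> * ((1 + y\<^sup>2) * cos (2 * s)) + cos \<gamma> * ((1 + y\<^sup>2) * sin (2 * s))"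
    unfolding T sin_add by (simp add: algebra_simps)
  then show "(1 + y\<^sup>2) * sin T = psin \<gamma> y" by (simp add: sin2 cos2 psin_def)
  have "(1 + y\<^sup>2) * cos T = cos \<gamma> * ((1 + y\<^sup>2) * cos (2 * s)) - sin \<gamma> * ((1 + y\<^sup>2) * sin (2 * s))"
    unfolding T cos_add by (simp add: algebra_simps)
  then show "(1 + y\<^sup>2) * cos T = pcos \<gamma> y" by (simp add: sin2 cos2 pcos_def)
  have inv: "inverse ((cos s)\<^sup>2) = 1 + y\<^sup>2" using one c0 by (simp add: field_simps)
  have "((\<lambda>T. tan ((T - \<gamma>) / 2)) has_real_derivative inverse ((cos s)\<^sup>2) * (1 / 2)) (at T)"
    unfolding s_def
    by (rule DERIV_chain2[OF DERIV_tan]) (use c0 in \<open>auto simp: s_def intro!: derivative_eq_intros\<close>)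
  then show "((\<lambda>T. tan ((T - \<gamma>) / 2)) has_real_derivative (1 + y\<^sup>2) / 2) (at T)"
    by (simp add: inv)
qed

definition half_tan :: "real \<Rightarrow> ('p \<Rightarrow> real \<Rightarrow> real) \<Rightarrow> 'p \<Rightarrow> real \<Rightarrow> real" where
  "half_tan \<gamma> T = (\<lambda>\<theta> t. tan ((T \<theta> t - \<gamma>) / 2))"

context family
begin

text \<open>The state of the chain after the crossing time \<open>T\<close>. Injectivity of
  \<open>T\<close> in the starting time is carried along because it bounds the zeros of the next
  clearing factor.\<close>

definition clock :: "('p \<Rightarrow> real set) \<Rightarrow> real \<Rightarrow> ('p \<Rightarrow> real \<Rightarrow> real) set \<Rightarrow> ('p \<Rightarrow> real \<Rightarrow> real) \<Rightarrow> bool" where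
  "clock P \<gamma> R T \<longleftrightarrow> (\<exists>e. tame_ring e R) \<and> half_tan \<gamma> T \<in> R \<and>
     (\<forall>\<theta>\<in>\<Theta>. inj_on (T \<theta>) (dom \<theta>) \<and>
       (\<forall>t\<in>dom \<theta>. T \<theta> t \<in> P \<theta> \<and> \<bar>T \<theta> t - \<gamma>\<bar> < pi \<and> (\<exists>D. (T \<theta> has_real_derivative D) (at t))))"

lemma clock_initial:
  assumes "\<And>\<theta> t. \<theta> \<in> \<Theta> \<Longrightarrow> t \<in> dom \<theta> \<Longrightarrow> t \<in> P \<theta> \<and> \<bar>t - \<gamma>\<bar> < pi"
  shows "clock P \<gamma> (adjoin constants (half_tan \<gamma> (\<lambda>\<theta> t. t))) (\<lambda>\<theta> t. t)"
proof -
  let ?y = "half_tan \<gamma> (\<lambda>\<theta> t. t) :: 'p \<Rightarrow> real \<Rightarrow> real"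
  have sR: "subring constants" using tame_ring_constants by (simp add: tame_ring_def)
  note sA = subring_adjoin[OF sR, of ?y] and y = gen_in_adjoin[OF sR, of ?y]
  have "tame_ring (\<lambda>\<theta> t. 1 * 1) (adjoin constants ?y)"
  proof (rule tame_ring_adjoin[OF tame_ring_constants])
    show "(\<lambda>\<theta> t. 1) \<in> adjoin constants ?y" by (rule subring_const[OF sA])
    show "few_zeros (\<lambda>\<theta> t. 1)" by (simp add: few_zeros_def)
    show "(\<lambda>\<theta> t. (1 + ?y \<theta> t ^ 2) * (1 / 2)) \<in> adjoin constants ?y"
      by (intro subring_intros sA y)
    show "has_der (\<lambda>\<theta> t. 1 * 1) ?y (\<lambda>\<theta> t. (1 + ?y \<theta> t ^ 2) * (1 / 2))"
      unfolding has_der_def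
    proof (intro ballI)
      fix \<theta> t assume *: "\<theta> \<in> \<Theta>" "t \<in> dom \<theta>"
      show "\<exists>D. (?y \<theta> has_real_derivative D) (at t) \<and> 1 * 1 * D = (1 + ?y \<theta> t ^ 2) * (1 / 2)"
        using half_angle(3)[of t \<gamma>] assms[OF *] by (auto simp: half_tan_def)
    qed
  qed
  then show ?thesis unfolding clock_def using y assms by (auto intro!: DERIV_ident)
qed

lemma clock_transition:
  assumes C: "clock P \<gamma> R T"
    and P: "\<And>\<theta>. P \<theta> = {p \<theta><..<q \<theta>}" and P': "\<And>\<theta>. P' \<theta> = {p' \<theta><..<q' \<theta>}"
    and v: "\<And>\<theta> x. \<theta> \<in> \<Theta> \<Longrightarrow> x \<in> P \<theta> \<Longrightarrow> c \<theta> * \<kappa> \<theta> + \<mu> \<theta> * sin x \<noteq> 0"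
    and v': "\<And>\<theta> x. \<theta> \<in> \<Theta> \<Longrightarrow> x \<in> P' \<theta> \<Longrightarrow> c \<theta> * \<kappa>' \<theta> + \<mu> \<theta> * sin x \<noteq> 0"
    and T': "\<And>\<theta> t. \<theta> \<in> \<Theta> \<Longrightarrow> t \<in> dom \<theta> \<Longrightarrow> T' \<theta> t \<in> P' \<theta> \<and> \<bar>T' \<theta> t - \<gamma>'\<bar> < pi"
    and eq: "\<And>\<theta> t. \<theta> \<in> \<Theta> \<Longrightarrow> t \<in> dom \<theta> \<Longrightarrow>
      first_integral (c \<theta>) (\<kappa>' \<theta>) (\<mu> \<theta>) (T' \<theta> t) = first_integral (c \<theta>) (\<kappa> \<theta>) (\<mu> \<theta>) (T \<theta> t)"
  shows "clock P' \<gamma>' (adjoin R (half_tan \<gamma>' T')) T'"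
proof -
  from C obtain e where e: "tame_ring e R" and yR: "half_tan \<gamma> T \<in> R"
    and inj: "\<And>\<theta>. \<theta> \<in> \<Theta> \<Longrightarrow> inj_on (T \<theta>) (dom \<theta>)"
    and T: "\<And>\<theta> t. \<theta> \<in> \<Theta> \<Longrightarrow> t \<in> dom \<theta> \<Longrightarrow> T \<theta> t \<in> P \<theta> \<and> \<bar>T \<theta> t - \<gamma>\<bar> < pi \<and> (\<exists>D. (T \<theta> has_real_derivative D) (at t))"
    unfolding clock_def by blast
  define y where "y = half_tan \<gamma> T"
  define y' where "y' = half_tan \<gamma>' T'"
  have sR: "subring R" using e by (simp add: tame_ring_def)
  note sA = subring_adjoin[OF sR, of y'] and y'A = gen_in_adjoin[OF sR, of y']
  have yA: "y \<in> adjoin R y'" unfolding y_def by (rule base_in_adjoin[OF sR yR])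
  from e yR obtain g where g: "g \<in> R" "has_der e y g" unfolding tame_ring_def y_def by blast
  have gA: "g \<in> adjoin R y'" by (rule base_in_adjoin[OF sR g(1)])
  have inj': "inj_on (first_integral (c \<theta>) (\<kappa> \<theta>) (\<mu> \<theta>)) (P \<theta>)" if "\<theta> \<in> \<Theta>" for \<theta>
    unfolding P by (rule first_integral_inj) (use v[OF that] P in auto)
  have trans: "\<exists>D'. (T' \<theta> has_real_derivative D') (at t) \<and>
      amp (c \<theta>) (\<kappa> \<theta>) (\<mu> \<theta>) (T \<theta> t) * (c \<theta> * \<kappa>' \<theta> + \<mu> \<theta> * sin (T' \<theta> t)) * D' =
      amp (c \<theta>) (\<kappa>' \<theta>) (\<mu> \<theta>) (T' \<theta> t) * (c \<theta> * \<kappa> \<theta> + \<mu> \<theta> * sin (T \<theta> t)) * D"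
    if \<theta>: "\<theta> \<in> \<Theta>" "t \<in> dom \<theta>" and D: "(T \<theta> has_real_derivative D) (at t)" for \<theta> t D
    by (rule transition_deriv[OF dom_def P'[of \<theta>] _ _ _ \<theta>(2) D]) (use \<theta>(1) v' T' eq in auto)
  \<comment> \<open>The suffix \<open>h\<close> marks an amplitude or a speed multiplied by one plus
    the square of its half-angle tangent, which makes it polynomial in that tangent.\<close>
  define Ah where "Ah = (\<lambda>\<theta> t. \<kappa> \<theta> * (1 + y \<theta> t ^ 2) +
    \<mu> \<theta> / (1 + (c \<theta>)\<^sup>2) * (c \<theta> * psin \<gamma> (y \<theta> t) + pcos \<gamma> (y \<theta> t)))"
  define Ah' where "Ah' = (\<lambda>\<theta> t. \<kappa>' \<theta> * (1 + y' \<theta> t ^ 2) +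
    \<mu> \<theta> / (1 + (c \<theta>)\<^sup>2) * (c \<theta> * psin \<gamma>' (y' \<theta> t) + pcos \<gamma>' (y' \<theta> t)))"
  define vh where "vh = (\<lambda>\<theta> t. c \<theta> * \<kappa> \<theta> * (1 + y \<theta> t ^ 2) + \<mu> \<theta> * psin \<gamma> (y \<theta> t))"
  define vh' where "vh' = (\<lambda>\<theta> t. c \<theta> * \<kappa>' \<theta> * (1 + y' \<theta> t ^ 2) + \<mu> \<theta> * psin \<gamma>' (y' \<theta> t))"
  have Ah: "Ah \<theta> t = amp (c \<theta>) (\<kappa> \<theta>) (\<mu> \<theta>) (T \<theta> t) * (1 + (y \<theta> t)\<^sup>2)"
    and vh: "vh \<theta> t = (c \<theta> * \<kappa> \<theta> + \<mu> \<theta> * sin (T \<theta> t)) * (1 + (y \<theta> t)\<^sup>2)"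
    and Ah': "Ah' \<theta> t = amp (c \<theta>) (\<kappa>' \<theta>) (\<mu> \<theta>) (T' \<theta> t) * (1 + (y' \<theta> t)\<^sup>2)"
    and vh': "vh' \<theta> t = (c \<theta> * \<kappa>' \<theta> + \<mu> \<theta> * sin (T' \<theta> t)) * (1 + (y' \<theta> t)\<^sup>2)"
    if \<theta>: "\<theta> \<in> \<Theta>" "t \<in> dom \<theta>" for \<theta> t
  proof -
    have "psin \<gamma> (y \<theta> t) = (1 + (y \<theta> t)\<^sup>2) * sin (T \<theta> t)" "pcos \<gamma> (y \<theta> t) = (1 + (y \<theta> t)\<^sup>2) * cos (T \<theta> t)"
      using half_angle(1,2)[of "T \<theta> t" \<gamma>] T[OF \<theta>] by (simp_all add: y_def half_tan_def)
    then show "Ah \<theta> t = amp (c \<theta>) (\<kappa> \<theta>) (\<mu> \<theta>) (T \<theta> t) * (1 + (y \<theta> t)\<^sup>2)"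
      and "vh \<theta> t = (c \<theta> * \<kappa> \<theta> + \<mu> \<theta> * sin (T \<theta> t)) * (1 + (y \<theta> t)\<^sup>2)"
      unfolding Ah_def vh_def amp_def by (simp_all add: distrib_right mult_ac distrib_left add_divide_distrib)
    have "psin \<gamma>' (y' \<theta> t) = (1 + (y' \<theta> t)\<^sup>2) * sin (T' \<theta> t)" "pcos \<gamma>' (y' \<theta> t) = (1 + (y' \<theta> t)\<^sup>2) * cos (T' \<theta> t)"
      using half_angle(1,2)[of "T' \<theta> t" \<gamma>'] T'[OF \<theta>] by (simp_all add: y'_def half_tan_def)
    then show "Ah' \<theta> t = amp (c \<theta>) (\<kappa>' \<theta>) (\<mu> \<theta>) (T' \<theta> t) * (1 + (y' \<theta> t)\<^sup>2)"
      and "vh' \<theta> t = (c \<theta> * \<kappa>' \<theta> + \<mu> \<theta> * sin (T' \<theta> t)) * (1 + (y' \<theta> t)\<^sup>2)"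
      unfolding Ah'_def vh'_def amp_def by (simp_all add: distrib_right mult_ac distrib_left add_divide_distrib)
  qed
  note sq = one_plus_square_neq_zero
  \<comment> \<open>The extra factor \<open>1 + y ^ 2\<close> evens out the weights:
    \<open>p\<close> and the product of \<open>d * e\<close> with the derivative of
    \<open>y'\<close> both carry \<open>1 + y ^ 2\<close> and \<open>1 + y' ^ 2\<close> squared, so
    the transition identity can be substituted.\<close>
  define d where "d = (\<lambda>\<theta> t. Ah \<theta> t * (1 + y \<theta> t ^ 2) * vh' \<theta> t)"
  have "d \<in> adjoin R y'"
    unfolding d_def Ah_def vh'_def psin_def pcos_def by (intro subring_intros sA yA y'A)
  \<comment> \<open>The speed on the target arc has no zero, so \<open>d\<close> vanishes only with
    the amplitude, that is, where the first integral is 0. As this integral is injective on the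
    source arc and \<open>T\<close> is injective, there is at most one such time.\<close>
  moreover have "few_zeros d"
    unfolding few_zeros_def
  proof (intro exI[of _ 1] ballI)
    fix \<theta> assume \<theta>: "\<theta> \<in> \<Theta>"
    have fi: "first_integral (c \<theta>) (\<kappa> \<theta>) (\<mu> \<theta>) (T \<theta> t) = 0" if "t \<in> dom \<theta>" "d \<theta> t = 0" for t
      using that v'[OF \<theta>] T'[OF \<theta>] sq by (auto simp: d_def Ah[OF \<theta>] vh'[OF \<theta>] first_integral_def)
    have "x = z" if "x \<in> {t \<in> dom \<theta>. d \<theta> t = 0}" "z \<in> {t \<in> dom \<theta>. d \<theta> t = 0}" for x z
    proof -
      have "T \<theta> x = T \<theta> z" using inj_onD[OF inj'[OF \<theta>], of "T \<theta> x" "T \<theta> z"] fi that T[OF \<theta>] by auto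
      then show ?thesis using inj_onD[OF inj[OF \<theta>]] that by auto
    qed
    then have "\<exists>z. {t \<in> dom \<theta>. d \<theta> t = 0} \<subseteq> {z}" by blast
    then obtain z where z: "{t \<in> dom \<theta>. d \<theta> t = 0} \<subseteq> {z}" by blast
    show "finite {t \<in> dom \<theta>. d \<theta> t = 0} \<and> card {t \<in> dom \<theta>. d \<theta> t = 0} \<le> 1"
      using finite_subset[OF z] card_mono[OF _ z] by simp
  qed
  moreover define p where "p = (\<lambda>\<theta> t. Ah' \<theta> t * (1 + y' \<theta> t ^ 2) * vh \<theta> t * g \<theta> t)"
  have "p \<in> adjoin R y'"
    unfolding p_def Ah'_def vh_def psin_def pcos_def by (intro subring_intros sA yA y'A gA)
  moreover have "has_der (\<lambda>\<theta> t. d \<theta> t * e \<theta> t) y' p"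
    unfolding has_der_def
  proof (intro ballI)
    fix \<theta> t assume \<theta>: "\<theta> \<in> \<Theta>" "t \<in> dom \<theta>"
    from T[OF \<theta>] obtain D where D: "(T \<theta> has_real_derivative D) (at t)" by blast
    from trans[OF \<theta> D] obtain D' where D': "(T' \<theta> has_real_derivative D') (at t)"
      "amp (c \<theta>) (\<kappa> \<theta>) (\<mu> \<theta>) (T \<theta> t) * (c \<theta> * \<kappa>' \<theta> + \<mu> \<theta> * sin (T' \<theta> t)) * D' =
      amp (c \<theta>) (\<kappa>' \<theta>) (\<mu> \<theta>) (T' \<theta> t) * (c \<theta> * \<kappa> \<theta> + \<mu> \<theta> * sin (T \<theta> t)) * D" by blast
    define Y Y' where "Y = 1 + (y \<theta> t)\<^sup>2" and "Y' = 1 + (y' \<theta> t)\<^sup>2"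
    have dy: "(y \<theta> has_real_derivative Y / 2 * D) (at t)"
      using DERIV_chain2[OF half_angle(3) D] T[OF \<theta>] by (simp add: y_def half_tan_def Y_def)
    have dy': "(y' \<theta> has_real_derivative Y' / 2 * D') (at t)"
      using DERIV_chain2[OF half_angle(3) D'(1)] T'[OF \<theta>] by (simp add: y'_def half_tan_def Y'_def)
    from g(2) \<theta> obtain D0 where "(y \<theta> has_real_derivative D0) (at t)" "e \<theta> t * D0 = g \<theta> t"
      unfolding has_der_def by blast
    then have ge: "g \<theta> t = e \<theta> t * (Y / 2 * D)" using DERIV_unique[OF dy] by simp
    have "d \<theta> t * e \<theta> t * (Y' / 2 * D') = (Y * Y * (Y' * Y') / 2 * e \<theta> t) *
        (amp (c \<theta>) (\<kappa> \<theta>) (\<mu> \<theta>) (T \<theta> t) * (c \<theta> * \<kappa>' \<theta> + \<mu> \<theta> * sin (T' \<theta> t)) * D')"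
      unfolding d_def Ah[OF \<theta>] vh'[OF \<theta>] Y_def[symmetric] Y'_def[symmetric] by simp
    also have "\<dots> = p \<theta> t"
      unfolding D'(2) p_def Ah'[OF \<theta>] vh[OF \<theta>] Y_def[symmetric] Y'_def[symmetric] ge by simp
    finally show "\<exists>D. (y' \<theta> has_real_derivative D) (at t) \<and> d \<theta> t * e \<theta> t * D = p \<theta> t"
      using dy' by blast
  qed
  ultimately have "tame_ring (\<lambda>\<theta> t. d \<theta> t * e \<theta> t) (adjoin R y')"
    by (intro tame_ring_adjoin[OF e])
  moreover have "inj_on (T' \<theta>) (dom \<theta>)" if \<theta>: "\<theta> \<in> \<Theta>" for \<theta>
  proof (rule inj_onI)
    fix x z assume xz: "x \<in> dom \<theta>" "z \<in> dom \<theta>" "T' \<theta> x = T' \<theta> z"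
    then have "first_integral (c \<theta>) (\<kappa> \<theta>) (\<mu> \<theta>) (T \<theta> x) = first_integral (c \<theta>) (\<kappa> \<theta>) (\<mu> \<theta>) (T \<theta> z)"
      using eq[OF \<theta>] by metis
    then have "T \<theta> x = T \<theta> z" using inj_onD[OF inj'[OF \<theta>]] T[OF \<theta>] xz by blast
    then show "x = z" using inj_onD[OF inj[OF \<theta>]] xz by blast
  qed
  moreover have "\<exists>D. (T' \<theta> has_real_derivative D) (at t)" if "\<theta> \<in> \<Theta>" "t \<in> dom \<theta>" for \<theta> t
    using T[OF that] trans[OF that] by blast
  ultimately show ?thesis
    unfolding clock_def y'_def[symmetric] using y'A T' by blast
qed

lemma clock_subring: "clock P \<gamma> R T \<Longrightarrow> subring R"
  by (auto simp: clock_def tame_ring_def)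

lemma clock_tame: "clock P \<gamma> R T \<Longrightarrow> f \<in> R \<Longrightarrow> tame f"
  by (auto simp: clock_def tame_ring_def)

lemma clock_half_tan: "clock P \<gamma> R T \<Longrightarrow> half_tan \<gamma> T \<in> R"
  by (auto simp: clock_def)

end

section \<open>Solutions crossing both lines\<close>

lemma sin_greater_on_arc:
  assumes "\<bar>\<alpha>\<bar> < pi / 2" "\<alpha> < x" "x < pi - \<alpha>"
  shows "sin \<alpha> < sin x"
proof -
  have "sin x - sin \<alpha> = 2 * sin ((x - \<alpha>) / 2) * cos ((x + \<alpha>) / 2)" by (rule sin_diff_sin)
  moreover have "sin ((x - \<alpha>) / 2) > 0" using assms by (intro sin_gt_zero) (auto simp: abs_less_iff)
  moreover have "cos ((x + \<alpha>) / 2) > 0" using assms by (intro cos_gt_zero_pi) (auto simp: abs_less_iff)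
  ultimately show ?thesis by (smt (verit) mult_pos_pos)
qed

lemma sin_less_on_arc:
  assumes "\<bar>\<alpha>\<bar> < pi / 2" "pi - \<alpha> < x" "x < 2 * pi + \<alpha>"
  shows "sin x < sin \<alpha>"
proof -
  have "sin (- \<alpha>) < sin (x - pi)" by (rule sin_greater_on_arc) (use assms in auto)
  then show ?thesis by simp
qed

text \<open>\<open>S 0\<close>, \<open>S 1\<close>, \<open>S 2\<close>, \<open>S 3\<close>, \<open>S 4\<close> are the consecutive crossing times of the lines
  \<open>-1\<close>, \<open>1\<close>, \<open>1\<close>, \<open>-1\<close>, \<open>-1\<close>, where \<open>b + \<mu> sin \<alpha> = 0\<close>. A line can only be crossed upwards on one
  arc of the time circle and only downwards on the complementary arc.\<close>

definition itinerary :: "real \<Rightarrow> real \<Rightarrow> real \<Rightarrow> real \<Rightarrow> (nat \<Rightarrow> real) \<Rightarrow> bool" where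
  "itinerary a b \<mu> \<alpha> S \<longleftrightarrow>
     S 0 \<in> {- \<alpha><..<pi + \<alpha>} \<and> S 1 \<in> {\<alpha><..<pi - \<alpha>} \<and> S 2 \<in> {pi - \<alpha><..<2 * pi + \<alpha>} \<and>
     S 3 \<in> {pi + \<alpha><..<2 * pi - \<alpha>} \<and> S 4 \<in> {2 * pi - \<alpha><..<3 * pi + \<alpha>} \<and>
     first_integral b 1 \<mu> (S 1) = first_integral b (-1) \<mu> (S 0) \<and>
     first_integral a (b / a) \<mu> (S 2) = first_integral a (b / a) \<mu> (S 1) \<and>
     first_integral b (-1) \<mu> (S 3) = first_integral b 1 \<mu> (S 2) \<and>
     first_integral a (- (b / a)) \<mu> (S 4) = first_integral a (- (b / a)) \<mu> (S 3)"

text \<open>The two tangents are centred at \<open>5 * pi / 2\<close> and \<open>pi / 2\<close>, a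
  full period apart, so that on the arcs their difference vanishes exactly when the solution returns
  after \<open>2 * pi\<close>.\<close>

lemma return_time_tame:
  "\<exists>N. \<forall>a b \<mu> \<alpha> l h. \<forall>T :: nat \<Rightarrow> real \<Rightarrow> real.
     a \<noteq> 0 \<and> \<mu> > 0 \<and> \<bar>\<alpha>\<bar> < pi / 2 \<and> b = - \<mu> * sin \<alpha> \<and>
     (\<forall>\<tau>\<in>{l<..<h}. T 0 \<tau> = \<tau> \<and> itinerary a b \<mu> \<alpha> (\<lambda>i. T i \<tau>)) \<longrightarrow>
     (\<exists>F. finite F \<and> card F \<le> N \<and>
       sgn_const_off {l<..<h} F (\<lambda>\<tau>. tan ((T 4 \<tau> - 5 * pi / 2) / 2) - tan ((\<tau> - pi / 2) / 2)))"
proof -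
  \<comment> \<open>A parameter packs six real numbers in its first component and the crossing-time
    functions in its second, so that one bound covers every choice of both.\<close>
  define a b \<mu> \<alpha> :: "(nat \<Rightarrow> real) \<times> (nat \<Rightarrow> real \<Rightarrow> real) \<Rightarrow> real"
    where "a \<theta> = fst \<theta> 0" and "b \<theta> = fst \<theta> 1" and "\<mu> \<theta> = fst \<theta> 2" and "\<alpha> \<theta> = fst \<theta> 3" for \<theta>
  define l h :: "(nat \<Rightarrow> real) \<times> (nat \<Rightarrow> real \<Rightarrow> real) \<Rightarrow> real"
    where "l \<theta> = fst \<theta> 4" and "h \<theta> = fst \<theta> 5" for \<theta>
  define T :: "nat \<Rightarrow> (nat \<Rightarrow> real) \<times> (nat \<Rightarrow> real \<Rightarrow> real) \<Rightarrow> real \<Rightarrow> real" where "T i \<theta> = snd \<theta> i" for i \<theta>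
  define \<Theta> where "\<Theta> = {\<theta>. a \<theta> \<noteq> 0 \<and> \<mu> \<theta> > 0 \<and> \<bar>\<alpha> \<theta>\<bar> < pi / 2 \<and> b \<theta> = - \<mu> \<theta> * sin (\<alpha> \<theta>) \<and>
     (\<forall>\<tau>\<in>{l \<theta><..<h \<theta>}. T 0 \<theta> \<tau> = \<tau> \<and> itinerary (a \<theta>) (b \<theta>) (\<mu> \<theta>) (\<alpha> \<theta>) (\<lambda>i. T i \<theta> \<tau>))}"
  interpret family \<Theta> l h .
  have \<Theta>: "a \<theta> \<noteq> 0" "\<mu> \<theta> > 0" "\<bar>\<alpha> \<theta>\<bar> < pi / 2" "b \<theta> = - \<mu> \<theta> * sin (\<alpha> \<theta>)" if "\<theta> \<in> \<Theta>" for \<theta>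
    using that by (auto simp: \<Theta>_def)
  have T0: "T 0 \<theta> \<tau> = \<tau>"
    and it: "itinerary (a \<theta>) (b \<theta>) (\<mu> \<theta>) (\<alpha> \<theta>) (\<lambda>i. T i \<theta> \<tau>)" if "\<theta> \<in> \<Theta>" "\<tau> \<in> dom \<theta>" for \<theta> \<tau>
    using that by (auto simp: \<Theta>_def dom_def)
  note it' = it[unfolded itinerary_def]
  define P where "P i \<theta> = [{- \<alpha> \<theta><..<pi + \<alpha> \<theta>}, {\<alpha> \<theta><..<pi - \<alpha> \<theta>}, {pi - \<alpha> \<theta><..<2 * pi + \<alpha> \<theta>},
     {pi + \<alpha> \<theta><..<2 * pi - \<alpha> \<theta>}, {2 * pi - \<alpha> \<theta><..<3 * pi + \<alpha> \<theta>}] ! i" for i \<theta>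
  have P: "P 0 \<theta> = {- \<alpha> \<theta><..<pi + \<alpha> \<theta>}" "P 1 \<theta> = {\<alpha> \<theta><..<pi - \<alpha> \<theta>}" "P 2 \<theta> = {pi - \<alpha> \<theta><..<2 * pi + \<alpha> \<theta>}"
    "P 3 \<theta> = {pi + \<alpha> \<theta><..<2 * pi - \<alpha> \<theta>}" "P 4 \<theta> = {2 * pi - \<alpha> \<theta><..<3 * pi + \<alpha> \<theta>}" for \<theta>
    by (simp_all add: P_def numeral_eq_Suc)
  have TP: "T i \<theta> \<tau> \<in> P i \<theta>" if "\<theta> \<in> \<Theta>" "\<tau> \<in> dom \<theta>" "i \<in> {0,1,2,3,4}" for i \<theta> \<tau>
    using it'[OF that(1,2)] that(3) by (auto simp: P P(2)[unfolded One_nat_def])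
  have sgn: "b \<theta> + \<mu> \<theta> * sin x \<noteq> 0" if \<theta>: "\<theta> \<in> \<Theta>" and x: "x \<in> P 1 \<theta> \<or> x \<in> P 2 \<theta>" for \<theta> x
  proof -
    have "sin x \<noteq> sin (\<alpha> \<theta>)"
      using x sin_greater_on_arc[OF \<Theta>(3)[OF \<theta>], of x] sin_less_on_arc[OF \<Theta>(3)[OF \<theta>], of x]
      unfolding P by auto
    moreover have "b \<theta> + \<mu> \<theta> * sin x = \<mu> \<theta> * (sin x - sin (\<alpha> \<theta>))"
      unfolding \<Theta>(4)[OF \<theta>] by (simp add: algebra_simps)
    ultimately show ?thesis using \<Theta>(2)[OF \<theta>] by simp
  qed
  have sgn': "- b \<theta> + \<mu> \<theta> * sin x \<noteq> 0" if \<theta>: "\<theta> \<in> \<Theta>" and x: "x \<in> P 0 \<theta> \<or> x \<in> P 3 \<theta> \<or> x \<in> P 4 \<theta>" for \<theta> x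
  proof -
    have \<alpha>: "\<bar>- \<alpha> \<theta>\<bar> < pi / 2" using \<Theta>(3)[OF \<theta>] by simp
    have "sin x \<noteq> sin (- \<alpha> \<theta>)"
      using x sin_greater_on_arc[OF \<alpha>, of x] sin_less_on_arc[OF \<alpha>, of x]
        sin_greater_on_arc[OF \<alpha>, of "x - 2 * pi"] unfolding P by (auto simp: sin_diff)
    moreover have "- b \<theta> + \<mu> \<theta> * sin x = \<mu> \<theta> * (sin x - sin (- \<alpha> \<theta>))"
      unfolding \<Theta>(4)[OF \<theta>] by (simp add: algebra_simps)
    ultimately show ?thesis using \<Theta>(2)[OF \<theta>] by simp
  qed
  \<comment> \<open>Since \<open>|\<alpha>| < pi / 2\<close>, each arc stays within distance
    \<open>pi\<close> of its centre.\<close>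
  have near: "\<bar>x - \<gamma>\<bar> < pi"
    if "\<theta> \<in> \<Theta>" "(x \<in> P 0 \<theta> \<or> x \<in> P 1 \<theta>) \<and> \<gamma> = pi / 2 \<or> (x \<in> P 2 \<theta> \<or> x \<in> P 3 \<theta>) \<and> \<gamma> = 3 * pi / 2 \<or>
      x \<in> P 4 \<theta> \<and> \<gamma> = 5 * pi / 2" for \<theta> x \<gamma>
    using that(2) \<Theta>(3)[OF that(1)] by (auto simp: P P(2)[unfolded One_nat_def] abs_less_iff)
  define R0 :: "((nat \<Rightarrow> real) \<times> (nat \<Rightarrow> real \<Rightarrow> real) \<Rightarrow> real \<Rightarrow> real) set"
    where "R0 = adjoin constants (half_tan (pi / 2) (\<lambda>\<theta> t. t))"
  define R1 where "R1 = adjoin R0 (half_tan (pi / 2) (T 1))"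
  define R2 where "R2 = adjoin R1 (half_tan (3 * pi / 2) (T 2))"
  define R3 where "R3 = adjoin R2 (half_tan (3 * pi / 2) (T 3))"
  define R4 where "R4 = adjoin R3 (half_tan (5 * pi / 2) (T 4))"
  have C0: "clock (P 0) (pi / 2) R0 (\<lambda>\<theta> t. t)" unfolding R0_def
  proof (rule clock_initial)
    fix \<theta> t assume \<theta>: "\<theta> \<in> \<Theta>" "t \<in> dom \<theta>"
    have "t \<in> P 0 \<theta>" using TP[OF \<theta>, of 0] T0[OF \<theta>] by simp
    then show "t \<in> P 0 \<theta> \<and> \<bar>t - pi / 2\<bar> < pi" using near[OF \<theta>(1)] by blast
  qed
  have C1: "clock (P 1) (pi / 2) R1 (T 1)" unfolding R1_def
  proof (rule clock_transition[OF C0 P(1) P(2), where c = b and \<mu> = \<mu> and \<kappa> = "\<lambda>_. -1" and \<kappa>' = "\<lambda>_. 1"])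
    show "b \<theta> * - 1 + \<mu> \<theta> * sin x \<noteq> 0" if "\<theta> \<in> \<Theta>" "x \<in> P 0 \<theta>" for \<theta> x
      using sgn'[OF that(1)] that(2) by simp
    show "b \<theta> * 1 + \<mu> \<theta> * sin x \<noteq> 0" if "\<theta> \<in> \<Theta>" "x \<in> P 1 \<theta>" for \<theta> x
      using sgn[OF that(1)] that(2) by simp
    show "T 1 \<theta> t \<in> P 1 \<theta> \<and> \<bar>T 1 \<theta> t - pi / 2\<bar> < pi" if "\<theta> \<in> \<Theta>" "t \<in> dom \<theta>" for \<theta> t
      using TP[OF that, of 1] near[OF that(1)] by blast
    show "first_integral (b \<theta>) 1 (\<mu> \<theta>) (T 1 \<theta> t) = first_integral (b \<theta>) (- 1) (\<mu> \<theta>) t"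
      if "\<theta> \<in> \<Theta>" "t \<in> dom \<theta>" for \<theta> t using it'[OF that] T0[OF that] by simp
  qed
  have C2: "clock (P 2) (3 * pi / 2) R2 (T 2)" unfolding R2_def
  \<comment> \<open>Above the strip the equation is
    \<open>x' = a * x + (b - a) + \<mu> * sin t\<close>, so the level 1 has
    \<open>\<kappa> = 1 + (b - a) / a = b / a\<close>. In the strip the constant term is 0 and
    \<kappa> is the level itself.\<close>
  proof (rule clock_transition[OF C1 P(2) P(3), where c = a and \<mu> = \<mu> and \<kappa> = "\<lambda>\<theta>. b \<theta> / a \<theta>" and \<kappa>' = "\<lambda>\<theta>. b \<theta> / a \<theta>"])
    show "a \<theta> * (b \<theta> / a \<theta>) + \<mu> \<theta> * sin x \<noteq> 0" if "\<theta> \<in> \<Theta>" "x \<in> P 1 \<theta>" for \<theta> x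
      using sgn[OF that(1)] that(2) \<Theta>(1)[OF that(1)] by simp
    show "a \<theta> * (b \<theta> / a \<theta>) + \<mu> \<theta> * sin x \<noteq> 0" if "\<theta> \<in> \<Theta>" "x \<in> P 2 \<theta>" for \<theta> x
      using sgn[OF that(1)] that(2) \<Theta>(1)[OF that(1)] by simp
    show "T 2 \<theta> t \<in> P 2 \<theta> \<and> \<bar>T 2 \<theta> t - 3 * pi / 2\<bar> < pi" if "\<theta> \<in> \<Theta>" "t \<in> dom \<theta>" for \<theta> t
      using TP[OF that, of 2] near[OF that(1)] by blast
    show "first_integral (a \<theta>) (b \<theta> / a \<theta>) (\<mu> \<theta>) (T 2 \<theta> t) = first_integral (a \<theta>) (b \<theta> / a \<theta>) (\<mu> \<theta>) (T 1 \<theta> t)"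
      if "\<theta> \<in> \<Theta>" "t \<in> dom \<theta>" for \<theta> t using it'[OF that] by simp
  qed
  have C3: "clock (P 3) (3 * pi / 2) R3 (T 3)" unfolding R3_def
  proof (rule clock_transition[OF C2 P(3) P(4), where c = b and \<mu> = \<mu> and \<kappa> = "\<lambda>_. 1" and \<kappa>' = "\<lambda>_. -1"])
    show "b \<theta> * 1 + \<mu> \<theta> * sin x \<noteq> 0" if "\<theta> \<in> \<Theta>" "x \<in> P 2 \<theta>" for \<theta> x
      using sgn[OF that(1)] that(2) by simp
    show "b \<theta> * - 1 + \<mu> \<theta> * sin x \<noteq> 0" if "\<theta> \<in> \<Theta>" "x \<in> P 3 \<theta>" for \<theta> x
      using sgn'[OF that(1)] that(2) by simp
    show "T 3 \<theta> t \<in> P 3 \<theta> \<and> \<bar>T 3 \<theta> t - 3 * pi / 2\<bar> < pi" if "\<theta> \<in> \<Theta>" "t \<in> dom \<theta>" for \<theta> t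
      using TP[OF that, of 3] near[OF that(1)] by blast
    show "first_integral (b \<theta>) (- 1) (\<mu> \<theta>) (T 3 \<theta> t) = first_integral (b \<theta>) 1 (\<mu> \<theta>) (T 2 \<theta> t)"
      if "\<theta> \<in> \<Theta>" "t \<in> dom \<theta>" for \<theta> t using it'[OF that] by simp
  qed
  have C4: "clock (P 4) (5 * pi / 2) R4 (T 4)" unfolding R4_def
  proof (rule clock_transition[OF C3 P(4) P(5), where c = a and \<mu> = \<mu> and \<kappa> = "\<lambda>\<theta>. - (b \<theta> / a \<theta>)" and \<kappa>' = "\<lambda>\<theta>. - (b \<theta> / a \<theta>)"])
    show "a \<theta> * - (b \<theta> / a \<theta>) + \<mu> \<theta> * sin x \<noteq> 0" if "\<theta> \<in> \<Theta>" "x \<in> P 3 \<theta>" for \<theta> x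
      using sgn'[OF that(1)] that(2) \<Theta>(1)[OF that(1)] by simp
    show "a \<theta> * - (b \<theta> / a \<theta>) + \<mu> \<theta> * sin x \<noteq> 0" if "\<theta> \<in> \<Theta>" "x \<in> P 4 \<theta>" for \<theta> x
      using sgn'[OF that(1)] that(2) \<Theta>(1)[OF that(1)] by simp
    show "T 4 \<theta> t \<in> P 4 \<theta> \<and> \<bar>T 4 \<theta> t - 5 * pi / 2\<bar> < pi" if "\<theta> \<in> \<Theta>" "t \<in> dom \<theta>" for \<theta> t
      using TP[OF that, of 4] near[OF that(1)] by blast
    show "first_integral (a \<theta>) (- (b \<theta> / a \<theta>)) (\<mu> \<theta>) (T 4 \<theta> t) = first_integral (a \<theta>) (- (b \<theta> / a \<theta>)) (\<mu> \<theta>) (T 3 \<theta> t)"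
      if "\<theta> \<in> \<Theta>" "t \<in> dom \<theta>" for \<theta> t using it'[OF that] by simp
  qed
  have "half_tan (pi / 2) (\<lambda>\<theta> t. t) \<in> R4"
    unfolding R4_def R3_def R2_def R1_def
    by (intro base_in_adjoin clock_half_tan[OF C0] clock_subring[OF C0] clock_subring[OF C1, unfolded R1_def]
        clock_subring[OF C2, unfolded R2_def R1_def] clock_subring[OF C3, unfolded R3_def R2_def R1_def])
  then have "(\<lambda>\<theta> t. half_tan (5 * pi / 2) (T 4) \<theta> t - half_tan (pi / 2) (\<lambda>\<theta> t. t) \<theta> t) \<in> R4"
    by (intro subring_diff clock_subring[OF C4] clock_half_tan[OF C4])
  then have "tame (\<lambda>\<theta> t. half_tan (5 * pi / 2) (T 4) \<theta> t - half_tan (pi / 2) (\<lambda>\<theta> t. t) \<theta> t)"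
    by (rule clock_tame[OF C4])
  then obtain N where N: "\<And>\<theta>. \<theta> \<in> \<Theta> \<Longrightarrow> \<exists>F. finite F \<and> card F \<le> N \<and>
      sgn_const_off (dom \<theta>) F (\<lambda>t. tan ((T 4 \<theta> t - 5 * pi / 2) / 2) - tan ((t - pi / 2) / 2))"
    unfolding tame_def half_tan_def by blast
  show ?thesis
  proof (intro exI[of _ N] allI impI)
    fix a' b' \<mu>' \<alpha>' l' h' and T' :: "nat \<Rightarrow> real \<Rightarrow> real"
    assume *: "a' \<noteq> 0 \<and> \<mu>' > 0 \<and> \<bar>\<alpha>'\<bar> < pi / 2 \<and> b' = - \<mu>' * sin \<alpha>' \<and>
      (\<forall>\<tau>\<in>{l'<..<h'}. T' 0 \<tau> = \<tau> \<and> itinerary a' b' \<mu>' \<alpha>' (\<lambda>i. T' i \<tau>))"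
    define \<theta> where "\<theta> = ((\<lambda>i. [a', b', \<mu>', \<alpha>', l', h'] ! i), T')"
    have \<theta>: "a \<theta> = a'" "b \<theta> = b'" "\<mu> \<theta> = \<mu>'" "\<alpha> \<theta> = \<alpha>'" "l \<theta> = l'" "h \<theta> = h'" "T i \<theta> = T' i" for i
      by (simp_all add: \<theta>_def a_def b_def \<mu>_def \<alpha>_def l_def h_def T_def numeral_eq_Suc)
    have "\<theta> \<in> \<Theta>" unfolding \<Theta>_def mem_Collect_eq \<theta> by (rule *)
    from N[OF this] show "\<exists>F. finite F \<and> card F \<le> N \<and>
       sgn_const_off {l'<..<h'} F (\<lambda>\<tau>. tan ((T' 4 \<tau> - 5 * pi / 2) / 2) - tan ((\<tau> - pi / 2) / 2))"
      by (simp add: dom_def \<theta>)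
  qed
qed

section \<open>Barriers and single crossings of a horizontal line\<close>

lemma cross_up:
  assumes v: "solution a b \<mu> v" and pq: "v p < k" "k < v q" "p < q"
    and up: "\<And>t. p < t \<Longrightarrow> t < q \<Longrightarrow> pwl a b k + \<mu> * sin t > 0"
  obtains t where "t \<in> {p<..<q}" "v t = k" "\<And>s. s \<in> {p..<t} \<Longrightarrow> v s < k" "\<And>s. s \<in> {t<..q} \<Longrightarrow> v s > k"
proof -
  \<comment> \<open>Once at or above \<open>k\<close> inside the arc, a solution is strictly above
    it afterwards; with the intermediate value theorem this gives existence and uniqueness of the
    crossing. The rate may vanish at \<open>p\<close> and \<open>q\<close>, hence the open
    interval.\<close>
  have after: "v s > k" if "p < r" "r < s" "s < q" "v r \<ge> k" for r s
  proof -
    have "v s - k > 0"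
    proof (rule first_crossing_up[OF that(2), of "\<lambda>t. v t - k" "\<lambda>t. pwl a b (v t) + \<mu> * sin t"])
      show "((\<lambda>t. v t - k) has_real_derivative pwl a b (v t) + \<mu> * sin t) (at t)" for t
        using DERIV_diff[OF solution_deriv[OF v] DERIV_const[of k]] by simp
    qed (use that up in auto)
    then show ?thesis by simp
  qed
  obtain t where t: "p \<le> t" "t \<le> q" "v t = k"
    using IVT'[of v p k q, OF _ _ _ solution_continuous[OF v]] pq by auto
  have t': "t \<in> {p<..<q}" using t pq by (auto simp: less_le)
  show ?thesis
  proof (rule that[OF t' t(3)])
    show "v s < k" if "s \<in> {p..<t}" for s
      using after[of s t] that t t' pq by (cases "s = p") force+
    show "v s > k" if "s \<in> {t<..q}" for s
      using after[of t s] that t t' pq by (cases "s = q") force+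
  qed
qed

lemma cross_down:
  assumes v: "solution a b \<mu> v" and pq: "v p > k" "k > v q" "p < q"
    and down: "\<And>t. p < t \<Longrightarrow> t < q \<Longrightarrow> pwl a b k + \<mu> * sin t < 0"
  obtains t where "t \<in> {p<..<q}" "v t = k" "\<And>s. s \<in> {p..<t} \<Longrightarrow> v s > k" "\<And>s. s \<in> {t<..q} \<Longrightarrow> v s < k"
proof -
  obtain t where "t \<in> {p<..<q}" "- v t = - k" "\<And>s. s \<in> {p..<t} \<Longrightarrow> - v s < - k" "\<And>s. s \<in> {t<..q} \<Longrightarrow> - v s > - k"
  proof (rule cross_up[OF solution_minus[OF v], of p "- k" q])
    show "pwl a b (- k) + - \<mu> * sin t > 0" if "p < t" "t < q" for t
      using down[OF that] by (simp add: pwl_minus)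
  qed (use pq in auto)
  then show ?thesis by (intro that[of t]) auto
qed

text \<open>Covers the ends of an arc, where the rate on the line is 0 and the strict argument
  fails. Below \<open>k\<close> the Lipschitz bound limits the downward speed by a multiple of the
  depth.\<close>

lemma stays_above:
  assumes v: "solution a b \<mu> v" and st: "s \<le> t" "v s \<ge> k"
    and up: "\<And>r. r \<in> {s..t} \<Longrightarrow> pwl a b k + \<mu> * sin r \<ge> 0"
  shows "v t \<ge> k"
proof -
  have "v t - k \<ge> 0"
  proof (rule stays_nonneg[OF st(1), of "\<lambda>t. v t - k" "\<lambda>t. pwl a b (v t) + \<mu> * sin t" "\<bar>a\<bar> + \<bar>b - a\<bar>"])
    show "((\<lambda>t. v t - k) has_real_derivative pwl a b (v t) + \<mu> * sin t) (at t)" for t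
      using DERIV_diff[OF solution_deriv[OF v] DERIV_const[of k]] by simp
    fix r assume r: "r \<in> {s..t}" "v r - k < 0"
    have "\<bar>pwl a b (v r) - pwl a b k\<bar> \<le> (\<bar>a\<bar> + \<bar>b - a\<bar>) * - (v r - k)"
      using pwl_lipschitz[of a b "v r" k] r by simp
    then have "pwl a b (v r) - pwl a b k \<ge> (\<bar>a\<bar> + \<bar>b - a\<bar>) * (v r - k)"
      unfolding mult_minus_right by linarith
    then show "(\<bar>a\<bar> + \<bar>b - a\<bar>) * (v r - k) \<le> pwl a b (v r) + \<mu> * sin r" using up[OF r(1)] by simp
  qed (use st in auto)
  then show ?thesis by simp
qed

lemma stays_below:
  assumes v: "solution a b \<mu> v" and st: "s \<le> t" "v s \<le> k"
    and down: "\<And>r. r \<in> {s..t} \<Longrightarrow> pwl a b k + \<mu> * sin r \<le> 0"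
  shows "v t \<le> k"
proof -
  have "- v t \<ge> - k"
  proof (rule stays_above[OF solution_minus[OF v] st(1)])
    show "pwl a b (- k) + - \<mu> * sin r \<ge> 0" if "r \<in> {s..t}" for r
      using down[OF that] by (simp add: pwl_minus)
  qed (use st in simp)
  then show ?thesis by simp
qed

lemma periodic_shift:
  assumes "periodic_solution a b \<mu> u"
  obtains s' where "c \<le> s'" "s' \<le> c + 2 * pi" "u s' = u s"
proof
  have per: "u (t + 2 * pi) = u t" for t using assms by (simp add: periodic_solution_def)
  have nat: "u (t + 2 * pi * real n) = u t" for t n
  proof (induction n)
    case (Suc n)
    have "t + 2 * pi * real (Suc n) = (t + 2 * pi * real n) + 2 * pi" by (simp add: algebra_simps)
    then show ?case using per Suc by metis
  qed simp
  have int: "u (t + 2 * pi * of_int n) = u t" for t n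
  proof (cases "n \<ge> 0")
    case True
    then show ?thesis using nat[of t "nat n"] by simp
  next
    case False
    then show ?thesis using nat[of "t + 2 * pi * of_int n" "nat (- n)"] by simp
  qed
  define n where "n = - \<lfloor>(s - c) / (2 * pi)\<rfloor>"
  show "u (s + 2 * pi * of_int n) = u s" by (rule int)
  have "of_int \<lfloor>(s - c) / (2 * pi)\<rfloor> * (2 * pi) \<le> s - c"
    using floor_divide_lower[of "2 * pi" "s - c"] by simp
  moreover have "s - c < (of_int \<lfloor>(s - c) / (2 * pi)\<rfloor> + 1) * (2 * pi)"
    using floor_divide_upper[of "2 * pi" "s - c"] by simp
  ultimately show "c \<le> s + 2 * pi * of_int n" "s + 2 * pi * of_int n \<le> c + 2 * pi"
    by (simp_all add: n_def algebra_simps)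
qed

lemma pwl_pm1: "pwl a b 1 = b" "pwl a b (-1) = - b"
  by (simp_all add: pwl_def)

lemma crossing_both_imp_less:
  assumes u: "periodic_solution a b \<mu> u" and \<mu>: "\<mu> \<ge> 0" and s: "u s < -1" and t: "u t > 1"
  shows "\<bar>b\<bar> < \<mu>"
proof (rule ccontr)
  assume "\<not> \<bar>b\<bar> < \<mu>"
  then consider "b \<ge> \<mu>" | "b \<le> - \<mu>" by linarith
  moreover have su: "solution a b \<mu> u" using u by (simp add: periodic_solution_def)
  have sin: "\<mu> * sin r \<le> \<mu>" "- \<mu> \<le> \<mu> * sin r" for r
    using mult_left_mono[OF sin_le_one[of r] \<mu>] mult_left_mono[OF sin_ge_minus_one[of r] \<mu>] by auto
  ultimately show False
  proof cases
    case 1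
    obtain s' where s': "t \<le> s'" "u s' = u s" using periodic_shift[OF u, of t s] by metis
    have "u s' \<ge> 1"
    proof (rule stays_above[OF su s'(1)])
      show "0 \<le> pwl a b 1 + \<mu> * sin r" for r using sin(2)[of r] 1 unfolding pwl_pm1 by linarith
    qed (use t in simp)
    then show False using s s' by simp
  next
    case 2
    obtain t' where t': "s \<le> t'" "u t' = u t" using periodic_shift[OF u, of s t] by metis
    have "u t' \<le> 1"
    proof (rule stays_below[OF su t'(1)])
      show "pwl a b 1 + \<mu> * sin r \<le> 0" for r using sin(1)[of r] 2 unfolding pwl_pm1 by linarith
    qed (use s in simp)
    then show False using t t' by simp
  qed
qed

text \<open>A solution above \<open>k\<close> at the start of the upward arc stays there along it; a
  visit below then happens in the downward arc and cannot be undone before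
  \<open>2 * pi + \<alpha>\<close>, against periodicity. The other end is analogous. The
  inequalities are weak because a cycle may touch the line at a tangency.\<close>

lemma periodic_crossing_bounds:
  assumes u: "periodic_solution a b \<mu> u" and s: "u s < k" and t: "u t > k" and \<alpha>: "\<bar>\<alpha>\<bar> < pi / 2"
    and up: "\<And>r. r \<in> {\<alpha>..pi - \<alpha>} \<Longrightarrow> pwl a b k + \<mu> * sin r \<ge> 0"
    and down: "\<And>r. r \<in> {pi - \<alpha>..2 * pi + \<alpha>} \<Longrightarrow> pwl a b k + \<mu> * sin r \<le> 0"
  shows "u \<alpha> \<le> k" "u (pi - \<alpha>) \<ge> k"
proof -
  have su: "solution a b \<mu> u" and per: "u (2 * pi + \<alpha>) = u \<alpha>"
    using u by (auto simp: periodic_solution_def add.commute)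
  obtain s' where s': "\<alpha> \<le> s'" "s' \<le> \<alpha> + 2 * pi" "u s' = u s" by (rule periodic_shift[OF u])
  obtain t' where t': "\<alpha> \<le> t'" "t' \<le> \<alpha> + 2 * pi" "u t' = u t" by (rule periodic_shift[OF u])
  show "u \<alpha> \<le> k"
  proof (rule ccontr)
    assume gt: "\<not> u \<alpha> \<le> k"
    show False
    proof (cases "s' \<le> pi - \<alpha>")
      case True
      have "u s' \<ge> k" by (rule stays_above[OF su s'(1)]) (use gt up True in auto)
      then show False using s s' by simp
    next
      case False
      have "u (2 * pi + \<alpha>) \<le> k" by (rule stays_below[OF su, of s']) (use s s' down False in auto)
      then show False using gt per by simp
    qed
  qed
  show "u (pi - \<alpha>) \<ge> k"
  proof (rule ccontr)
    assume less: "\<not> u (pi - \<alpha>) \<ge> k"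
    show False
    proof (cases "t' \<le> pi - \<alpha>")
      case True
      have "u (pi - \<alpha>) \<ge> k" by (rule stays_above[OF su True]) (use t t' up in auto)
      then show False using less by simp
    next
      case False
      have "u t' \<le> k" by (rule stays_below[OF su, of "pi - \<alpha>"]) (use less t' down False in auto)
      then show False using t t' by simp
    qed
  qed
qed

text \<open>The shift by \<open>d\<close> absorbs the constant term: \<open>v + d\<close> solves
  \<open>w' = c * w + \<mu> * sin t\<close>, and its deviation from the periodic solution is a pure
  exponential.\<close>

lemma first_integral_invariant:
  assumes st: "s \<le> t"
    and der: "\<And>r. r \<in> {s..t} \<Longrightarrow> (v has_real_derivative c * (v r + d) + \<mu> * sin r) (at r)"
  shows "first_integral c (v t + d) \<mu> t = first_integral c (v s + d) \<mu> s"
proof (cases "s < t")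
  case True
  define k where "k = \<mu> / (1 + c\<^sup>2)"
  have k: "k * (1 + c\<^sup>2) = \<mu>" by (simp add: k_def one_plus_square_neq_zero)
  define g where "g r = exp (- c * r) * (v r + d + k * (c * sin r + cos r))" for r
  have dg: "(g has_real_derivative 0) (at r)" if "r \<in> {s..t}" for r
  proof -
    have "(g has_real_derivative (exp (- c * r) * (- c)) * (v r + d + k * (c * sin r + cos r)) +
       exp (- c * r) * ((c * (v r + d) + \<mu> * sin r) + k * (c * cos r - sin r))) (at r)"
      unfolding g_def by (auto intro!: derivative_eq_intros der[OF that])
    moreover have "(exp (- c * r) * (- c)) * (v r + d + k * (c * sin r + cos r)) +
       exp (- c * r) * ((c * (v r + d) + \<mu> * sin r) + k * (c * cos r - sin r)) = 0"
      unfolding k[symmetric] by (simp add: algebra_simps power2_eq_square)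
    ultimately show ?thesis by simp
  qed
  have "g t = g s"
  proof (rule DERIV_isconst_end[OF True])
    show "continuous_on {s..t} g"
      using dg by (intro continuous_at_imp_continuous_on ballI) (blast intro: DERIV_isCont)
  qed (use dg in auto)
  then show ?thesis by (simp add: g_def first_integral_def amp_def k_def)
qed (use st in auto)

lemma first_integral_mid:
  assumes v: "solution a b \<mu> v" and "s \<le> t" and "\<And>r. r \<in> {s..t} \<Longrightarrow> -1 \<le> v r \<and> v r \<le> 1"
  shows "first_integral b (v t) \<mu> t = first_integral b (v s) \<mu> s"
proof -
  have pw: "pwl a b x = b * (x + 0)" if "-1 \<le> x \<and> x \<le> 1" for x
    using that by (auto simp: pwl_def algebra_simps)
  have "first_integral b (v t + 0) \<mu> t = first_integral b (v s + 0) \<mu> s"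
    by (rule first_integral_invariant[OF assms(2)]) (use solution_deriv[OF v] pw assms(3) in metis)
  then show ?thesis by simp
qed

lemma first_integral_outer:
  assumes v: "solution a b \<mu> v" and "s \<le> t" and a: "a \<noteq> 0" and \<sigma>: "\<sigma> = 1 \<or> \<sigma> = - 1"
    and out: "\<And>r. r \<in> {s..t} \<Longrightarrow> \<sigma> * v r \<ge> 1" and ends: "v s = \<sigma>" "v t = \<sigma>"
  shows "first_integral a (\<sigma> * (b / a)) \<mu> t = first_integral a (\<sigma> * (b / a)) \<mu> s"
proof -
  have pw: "pwl a b x = a * (x + \<sigma> * (b - a) / a)" if "\<sigma> * x \<ge> 1" for x
    using that \<sigma> a by (auto simp: pwl_def field_simps)
  have "first_integral a (v t + \<sigma> * (b - a) / a) \<mu> t = first_integral a (v s + \<sigma> * (b - a) / a) \<mu> s"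
    by (rule first_integral_invariant[OF assms(2)])
      (use solution_deriv[OF v] pw out in metis)
  moreover have "\<sigma> + \<sigma> * (b - a) / a = \<sigma> * (b / a)" using a by (simp add: field_simps)
  ultimately show ?thesis using ends by simp
qed


lemma sin_arc_closed:
  assumes "\<bar>\<alpha>\<bar> < pi / 2"
  shows "x \<in> {\<alpha>..pi - \<alpha>} \<Longrightarrow> sin \<alpha> \<le> sin x" "x \<in> {pi - \<alpha>..2 * pi + \<alpha>} \<Longrightarrow> sin x \<le> sin \<alpha>"
proof -
  assume x: "x \<in> {\<alpha>..pi - \<alpha>}"
  then consider "x = \<alpha>" | "x = pi - \<alpha>" | "\<alpha> < x" "x < pi - \<alpha>" by fastforce
  then show "sin \<alpha> \<le> sin x" using sin_greater_on_arc[OF assms, of x] by cases auto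
next
  assume x: "x \<in> {pi - \<alpha>..2 * pi + \<alpha>}"
  then consider "x = pi - \<alpha>" | "x = 2 * pi + \<alpha>" | "pi - \<alpha> < x" "x < 2 * pi + \<alpha>" by fastforce
  then show "sin x \<le> sin \<alpha>" using sin_less_on_arc[OF assms, of x] by cases (auto simp: sin_add)
qed

section \<open>From crossing times to limit cycles\<close>

locale crossing =
  fixes a b \<mu> \<alpha> :: real
  assumes a: "a \<noteq> 0" and \<mu>: "\<mu> > 0" and \<alpha>: "\<bar>\<alpha>\<bar> < pi / 2" and b: "b = - \<mu> * sin \<alpha>"
begin

lemma rate:
  "pwl a b 1 + \<mu> * sin r = \<mu> * (sin r - sin \<alpha>)" "pwl a b (-1) + \<mu> * sin r = \<mu> * (sin r - sin (- \<alpha>))"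
  by (simp_all add: pwl_pm1 b algebra_simps)

lemma \<alpha>': "\<bar>- \<alpha>\<bar> < pi / 2"
  using \<alpha> by simp

lemma up1: "\<alpha> < r \<Longrightarrow> r < pi - \<alpha> \<Longrightarrow> pwl a b 1 + \<mu> * sin r > 0"
  and down1: "pi - \<alpha> < r \<Longrightarrow> r < 2 * pi + \<alpha> \<Longrightarrow> pwl a b 1 + \<mu> * sin r < 0"
  and up2: "- \<alpha> < r \<Longrightarrow> r < pi + \<alpha> \<Longrightarrow> pwl a b (-1) + \<mu> * sin r > 0"
  and down2: "pi + \<alpha> < r \<Longrightarrow> r < 2 * pi - \<alpha> \<Longrightarrow> pwl a b (-1) + \<mu> * sin r < 0"
  unfolding rate using \<mu> sin_greater_on_arc[OF \<alpha>, of r] sin_less_on_arc[OF \<alpha>, of r]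
    sin_greater_on_arc[OF \<alpha>', of r] sin_less_on_arc[OF \<alpha>', of r]
  by (auto simp: mult_pos_neg)

lemma up3: "2 * pi - \<alpha> < r \<Longrightarrow> r < 3 * pi + \<alpha> \<Longrightarrow> pwl a b (-1) + \<mu> * sin r > 0"
  using up2[of "r - 2 * pi"] by (simp add: sin_diff)

lemma up1_closed: "r \<in> {\<alpha>..pi - \<alpha>} \<Longrightarrow> pwl a b 1 + \<mu> * sin r \<ge> 0"
  and down1_closed: "r \<in> {pi - \<alpha>..2 * pi + \<alpha>} \<Longrightarrow> pwl a b 1 + \<mu> * sin r \<le> 0"
  and up2_closed: "r \<in> {- \<alpha>..pi - (- \<alpha>)} \<Longrightarrow> pwl a b (-1) + \<mu> * sin r \<ge> 0"
  and down2_closed: "r \<in> {pi - (- \<alpha>)..2 * pi + (- \<alpha>)} \<Longrightarrow> pwl a b (-1) + \<mu> * sin r \<le> 0"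
  unfolding rate using \<mu> sin_arc_closed[OF \<alpha>, of r] sin_arc_closed[OF \<alpha>', of r]
  by (auto simp: mult_nonneg_nonpos)

definition crosses_both :: "(real \<Rightarrow> real) \<Rightarrow> bool" where
  "crosses_both u \<longleftrightarrow> periodic_solution a b \<mu> u \<and> (\<exists>s. u s < -1) \<and> (\<exists>t. u t > 1)"

lemma crosses_both_bounds:
  assumes "crosses_both u"
  shows "u \<alpha> \<le> 1" "u (pi - \<alpha>) \<ge> 1" "u (2 * pi + \<alpha>) \<le> 1"
    "u (- \<alpha>) \<le> -1" "u (pi + \<alpha>) \<ge> -1" "u (2 * pi - \<alpha>) \<le> -1" "u (3 * pi + \<alpha>) \<ge> -1"
proof -
  from assms obtain s t where u: "periodic_solution a b \<mu> u" and st: "u s < -1" "u t > 1"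
    by (auto simp: crosses_both_def)
  have per: "u (r + 2 * pi) = u r" for r using u by (simp add: periodic_solution_def)
  show 1: "u \<alpha> \<le> 1" "u (pi - \<alpha>) \<ge> 1"
    using periodic_crossing_bounds[OF u, of s 1 t \<alpha>] st \<alpha> up1_closed down1_closed by auto
  have "u (- \<alpha>) \<le> -1" "u (pi - - \<alpha>) \<ge> -1"
    using periodic_crossing_bounds[OF u, of s "-1" t "- \<alpha>"] st \<alpha>' up2_closed down2_closed by auto
  then show 2: "u (- \<alpha>) \<le> -1" "u (pi + \<alpha>) \<ge> -1" by simp_all
  show "u (2 * pi + \<alpha>) \<le> 1" "u (2 * pi - \<alpha>) \<le> -1" "u (3 * pi + \<alpha>) \<ge> -1"
    using 1 2 per[of \<alpha>] per[of "- \<alpha>"] per[of "pi + \<alpha>"] by (simp_all add: algebra_simps)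
qed

text \<open>The cycles \<open>lo\<close> and \<open>hi\<close> satisfy weak inequalities at the ends
  of the arcs; being strictly between them makes these strict for \<open>v\<close>, periodic or not,
  and gives one crossing per arc. Arcs of different lines overlap, so the order of the crossings
  needs an argument of its own.\<close>

lemma sandwiched_itinerary:
  assumes lo: "crosses_both lo" and hi: "crosses_both hi" and v: "solution a b \<mu> v"
    and between: "\<And>t. lo t < v t" "\<And>t. v t < hi t"
    and \<tau>: "\<tau> \<in> {- \<alpha><..<pi + \<alpha>}" "v \<tau> = -1"
  shows "\<exists>S. S 0 = \<tau> \<and> itinerary a b \<mu> \<alpha> S \<and> v (S 4) = -1 \<and>
    (\<forall>t\<in>{2 * pi - \<alpha><..<3 * pi + \<alpha>}. v t = -1 \<longrightarrow> t = S 4)"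
proof -
  note lo' = crosses_both_bounds[OF lo] and hi' = crosses_both_bounds[OF hi]
  have ends: "v \<alpha> < 1" "v (pi - \<alpha>) > 1" "v (2 * pi + \<alpha>) < 1"
    "v (- \<alpha>) < -1" "v (pi + \<alpha>) > -1" "v (2 * pi - \<alpha>) < -1" "v (3 * pi + \<alpha>) > -1"
    using lo'(2,5,7) hi'(1,3,4,6) between[of \<alpha>] between[of "pi - \<alpha>"] between[of "2 * pi + \<alpha>"]
      between[of "- \<alpha>"] between[of "pi + \<alpha>"] between[of "2 * pi - \<alpha>"] between[of "3 * pi + \<alpha>"]
    by linarith+
  have \<alpha>_less: "\<alpha> < pi / 2" "- (pi / 2) < \<alpha>" using \<alpha> by (auto simp: abs_less_iff)
  obtain t0 where t0: "t0 \<in> {- \<alpha><..<pi + \<alpha>}" "v t0 = -1"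
    "\<And>s. s \<in> {- \<alpha>..<t0} \<Longrightarrow> v s < -1" "\<And>s. s \<in> {t0<..pi + \<alpha>} \<Longrightarrow> v s > -1"
    by (rule cross_up[OF v ends(4,5) _ up2]) (use \<alpha>_less in auto)
  obtain t1 where t1: "t1 \<in> {\<alpha><..<pi - \<alpha>}" "v t1 = 1"
    "\<And>s. s \<in> {\<alpha>..<t1} \<Longrightarrow> v s < 1" "\<And>s. s \<in> {t1<..pi - \<alpha>} \<Longrightarrow> v s > 1"
    by (rule cross_up[OF v ends(1,2) _ up1]) (use \<alpha>_less in auto)
  obtain t2 where t2: "t2 \<in> {pi - \<alpha><..<2 * pi + \<alpha>}" "v t2 = 1"
    "\<And>s. s \<in> {pi - \<alpha>..<t2} \<Longrightarrow> v s > 1" "\<And>s. s \<in> {t2<..2 * pi + \<alpha>} \<Longrightarrow> v s < 1"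
    by (rule cross_down[OF v ends(2,3) _ down1]) (use \<alpha>_less in auto)
  obtain t3 where t3: "t3 \<in> {pi + \<alpha><..<2 * pi - \<alpha>}" "v t3 = -1"
    "\<And>s. s \<in> {pi + \<alpha>..<t3} \<Longrightarrow> v s > -1" "\<And>s. s \<in> {t3<..2 * pi - \<alpha>} \<Longrightarrow> v s < -1"
    by (rule cross_down[OF v ends(5,6) _ down2]) (use \<alpha>_less in auto)
  obtain t4 where t4: "t4 \<in> {2 * pi - \<alpha><..<3 * pi + \<alpha>}" "v t4 = -1"
    "\<And>s. s \<in> {2 * pi - \<alpha>..<t4} \<Longrightarrow> v s < -1" "\<And>s. s \<in> {t4<..3 * pi + \<alpha>} \<Longrightarrow> v s > -1"
    by (rule cross_up[OF v ends(6,7) _ up3]) (use \<alpha>_less in auto)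
  have t0\<tau>: "t0 = \<tau>"
    using t0(3)[of \<tau>] t0(4)[of \<tau>] \<tau> by (cases t0 \<tau> rule: linorder_cases) auto
  have t4_unique: "t = t4" if "t \<in> {2 * pi - \<alpha><..<3 * pi + \<alpha>}" "v t = -1" for t
    using t4(3)[of t] t4(4)[of t] that by (cases t4 t rule: linorder_cases) auto
  have above1: "v s > 1" if "t1 < s" "s < t2" for s
    using t1(4)[of s] t2(3)[of s] that by (cases "s \<le> pi - \<alpha>") auto
  have above2: "v s > -1" if "t0 < s" "s < t3" for s
    using t0(4)[of s] t3(3)[of s] that by (cases "s \<le> pi + \<alpha>") auto
  have below2: "v s < -1" if "t3 < s" "s < t4" for s
    using t3(4)[of s] t4(3)[of s] that by (cases "s \<le> 2 * pi - \<alpha>") auto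
  have t01: "t0 < t1"
  proof (rule ccontr)
    assume le: "\<not> t0 < t1"
    \<comment> \<open>Between \<open>- \<alpha>\<close> and \<open>t0\<close> the solution is below
      -1, so \<open>t1\<close> would have to precede \<open>- \<alpha>\<close>; but then
      \<open>v\<close> would already exceed 1 at \<open>- \<alpha>\<close>.\<close>
    have "t1 < - \<alpha>"
      using t0(2) t0(3)[of t1] t1(2) le by (cases "t1 = t0") force+
    then have "v (- \<alpha>) > 1" using t2(1) \<alpha>_less by (intro above1) auto
    then show False using ends by simp
  qed
  have t23: "t2 < t3"
  proof (rule ccontr)
    assume le: "\<not> t2 < t3"
    have "t2 > 2 * pi - \<alpha>"
      using t3(2) t3(4)[of t2] t2(2) le by (cases "t2 = t3") force+
    then have "v (2 * pi - \<alpha>) > 1" using t1(1) \<alpha>_less by (intro above1) auto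
    then show False using ends by simp
  qed
  have t12: "t1 < t2" and t34: "t3 < t4" using t1(1) t2(1) t3(1) t4(1) by auto
  have mid01: "-1 \<le> v r \<and> v r \<le> 1" if r: "r \<in> {t0..t1}" for r
  proof
    show "-1 \<le> v r" using above2[of r] t0(2) r t12 t23 by (cases "r = t0") auto
    show "v r \<le> 1"
    proof (cases "r \<ge> \<alpha>")
      case True
      then show ?thesis using t1(2) t1(3)[of r] r by (cases "r = t1") auto
    next
      case False
      show ?thesis
      proof (rule stays_below[OF v])
        show "- \<alpha> \<le> r" "v (- \<alpha>) \<le> 1" using r t0(1) ends by auto
        fix s assume "s \<in> {- \<alpha>..r}"
        then have "s + 2 * pi \<in> {pi - \<alpha>..2 * pi + \<alpha>}" using False \<alpha>_less by auto
        from down1_closed[OF this] show "pwl a b 1 + \<mu> * sin s \<le> 0" by simp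
      qed
    qed
  qed
  have mid23: "-1 \<le> v r \<and> v r \<le> 1" if r: "r \<in> {t2..t3}" for r
  proof
    show "-1 \<le> v r" using above2[of r] t3(2) r t01 t12 by (cases "r = t3") auto
    show "v r \<le> 1"
    proof (cases "r \<le> 2 * pi + \<alpha>")
      case True
      then show ?thesis using t2(2) t2(4)[of r] r by (cases "r = t2") auto
    next
      case False
      show ?thesis
      proof (rule ccontr)
        assume gt: "\<not> v r \<le> 1"
        have "v (2 * pi - \<alpha>) \<ge> 1"
        proof (rule stays_above[OF v])
          show "r \<le> 2 * pi - \<alpha>" "v r \<ge> 1" using r t3(1) gt by auto
          fix s assume "s \<in> {r..2 * pi - \<alpha>}"
          then have "s - 2 * pi \<in> {\<alpha>..pi - \<alpha>}" using False \<alpha>_less by auto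
          from up1_closed[OF this] show "pwl a b 1 + \<mu> * sin s \<ge> 0" by (simp add: sin_diff)
        qed
        then show False using ends by simp
      qed
    qed
  qed
  have out12: "1 * v r \<ge> 1" if "r \<in> {t1..t2}" for r
    using above1[of r] t1(2) t2(2) that by (cases "r = t1 \<or> r = t2") auto
  have out34: "- 1 * v r \<ge> 1" if "r \<in> {t3..t4}" for r
    using below2[of r] t3(2) t4(2) that by (cases "r = t3 \<or> r = t4") auto
  define S where "S i = [t0, t1, t2, t3, t4] ! i" for i
  have S: "S 0 = t0" "S 1 = t1" "S 2 = t2" "S 3 = t3" "S 4 = t4"
    by (simp_all add: S_def numeral_eq_Suc)
  have "itinerary a b \<mu> \<alpha> S"
    unfolding itinerary_def S
  proof (intro conjI)
    show "first_integral b 1 \<mu> t1 = first_integral b (- 1) \<mu> t0"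
      using first_integral_mid[OF v less_imp_le[OF t01] mid01] t0(2) t1(2) by simp
    show "first_integral b (- 1) \<mu> t3 = first_integral b 1 \<mu> t2"
      using first_integral_mid[OF v less_imp_le[OF t23] mid23] t2(2) t3(2) by simp
    show "first_integral a (b / a) \<mu> t2 = first_integral a (b / a) \<mu> t1"
      using first_integral_outer[OF v less_imp_le[OF t12] a _ out12] t1(2) t2(2) by simp
    show "first_integral a (- (b / a)) \<mu> t4 = first_integral a (- (b / a)) \<mu> t3"
      using first_integral_outer[OF v less_imp_le[OF t34] a _ out34] t3(2) t4(2) by simp
  qed (use t0 t1 t2 t3 t4 in blast)+
  then show ?thesis using t0\<tau> t4(2) t4_unique by (intro exI[of _ S]) (simp add: S)
qed

text \<open>Cycles are counted through the times at which they cross -1 upwards. Between two such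
  times every solution crossing there is sandwiched, so the return time is defined on the whole
  interval and the tame bound applies.\<close>

lemma limit_cycles_between:
  assumes N: "\<And>l h (T :: nat \<Rightarrow> real \<Rightarrow> real).
      (\<forall>\<tau>\<in>{l<..<h}. T 0 \<tau> = \<tau> \<and> itinerary a b \<mu> \<alpha> (\<lambda>i. T i \<tau>)) \<Longrightarrow>
      \<exists>F. finite F \<and> card F \<le> N \<and>
       sgn_const_off {l<..<h} F (\<lambda>\<tau>. tan ((T 4 \<tau> - 5 * pi / 2) / 2) - tan ((\<tau> - pi / 2) / 2))"
    and lo: "crosses_both lo" and hi: "crosses_both hi"
  defines "Z \<equiv> {v. limit_cycle a b \<mu> v \<and> lo 0 < v 0 \<and> v 0 < hi 0}"
  shows "finite ((\<lambda>v. v 0) ` Z) \<and> card ((\<lambda>v. v 0) ` Z) \<le> N + 2"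
proof -
  have slo: "solution a b \<mu> lo" and shi: "solution a b \<mu> hi"
    using lo hi by (auto simp: crosses_both_def periodic_solution_def)
  have between: "lo t < v t" "v t < hi t" if "v \<in> Z" for v t
    using that solution_less[OF slo, of v 0 t] solution_less[OF _ shi, of v 0 t] limit_cycle_solution
    by (auto simp: Z_def)
  have \<alpha>_less: "\<alpha> < pi / 2" "- (pi / 2) < \<alpha>" using \<alpha> by (auto simp: abs_less_iff)
  define sol where "sol \<tau> = (SOME v. solution a b \<mu> v \<and> v \<tau> = -1)" for \<tau>
  have sol: "solution a b \<mu> (sol \<tau>)" "sol \<tau> \<tau> = -1" for \<tau>
    using someI_ex[OF solution_exists[of a b \<mu> \<tau> "-1"]] by (auto simp: sol_def)
  have sol_eq: "v = sol \<tau>" if "solution a b \<mu> v" "v \<tau> = -1" for v \<tau>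
    using solution_unique[OF that(1) sol(1)] that(2) sol(2) by metis
  define Y where "Y = {\<tau>\<in>{- \<alpha><..<pi + \<alpha>}. sol \<tau> \<in> Z}"
  have rise: "v s > -1" if "solution a b \<mu> v" "- \<alpha> < r" "r < s" "s < pi + \<alpha>" "v r \<ge> -1" for v r s
  proof -
    have "v s - -1 > 0"
    proof (rule first_crossing_up[OF that(3), of "\<lambda>t. v t - -1" "\<lambda>t. pwl a b (v t) + \<mu> * sin t"])
      show "((\<lambda>t. v t - -1) has_real_derivative pwl a b (v t) + \<mu> * sin t) (at t)" for t
        using DERIV_diff[OF solution_deriv[OF that(1)] DERIV_const[of "-1"]] by simp
      fix t assume t: "t \<in> {r..s}" "v t - -1 = 0"
      have "v t = -1" using t(2) by simp
      then show "0 < pwl a b (v t) + \<mu> * sin t" using up2[of t] t(1) that by simp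
    qed (use that in auto)
    then show ?thesis by simp
  qed
  have "finite Y \<and> card Y \<le> N + 2"
  proof (rule card_le_of_between)
    fix l h assume lh: "l \<in> Y" "h \<in> Y" "l < h"
    have mid: "\<tau> \<in> {- \<alpha><..<pi + \<alpha>}" if "\<tau> \<in> {l<..<h}" for \<tau> using lh that by (auto simp: Y_def)
    \<comment> \<open>A later upward crossing means a lower solution: at time \<tau> the solution
      crossing at \<open>l\<close> is already above -1, the one crossing at \<open>h\<close> still
      below.\<close>
    have sandwich: "lo t < sol \<tau> t" "sol \<tau> t < hi t" if \<tau>: "\<tau> \<in> {l<..<h}" for \<tau> t
    proof -
      have "sol l \<tau> > -1" using rise[OF sol(1), of l \<tau> l] sol(2)[of l] lh \<tau> by (auto simp: Y_def)
      then have "sol \<tau> \<tau> < hi \<tau>" using between(2)[of "sol l" \<tau>] lh sol(2)[of \<tau>] by (auto simp: Y_def)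
      then show "sol \<tau> t < hi t" by (rule solution_less[OF sol(1) shi])
      have "sol h \<tau> < -1" using rise[OF sol(1), of \<tau> h h] sol(2)[of h] lh \<tau>
        by (cases "sol h \<tau> < -1") (auto simp: Y_def)
      then have "lo \<tau> < sol \<tau> \<tau>" using between(1)[of "sol h" \<tau>] lh sol(2)[of \<tau>] by (auto simp: Y_def)
      then show "lo t < sol \<tau> t" by (rule solution_less[OF slo sol(1)])
    qed
    have "\<forall>\<tau>. \<exists>S. \<tau> \<in> {l<..<h} \<longrightarrow> S 0 = \<tau> \<and> itinerary a b \<mu> \<alpha> S \<and> sol \<tau> (S 4) = -1 \<and>
        (\<forall>t\<in>{2 * pi - \<alpha><..<3 * pi + \<alpha>}. sol \<tau> t = -1 \<longrightarrow> t = S 4)"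
      using sandwiched_itinerary[OF lo hi sol(1) sandwich mid sol(2)] by blast
    then obtain S where S: "\<And>\<tau>. \<tau> \<in> {l<..<h} \<Longrightarrow> S \<tau> 0 = \<tau> \<and> itinerary a b \<mu> \<alpha> (S \<tau>) \<and> sol \<tau> (S \<tau> 4) = -1 \<and>
        (\<forall>t\<in>{2 * pi - \<alpha><..<3 * pi + \<alpha>}. sol \<tau> t = -1 \<longrightarrow> t = S \<tau> 4)"
      by metis
    define T where "T i \<tau> = S \<tau> i" for i :: nat and \<tau>
    define D where "D \<tau> = tan ((T 4 \<tau> - 5 * pi / 2) / 2) - tan ((\<tau> - pi / 2) / 2)" for \<tau>
    have "\<exists>F. finite F \<and> card F \<le> N \<and> sgn_const_off {l<..<h} F D"
      unfolding D_def by (rule N) (use S in \<open>simp add: T_def\<close>)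
    then obtain F where F: "finite F" "card F \<le> N" "sgn_const_off {l<..<h} F D" by blast
    have D_iff: "D \<tau> = 0 \<longleftrightarrow> periodic_solution a b \<mu> (sol \<tau>)" if \<tau>: "\<tau> \<in> {l<..<h}" for \<tau>
    proof -
      have S4: "S \<tau> 4 \<in> {2 * pi - \<alpha><..<3 * pi + \<alpha>}" using S[OF \<tau>] by (simp add: itinerary_def)
      \<comment> \<open>Moving the period into the centre puts both tangents on the branch where
        \<open>tan\<close> is injective.\<close>
      have arg: "(\<tau> - pi / 2) / 2 = (\<tau> + 2 * pi - 5 * pi / 2) / 2" by simp
      have "D \<tau> = 0 \<longleftrightarrow> S \<tau> 4 = \<tau> + 2 * pi"
      proof
        assume "D \<tau> = 0"
        then have "tan ((S \<tau> 4 - 5 * pi / 2) / 2) = tan ((\<tau> + 2 * pi - 5 * pi / 2) / 2)"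
          unfolding D_def T_def arg by simp
        moreover have "(S \<tau> 4 - 5 * pi / 2) / 2 \<in> {- (pi / 2)<..<pi / 2}"
          "(\<tau> + 2 * pi - 5 * pi / 2) / 2 \<in> {- (pi / 2)<..<pi / 2}"
          using S4 mid[OF \<tau>] \<alpha>_less by auto
        ultimately have "(S \<tau> 4 - 5 * pi / 2) / 2 = (\<tau> + 2 * pi - 5 * pi / 2) / 2"
          using tan_monotone by (metis greaterThanLessThan_iff less_irrefl linorder_neqE_linordered_idom)
        then show "S \<tau> 4 = \<tau> + 2 * pi" by simp
      qed (simp add: D_def T_def)
      also have "\<dots> \<longleftrightarrow> sol \<tau> (\<tau> + 2 * pi) = sol \<tau> \<tau>"
        using S[OF \<tau>] mid[OF \<tau>] sol(2)[of \<tau>] by (auto simp: algebra_simps)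
      finally show ?thesis using periodic_iff_return[OF sol(1)] by metis
    qed
    have "Y \<inter> {l<..<h} \<subseteq> F"
    proof
      fix \<tau> assume \<tau>: "\<tau> \<in> Y \<inter> {l<..<h}"
      then have cyc: "limit_cycle a b \<mu> (sol \<tau>)" by (simp add: Y_def Z_def)
      show "\<tau> \<in> F"
      proof (rule ccontr)
        assume "\<tau> \<notin> F"
        have "open ({l<..<h} - F)" using F(1) by (intro open_Diff finite_imp_closed) auto
        then obtain \<epsilon> where \<epsilon>: "\<epsilon> > 0" "ball \<tau> \<epsilon> \<subseteq> {l<..<h} - F"
          using \<tau> \<open>\<tau> \<notin> F\<close> by (meson DiffI IntD2 openE)
        \<comment> \<open>Off \<open>F\<close> a zero of \<open>D\<close> spreads to an interval of
          zeros. The part to the right of \<tau> already gives a strip of periodic solutions with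
          the cycle as its upper boundary.\<close>
        define \<rho> where "\<rho> = \<tau> + \<epsilon> / 2"
        have \<rho>: "\<tau> < \<rho>" "{\<tau>..\<rho>} \<subseteq> {l<..<h} - F"
        proof -
          have "{\<tau>..\<rho>} \<subseteq> ball \<tau> \<epsilon>" using \<epsilon>(1) by (auto simp: \<rho>_def dist_real_def)
          then show "{\<tau>..\<rho>} \<subseteq> {l<..<h} - F" using \<epsilon>(2) by blast
        qed (use \<epsilon> in \<open>simp add: \<rho>_def\<close>)
        have D0: "D \<tau> = 0" using D_iff[of \<tau>] \<tau> limit_cycle_periodic[OF cyc] by simp
        have per: "periodic_solution a b \<mu> (sol \<sigma>)" if "\<sigma> \<in> {\<tau>..\<rho>}" for \<sigma>
        proof -
          have "sgn (D \<sigma>) = sgn (D \<tau>)" by (rule sgn_const_offD[OF F(3) \<rho>(2) that]) (use \<rho> in auto)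
          then have "D \<sigma> = 0" using D0 by (simp add: sgn_zero_iff)
          moreover have "\<sigma> \<in> {l<..<h}" using that \<rho>(2) by blast
          ultimately show ?thesis using D_iff by blast
        qed
        have \<rho>_in: "\<rho> \<in> {l<..<h}" using \<rho> by (meson Diff_iff atLeastAtMost_iff less_imp_le order_refl subsetD)
        have "sol \<rho> \<rho> < sol \<tau> \<rho>"
          using rise[OF sol(1), of \<tau> \<rho> \<tau>] sol(2) mid[OF \<rho>_in] \<tau> \<rho>(1) by (auto simp: Y_def)
        note less = solution_less[OF sol(1) sol(1) this]
        show False
        proof (rule limit_cycle_not_between[OF cyc less[of 0]])
          fix z assume z: "solution a b \<mu> z" "sol \<rho> 0 < z 0" "z 0 < sol \<tau> 0"
          have "z \<tau> < -1" "z \<rho> > -1"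
            using solution_less[OF z(1) sol(1) z(3), of \<tau>] solution_less[OF sol(1) z(1) z(2), of \<rho>] sol(2)
            by metis+
          \<comment> \<open>A solution strictly inside the strip crosses -1 at some time between
            \<tau> and \<rho>, hence is one of the solutions already known to be periodic.\<close>
          then obtain \<sigma> where \<sigma>: "\<tau> \<le> \<sigma>" "\<sigma> \<le> \<rho>" "z \<sigma> = -1"
            using IVT'[of z \<tau> "-1" \<rho>, OF _ _ _ solution_continuous[OF z(1)]] \<rho>(1) by auto
          then show "periodic_solution a b \<mu> z" using per[of \<sigma>] sol_eq[OF z(1) \<sigma>(3)] by simp
        qed (use less[of 0] in auto)
      qed
    qed
    then show "finite (Y \<inter> {l<..<h}) \<and> card (Y \<inter> {l<..<h}) \<le> N"
      using F(1,2) by (meson card_mono finite_subset order_trans)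
  qed
  moreover have sub: "(\<lambda>v. v 0) ` Z \<subseteq> (\<lambda>\<tau>. sol \<tau> 0) ` Y"
  proof
    fix x assume "x \<in> (\<lambda>v. v 0) ` Z"
    then obtain v where v: "v \<in> Z" "x = v 0" by blast
    then have sv: "solution a b \<mu> v" by (simp add: Z_def limit_cycle_solution)
    have "v (- \<alpha>) < -1" "v (pi + \<alpha>) > -1"
      using between[OF v(1), of "- \<alpha>"] between[OF v(1), of "pi + \<alpha>"]
        crosses_both_bounds[OF lo] crosses_both_bounds[OF hi] by linarith+
    moreover from this obtain \<tau> where \<tau>: "- \<alpha> \<le> \<tau>" "\<tau> \<le> pi + \<alpha>" "v \<tau> = -1"
      using IVT'[of v "- \<alpha>" "-1" "pi + \<alpha>", OF _ _ _ solution_continuous[OF sv]] \<alpha>_less by auto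
    ultimately have "\<tau> \<in> {- \<alpha><..<pi + \<alpha>}" by (auto simp: less_le)
    then have "\<tau> \<in> Y" using v sol_eq[OF sv \<tau>(3)] by (simp add: Y_def)
    then show "x \<in> (\<lambda>\<tau>. sol \<tau> 0) ` Y" using v sol_eq[OF sv \<tau>(3)] by blast
  qed
  ultimately show ?thesis
    by (meson card_image_le card_mono finite_imageI finite_subset order_trans)
qed

end

section \<open>Assembly of the bound\<close>

lemma limit_cycles_bounded_nonneg:
  "\<exists>L. \<forall>a b \<mu>. \<mu> \<ge> 0 \<longrightarrow> finite {v. limit_cycle a b \<mu> v} \<and> card {v. limit_cycle a b \<mu> v} \<le> L"
proof -
  obtain N where N: "\<And>a b \<mu> \<alpha> l h (T :: nat \<Rightarrow> real \<Rightarrow> real).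
     a \<noteq> 0 \<and> \<mu> > 0 \<and> \<bar>\<alpha>\<bar> < pi / 2 \<and> b = - \<mu> * sin \<alpha> \<and>
     (\<forall>\<tau>\<in>{l<..<h}. T 0 \<tau> = \<tau> \<and> itinerary a b \<mu> \<alpha> (\<lambda>i. T i \<tau>)) \<Longrightarrow>
     \<exists>F. finite F \<and> card F \<le> N \<and>
       sgn_const_off {l<..<h} F (\<lambda>\<tau>. tan ((T 4 \<tau> - 5 * pi / 2) / 2) - tan ((\<tau> - pi / 2) / 2))"
    using return_time_tame by blast
  show ?thesis
  \<comment> \<open>Two cycles for each of the two one-kink classes, and \<open>N + 4\<close> for
    those crossing both lines: 2 for the outermost cycles and 2 for the outermost crossing times
    between them.\<close>
  proof (intro exI[of _ "N + 8"] allI impI)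
    fix a b \<mu> :: real assume \<mu>: "\<mu> \<ge> 0"
    define init where "init = (\<lambda>v :: real \<Rightarrow> real. v 0)"
    define U V W where "U = {v. limit_cycle a b \<mu> v \<and> (\<forall>t. v t \<ge> -1)}"
      and "V = {v. limit_cycle a b \<mu> v \<and> (\<forall>t. v t \<le> 1)}"
      and "W = {v. limit_cycle a b \<mu> v \<and> (\<exists>s. v s < -1) \<and> (\<exists>t. v t > 1)}"
    have split: "{v. limit_cycle a b \<mu> v} = U \<union> V \<union> W"
      by (auto simp: U_def V_def W_def not_le)
    have "finite (init ` U) \<and> card (init ` U) \<le> 0 + 2"
    proof (rule card_le_of_between)
      fix l h assume "l \<in> init ` U" "h \<in> init ` U" "l < h"
      then have "init ` U \<inter> {l<..<h} = {}"
        using limit_cycles_one_kink[of a b \<mu>] by (fastforce simp: U_def init_def)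
      then show "finite (init ` U \<inter> {l<..<h}) \<and> card (init ` U \<inter> {l<..<h}) \<le> 0" by simp
    qed
    moreover have "finite (init ` V) \<and> card (init ` V) \<le> 0 + 2"
    proof (rule card_le_of_between)
      fix l h assume lh: "l \<in> init ` V" "h \<in> init ` V" "l < h"
      have "init ` V \<inter> {l<..<h} = {}"
      proof (rule ccontr)
        assume "init ` V \<inter> {l<..<h} \<noteq> {}"
        with lh obtain u v w where *: "u \<in> V" "v \<in> V" "w \<in> V" "u 0 < v 0" "v 0 < w 0"
          by (auto simp: init_def)
        \<comment> \<open>Reflection reverses the order and sends the kink at -1 to the kink at 1;
          the one-kink argument is valid for either sign of \<mu>.\<close>
        then have "limit_cycle a b (- \<mu>) (\<lambda>t. - w t)" "limit_cycle a b (- \<mu>) (\<lambda>t. - v t)"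
          "limit_cycle a b (- \<mu>) (\<lambda>t. - u t)" by (auto simp: V_def limit_cycle_minus)
        from limit_cycles_one_kink[OF this] * show False by (auto simp: V_def)
      qed
      then show "finite (init ` V \<inter> {l<..<h}) \<and> card (init ` V \<inter> {l<..<h}) \<le> 0" by simp
    qed
    moreover have "finite (init ` W) \<and> card (init ` W) \<le> (N + 2) + 2"
    proof (rule card_le_of_between)
      fix l h assume lh: "l \<in> init ` W" "h \<in> init ` W" "l < h"
      then obtain lo hi where lo: "lo \<in> W" "lo 0 = l" and hi: "hi \<in> W" "hi 0 = h"
        by (auto simp: init_def)
      have cyc: "limit_cycle a b \<mu> lo" "limit_cycle a b \<mu> hi" using lo hi by (auto simp: W_def)
      have "a \<noteq> 0" using limit_cycles_monotone[OF _ cyc] lo hi lh by auto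
      have "\<bar>b\<bar> < \<mu>"
        using lo crossing_both_imp_less[OF limit_cycle_periodic[OF cyc(1)] \<mu>] by (auto simp: W_def)
      define \<alpha> where "\<alpha> = arcsin (- b / \<mu>)"
      have bnd: "- 1 < - b / \<mu>" "- b / \<mu> < 1" using \<open>\<bar>b\<bar> < \<mu>\<close> by (auto simp: field_simps abs_less_iff)
      interpret crossing a b \<mu> \<alpha>
      proof
        show "\<bar>\<alpha>\<bar> < pi / 2" using arcsin_lt_bounded[OF bnd] by (auto simp: \<alpha>_def abs_less_iff)
        have "sin \<alpha> = - b / \<mu>" unfolding \<alpha>_def using bnd by (intro sin_arcsin) auto
        then show "b = - \<mu> * sin \<alpha>" using \<open>\<bar>b\<bar> < \<mu>\<close> by simp
      qed (use \<open>a \<noteq> 0\<close> \<open>\<bar>b\<bar> < \<mu>\<close> in auto)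
      let ?Z = "{v. limit_cycle a b \<mu> v \<and> lo 0 < v 0 \<and> v 0 < hi 0}"
      have Z: "finite ((\<lambda>v. v 0) ` ?Z) \<and> card ((\<lambda>v. v 0) ` ?Z) \<le> N + 2"
      proof (rule limit_cycles_between)
        show "crosses_both lo" "crosses_both hi"
          using lo hi limit_cycle_periodic by (auto simp: W_def crosses_both_def)
      qed (use N a \<mu> \<alpha> b in blast)
      have "init ` W \<inter> {l<..<h} \<subseteq> (\<lambda>v. v 0) ` ?Z" using lo hi by (auto simp: init_def W_def)
      then show "finite (init ` W \<inter> {l<..<h}) \<and> card (init ` W \<inter> {l<..<h}) \<le> N + 2"
        using Z by (meson card_mono finite_subset order_trans)
    qed
    ultimately have fin: "finite (init ` (U \<union> V \<union> W))" and card: "card (init ` (U \<union> V \<union> W)) \<le> N + 8"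
      using card_Un_le[of "init ` U \<union> init ` V" "init ` W"] card_Un_le[of "init ` U" "init ` V"]
      by (auto simp: image_Un)
    \<comment> \<open>The classes were counted by initial values; uniqueness of solutions turns this
      into a count of the cycles themselves.\<close>
    have inj: "inj_on init {v. limit_cycle a b \<mu> v}"
      by (intro inj_onI solution_unique[where s = 0]) (auto simp: init_def intro: limit_cycle_solution)
    show "finite {v. limit_cycle a b \<mu> v} \<and> card {v. limit_cycle a b \<mu> v} \<le> N + 8"
      using finite_imageD[OF _ inj] card_image[OF inj] fin card by (simp add: split)
  qed
qed

text \<open>Oddness of the field makes reflection a bijection between the limit cycles for \<mu> and
  for \<open>- \<mu>\<close>, so the bound for \<open>\<mu> \<ge> 0\<close> carries over
  unchanged.\<close>

theorem theorem4p3: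
  shows "\<exists>L::nat. \<forall>a b \<mu> :: real.
    finite {v. limit_cycle a b \<mu> v} \<and> card {v. limit_cycle a b \<mu> v} \<le> L"
proof -
  obtain L where L: "\<And>a b \<mu>. \<mu> \<ge> 0 \<Longrightarrow>
      finite {v. limit_cycle a b \<mu> v} \<and> card {v. limit_cycle a b \<mu> v} \<le> L"
    using limit_cycles_bounded_nonneg by blast
  have "finite {v. limit_cycle a b \<mu> v} \<and> card {v. limit_cycle a b \<mu> v} \<le> L" for a b \<mu>
  proof (cases "\<mu> \<ge> 0")
    case False
    have sub: "{v. limit_cycle a b \<mu> v} \<subseteq> (\<lambda>v t. - v t) ` {v. limit_cycle a b (- \<mu>) v}"
    proof
      fix v assume "v \<in> {v. limit_cycle a b \<mu> v}"
      then have "(\<lambda>t. - v t) \<in> {v. limit_cycle a b (- \<mu>) v}" by (simp add: limit_cycle_minus)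
      from imageI[OF this, of "\<lambda>v t. - v t"] show "v \<in> (\<lambda>v t. - v t) ` {v. limit_cycle a b (- \<mu>) v}" by simp
    qed
    have fin: "finite {v. limit_cycle a b (- \<mu>) v}" and card: "card {v. limit_cycle a b (- \<mu>) v} \<le> L"
      using L[of "- \<mu>" a b] False by auto
    show ?thesis
      using finite_subset[OF sub finite_imageI[OF fin]] card_mono[OF finite_imageI[OF fin] sub]
        card_image_le[OF fin, of "\<lambda>v t. - v t"] card by linarith
  qed (rule L)
  then show ?thesis by blast
qed

end
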